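(* Let $G=\mathbb{C}^*$, let $V$ be a $G$-module all of whose weights are $\pm 1$, and let $Z=V/\!\!/G$. Then $p_\infty^*\colon\mathcal{O}(Z_\infty)\to\mathcal{O}(V_\infty)^{G_\infty}$ is an isomorphism and $\mathcal{O}(Z_\infty)$ is integrally closed.
   Context: A $G$-module is a finite-dimensional rational representation. For a scheme $X$ of finite type over $\mathbb{C}$ and an integer $m\ge 0$, the jet scheme $X_m$ is characterized by functorial bijections $\mathrm{Hom}(\mathrm{Spec}\,A,X_m)\cong\mathrm{Hom}(\mathrm{Spec}\,A[t]/\langle t^{m+1}\rangle,X)$ for $\mathbb{C}$-algebras $A$; the arc space is $X_\infty=\varprojlim X_m$. $V/\!\!/G=\mathrm{Spec}(\mathcal{O}(V)^G)$ with canonical map $p\colon V\to V/\!\!/G$. By functoriality $G_\infty$ acts on $V_\infty$, and $p$ induces $p_\infty\colon V_\infty\to(V/\!\!/G)_\infty$ and $p_\infty^*\colon\mathcal{O}((V/\!\!/G)_\infty)\to\mathcal{O}(V_\infty)^{G_\infty}$. *)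

theory Defs
  imports Complex_Main "HOL-Library.Poly_Mapping" "HOL-Algebra.Polynomials" "HOL-Algebra.QuotRing"
    "HOL-Algebra.Module"
begin

section \<open>Integrally closed rings\<close>

definition frac_rel :: "('a, 'b) ring_scheme \<Rightarrow> (('a \<times> 'a) \<times> ('a \<times> 'a)) set" where
  "frac_rel R = {((a, b), (c, d)). a \<in> carrier R \<and> c \<in> carrier R \<and>
     b \<in> carrier R - {\<zero>\<^bsub>R\<^esub>} \<and> d \<in> carrier R - {\<zero>\<^bsub>R\<^esub>} \<and> a \<otimes>\<^bsub>R\<^esub> d = c \<otimes>\<^bsub>R\<^esub> b}"

definition fraction :: "('a, 'b) ring_scheme \<Rightarrow> 'a \<Rightarrow> 'a \<Rightarrow> ('a \<times> 'a) set" where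
  "fraction R a b = frac_rel R `` {(a, b)}"

definition frac_field :: "('a, 'b) ring_scheme \<Rightarrow> ('a \<times> 'a) set ring" where
  "frac_field R =
    \<lparr>carrier = (carrier R \<times> (carrier R - {\<zero>\<^bsub>R\<^esub>})) // frac_rel R,
     mult = (\<lambda>U W. \<Union>(a, b)\<in>U. \<Union>(c, d)\<in>W. fraction R (a \<otimes>\<^bsub>R\<^esub> c) (b \<otimes>\<^bsub>R\<^esub> d)),
     one = fraction R \<one>\<^bsub>R\<^esub> \<one>\<^bsub>R\<^esub>,
     zero = fraction R \<zero>\<^bsub>R\<^esub> \<one>\<^bsub>R\<^esub>,
     add = (\<lambda>U W. \<Union>(a, b)\<in>U. \<Union>(c, d)\<in>W.
       fraction R (a \<otimes>\<^bsub>R\<^esub> d \<oplus>\<^bsub>R\<^esub> c \<otimes>\<^bsub>R\<^esub> b) (b \<otimes>\<^bsub>R\<^esub> d))\<rparr>"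

text \<open>Polynomials are coefficient lists, leading coefficient first, as in
  \<^theory>\<open>HOL-Algebra.Polynomials\<close>.\<close>

definition integral_over :: "('a, 'b) ring_scheme \<Rightarrow> 'a set \<Rightarrow> 'a \<Rightarrow> bool" where
  "integral_over K S x \<longleftrightarrow>
     (\<exists>p. p \<noteq> [] \<and> set p \<subseteq> S \<and> hd p = \<one>\<^bsub>K\<^esub> \<and> ring.eval K p x = \<zero>\<^bsub>K\<^esub>)"

definition integrally_closed :: "('a, 'b) ring_scheme \<Rightarrow> bool" where
  "integrally_closed R \<longleftrightarrow> domain R \<and>
     (let S = (\<lambda>a. fraction R a \<one>\<^bsub>R\<^esub>) ` carrier R
      in \<forall>x\<in>carrier (frac_field R). integral_over (frac_field R) S x \<longrightarrow> x \<in> S)"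


section \<open>Direct limits of sequences of rings\<close>

text \<open>For a sequence of rings \<open>R m\<close> with transition maps \<open>\<tau> m n\<close>, \<open>m \<le> n\<close>.\<close>

definition dlim_rel ::
    "(nat \<Rightarrow> 'a ring) \<Rightarrow> (nat \<Rightarrow> nat \<Rightarrow> 'a \<Rightarrow> 'a) \<Rightarrow> ((nat \<times> 'a) \<times> (nat \<times> 'a)) set" where
  "dlim_rel R \<tau> = {((m, x), (n, y)). x \<in> carrier (R m) \<and> y \<in> carrier (R n) \<and>
     (\<exists>k. m \<le> k \<and> n \<le> k \<and> \<tau> m k x = \<tau> n k y)}"

definition dlim_in ::
    "(nat \<Rightarrow> 'a ring) \<Rightarrow> (nat \<Rightarrow> nat \<Rightarrow> 'a \<Rightarrow> 'a) \<Rightarrow> nat \<Rightarrow> 'a \<Rightarrow> (nat \<times> 'a) set" where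
  "dlim_in R \<tau> m x = dlim_rel R \<tau> `` {(m, x)}"

definition dlim ::
    "(nat \<Rightarrow> 'a ring) \<Rightarrow> (nat \<Rightarrow> nat \<Rightarrow> 'a \<Rightarrow> 'a) \<Rightarrow> (nat \<times> 'a) set ring" where
  "dlim R \<tau> =
    \<lparr>carrier = (SIGMA m:UNIV. carrier (R m)) // dlim_rel R \<tau>,
     mult = (\<lambda>U W. \<Union>(m, x)\<in>U. \<Union>(n, y)\<in>W. let k = max m n in
       dlim_in R \<tau> k (\<tau> m k x \<otimes>\<^bsub>R k\<^esub> \<tau> n k y)),
     one = dlim_in R \<tau> 0 \<one>\<^bsub>R 0\<^esub>,
     zero = dlim_in R \<tau> 0 \<zero>\<^bsub>R 0\<^esub>,
     add = (\<lambda>U W. \<Union>(m, x)\<in>U. \<Union>(n, y)\<in>W. let k = max m n in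
       dlim_in R \<tau> k (\<tau> m k x \<oplus>\<^bsub>R k\<^esub> \<tau> n k y))\<rparr>"


section \<open>Jet schemes and arc spaces of affine schemes\<close>

text \<open>
  A commutative \<open>\<complex>\<close>-algebra \<open>R\<close> is given by a record of type \<open>(complex, 'a) module\<close>
  (cf.\ \<^locale>\<open>algebra\<close>). For \<open>X = Spec R\<close> the jet scheme \<open>X\<^sub>m\<close> is affine; its coordinate ring
  represents the functor \<open>B \<mapsto> Hom(R, B[t]/(t\<^sup>m\<^sup>+\<^sup>1))\<close> on \<open>\<complex>\<close>-algebras. It is generated by
  symbols \<open>(a, k)\<close>, \<open>a \<in> R\<close>, \<open>k \<le> m\<close>, standing for the coefficient of \<open>t\<^sup>k\<close> in the image
  of \<open>a\<close>, with exactly the relations saying that \<open>a \<mapsto> \<Sum>\<^sub>k (a, k) t\<^sup>k\<close> is a homomorphism of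
  \<open>\<complex>\<close>-algebras modulo \<open>t\<^sup>m\<^sup>+\<^sup>1\<close>.
\<close>

type_synonym 'v cpoly = "('v \<Rightarrow>\<^sub>0 nat) \<Rightarrow>\<^sub>0 complex"

definition pvar :: "'v \<Rightarrow> 'v cpoly" where
  "pvar v = Poly_Mapping.single (Poly_Mapping.single v 1) 1"

definition pconst :: "complex \<Rightarrow> 'v cpoly" where
  "pconst c = Poly_Mapping.single 0 c"

text \<open>The \<open>\<complex>\<close>-algebra homomorphism of polynomial rings that renames variables along \<open>\<phi>\<close>,
  which need not be injective.\<close>

definition prename :: "('v \<Rightarrow> 'w) \<Rightarrow> 'v cpoly \<Rightarrow> 'w cpoly" where
  "prename \<phi> p = (\<Sum>\<mu>\<in>Poly_Mapping.keys p. pconst (Poly_Mapping.lookup p \<mu>) *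
     (\<Prod>v\<in>Poly_Mapping.keys \<mu>. pvar (\<phi> v) ^ Poly_Mapping.lookup \<mu> v))"

definition jet_poly :: "(complex, 'a, 'c) module_scheme \<Rightarrow> nat \<Rightarrow> ('a \<times> nat) cpoly ring" where
  "jet_poly R m =
    \<lparr>carrier = {p. \<forall>\<mu>\<in>Poly_Mapping.keys p. Poly_Mapping.keys \<mu> \<subseteq> carrier R \<times> {..m}},
     mult = (*), one = 1, zero = 0, add = (+)\<rparr>"

definition jet_rels :: "(complex, 'a, 'c) module_scheme \<Rightarrow> nat \<Rightarrow> ('a \<times> nat) cpoly set" where
  "jet_rels R m =
     {pvar (a \<oplus>\<^bsub>R\<^esub> b, k) - (pvar (a, k) + pvar (b, k)) | a b k.
        a \<in> carrier R \<and> b \<in> carrier R \<and> k \<le> m} \<union>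
     {pvar (a \<otimes>\<^bsub>R\<^esub> b, k) - (\<Sum>i\<le>k. pvar (a, i) * pvar (b, k - i)) | a b k.
        a \<in> carrier R \<and> b \<in> carrier R \<and> k \<le> m} \<union>
     {pvar (c \<odot>\<^bsub>R\<^esub> a, k) - pconst c * pvar (a, k) | c a k. a \<in> carrier R \<and> k \<le> m} \<union>
     {pvar (\<one>\<^bsub>R\<^esub>, k) - (if k = 0 then 1 else 0) | k. k \<le> m}"

definition jet_ideal :: "(complex, 'a, 'c) module_scheme \<Rightarrow> nat \<Rightarrow> ('a \<times> nat) cpoly set" where
  "jet_ideal R m = Idl\<^bsub>jet_poly R m\<^esub> (jet_rels R m)"

definition jet_class ::
    "(complex, 'a, 'c) module_scheme \<Rightarrow> nat \<Rightarrow> ('a \<times> nat) cpoly \<Rightarrow> ('a \<times> nat) cpoly set" where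
  "jet_class R m p = jet_ideal R m +>\<^bsub>jet_poly R m\<^esub> p"

definition jet_ring :: "(complex, 'a, 'c) module_scheme \<Rightarrow> nat \<Rightarrow> ('a \<times> nat) cpoly set ring" where
  "jet_ring R m = jet_poly R m Quot jet_ideal R m"

text \<open>The map of \<open>m\<close>-jet rings induced by a \<open>\<complex>\<close>-algebra homomorphism \<open>\<phi>\<close> into \<open>S\<close>, and
  the map \<open>\<O>(X\<^sub>m) \<rightarrow> \<O>(X\<^sub>n)\<close> dual to truncation \<open>X\<^sub>n \<rightarrow> X\<^sub>m\<close>, \<open>m \<le> n\<close>. The unions are
  over equal cosets.\<close>

definition jet_map :: "(complex, 'b, 'c) module_scheme \<Rightarrow> ('a \<Rightarrow> 'b) \<Rightarrow> nat \<Rightarrow>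
    ('a \<times> nat) cpoly set \<Rightarrow> ('b \<times> nat) cpoly set" where
  "jet_map S \<phi> m U = (\<Union>p\<in>U. jet_class S m (prename (\<lambda>(a, k). (\<phi> a, k)) p))"

definition jet_trans :: "(complex, 'a, 'c) module_scheme \<Rightarrow> nat \<Rightarrow> nat \<Rightarrow>
    ('a \<times> nat) cpoly set \<Rightarrow> ('a \<times> nat) cpoly set" where
  "jet_trans R m n U = (\<Union>p\<in>U. jet_class R n p)"

text \<open>\<open>\<O>(X\<^sub>\<infinity>)\<close> for \<open>X = Spec R\<close>: the limit \<open>X\<^sub>\<infinity>\<close> of affine schemes is the spectrum of the
  direct limit of the rings \<open>\<O>(X\<^sub>m)\<close>.\<close>

definition arc_ring ::
    "(complex, 'a, 'c) module_scheme \<Rightarrow> (nat \<times> ('a \<times> nat) cpoly set) set ring" where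
  "arc_ring R = dlim (jet_ring R) (jet_trans R)"

definition arc_map :: "(complex, 'b, 'c) module_scheme \<Rightarrow> ('a \<Rightarrow> 'b) \<Rightarrow>
    (nat \<times> ('a \<times> nat) cpoly set) set \<Rightarrow> (nat \<times> ('b \<times> nat) cpoly set) set" where
  "arc_map S \<phi> U = (\<Union>(m, x)\<in>U. dlim_in (jet_ring S) (jet_trans S) m (jet_map S \<phi> m x))"


section \<open>Algebras of regular functions\<close>

definition fun_alg :: "('x \<Rightarrow> complex) set \<Rightarrow> (complex, 'x \<Rightarrow> complex) module" where
  "fun_alg A = \<lparr>carrier = A, mult = (\<lambda>f g x. f x * g x), one = (\<lambda>x. 1),
     zero = (\<lambda>x. 0), add = (\<lambda>f g x. f x + g x), smult = (\<lambda>c f x. c * f x)\<rparr>"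

inductive_set gen_funs :: "('x \<Rightarrow> complex) set \<Rightarrow> ('x \<Rightarrow> complex) set"
  for S :: "('x \<Rightarrow> complex) set" where
  const: "(\<lambda>x. c) \<in> gen_funs S"
| gen: "f \<in> S \<Longrightarrow> f \<in> gen_funs S"
| add: "f \<in> gen_funs S \<Longrightarrow> g \<in> gen_funs S \<Longrightarrow> (\<lambda>x. f x + g x) \<in> gen_funs S"
| mult: "f \<in> gen_funs S \<Longrightarrow> g \<in> gen_funs S \<Longrightarrow> (\<lambda>x. f x * g x) \<in> gen_funs S"


section \<open>Modules for the multiplicative group\<close>

typedef cstar = "{z :: complex. z \<noteq> 0}"
  morphisms of_cstar Abs_cstar
  by (rule exI[of _ 1]) simp

setup_lifting type_definition_cstar

instantiation cstar :: comm_monoid_mult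
begin
lift_definition one_cstar :: cstar is 1 by simp
lift_definition times_cstar :: "cstar \<Rightarrow> cstar \<Rightarrow> cstar" is "(*)" by simp
instance by standard (transfer; simp add: mult_ac)+
end

text \<open>\<open>\<O>(\<complex>\<^sup>*) = \<complex>[z, z\<^sup>-\<^sup>1]\<close>\<close>

definition cstar_funs :: "(cstar \<Rightarrow> complex) set" where
  "cstar_funs = gen_funs {of_cstar, \<lambda>g. inverse (of_cstar g)}"

abbreviation linear_functional ::
    "(complex \<Rightarrow> 'v::ab_group_add \<Rightarrow> 'v) \<Rightarrow> ('v \<Rightarrow> complex) \<Rightarrow> bool" where
  "linear_functional scale l \<equiv> Vector_Spaces.linear scale (*) l"

text \<open>A finite-dimensional rational representation of \<open>\<complex>\<^sup>*\<close>: rationality means that all matrix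
  coefficients are regular functions on \<open>\<complex>\<^sup>*\<close>.\<close>

locale cstar_module = vector_space scale
  for scale :: "complex \<Rightarrow> 'v::ab_group_add \<Rightarrow> 'v" +
  fixes act :: "cstar \<Rightarrow> 'v \<Rightarrow> 'v"
  assumes finite_dim: "\<exists>B. finite B \<and> span B = UNIV"
    and act_linear: "Vector_Spaces.linear scale scale (act g)"
    and act_one: "act 1 v = v"
    and act_mult: "act (g * h) v = act g (act h v)"
    and rational: "linear_functional scale l \<Longrightarrow> (\<lambda>g. l (act g v)) \<in> cstar_funs"

definition is_weight ::
    "(complex \<Rightarrow> 'v::ab_group_add \<Rightarrow> 'v) \<Rightarrow> (cstar \<Rightarrow> 'v \<Rightarrow> 'v) \<Rightarrow> int \<Rightarrow> bool" where
  "is_weight scale act n \<longleftrightarrow> (\<exists>v. v \<noteq> 0 \<and> (\<forall>g. act g v = scale (of_cstar g powi n) v))"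

text \<open>\<open>\<O>(V)\<close> and \<open>\<O>(G \<times> V)\<close>\<close>

definition V_funs :: "(complex \<Rightarrow> 'v::ab_group_add \<Rightarrow> 'v) \<Rightarrow> ('v \<Rightarrow> complex) set" where
  "V_funs scale = gen_funs {l. linear_functional scale l}"

definition GV_funs :: "(complex \<Rightarrow> 'v::ab_group_add \<Rightarrow> 'v) \<Rightarrow> (cstar \<times> 'v \<Rightarrow> complex) set" where
  "GV_funs scale = gen_funs ({\<lambda>(g, v). of_cstar g, \<lambda>(g, v). inverse (of_cstar g)} \<union>
     {\<lambda>(g, v). l v | l. linear_functional scale l})"

text \<open>The comorphisms of the action \<open>G \<times> V \<rightarrow> V\<close> and of the projection \<open>G \<times> V \<rightarrow> V\<close>\<close>

definition action_pullback ::
    "(cstar \<Rightarrow> 'v \<Rightarrow> 'v) \<Rightarrow> ('v \<Rightarrow> complex) \<Rightarrow> cstar \<times> 'v \<Rightarrow> complex" where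
  "action_pullback act f = (\<lambda>(g, v). f (act g v))"

definition proj_pullback :: "('v \<Rightarrow> complex) \<Rightarrow> cstar \<times> 'v \<Rightarrow> complex" where
  "proj_pullback f = (\<lambda>(g, v). f v)"

text \<open>\<open>\<O>(V)\<^sup>G = \<O>(V//G)\<close>\<close>

definition invariant_funs ::
    "(complex \<Rightarrow> 'v::ab_group_add \<Rightarrow> 'v) \<Rightarrow> (cstar \<Rightarrow> 'v \<Rightarrow> 'v) \<Rightarrow> ('v \<Rightarrow> complex) set" where
  "invariant_funs scale act = {f \<in> V_funs scale. \<forall>g v. f (act g v) = f v}"

text \<open>\<open>\<O>(V\<^sub>\<infinity>)\<close> and \<open>\<O>(Z\<^sub>\<infinity>)\<close> for \<open>Z = V//G\<close>\<close>

definition arc_V where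
  "arc_V scale = arc_ring (fun_alg (V_funs scale))"

definition arc_quotient where
  "arc_quotient scale act = arc_ring (fun_alg (invariant_funs scale act))"

text \<open>\<open>\<O>(V\<^sub>\<infinity>)\<close> with invariants under the group scheme \<open>G\<^sub>\<infinity>\<close>: since passing to arcs commutes
  with products, \<open>G\<^sub>\<infinity> \<times> V\<^sub>\<infinity> = (G \<times> V)\<^sub>\<infinity>\<close>, and the action and the projection
  \<open>G\<^sub>\<infinity> \<times> V\<^sub>\<infinity> \<rightarrow> V\<^sub>\<infinity>\<close> are induced by those of \<open>G\<close> on \<open>V\<close>. A function \<open>F\<close> on \<open>V\<^sub>\<infinity>\<close> is
  invariant if its pullbacks along the two agree.\<close>

definition arc_invariants where
  "arc_invariants scale act = (arc_V scale)
     \<lparr>carrier := {F \<in> carrier (arc_V scale).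
        arc_map (fun_alg (GV_funs scale)) (action_pullback act) F =
        arc_map (fun_alg (GV_funs scale)) proj_pullback F}\<rparr>"

text \<open>\<open>p\<^sub>\<infinity>\<^sup>*\<close>, where \<open>p\<^sup>* : \<O>(Z) \<rightarrow> \<O>(V)\<close> is the inclusion\<close>

definition p_arc where
  "p_arc scale = arc_map (fun_alg (V_funs scale)) (\<lambda>f. f)"

end

theory Submission
  imports Defs "HOL-Library.Product_Lexorder" "HOL-Combinatorics.Permutations"
    "HOL-Computational_Algebra.Polynomial_FPS"
begin

text \<open>
  In coordinates \<open>x\<^sub>i\<close> of weight \<open>1\<close> and \<open>y\<^sub>j\<close> of weight \<open>-1\<close>, the ring \<open>\<O>(V\<^sub>\<infinity>)\<close> is the polynomial ring in the
  coefficients of the series \<open>x\<^sub>i(t)\<close> and \<open>y\<^sub>j(t)\<close>, and \<open>\<O>(Z)\<close> is generated by the products \<open>z\<^sub>i\<^sub>j = x\<^sub>i y\<^sub>j\<close>. Hence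
  the coefficients of the series \<open>z\<^sub>i\<^sub>j(t)\<close> generate \<open>\<O>(Z\<^sub>\<infinity>)\<close>, and the coefficients of their 2 by 2 minors vanish
  there. So it suffices that the homomorphism \<open>phi\<close> of polynomial rings, \<open>z\<^sub>i\<^sub>j(t) \<mapsto> x\<^sub>i(t) y\<^sub>j(t)\<close>, has no kernel beyond
  the ideal of these coefficients, and that its range consists of all \<open>q\<close> with \<open>q(g x, y) = q(x, g y)\<close> for
  invertible \<open>g(t)\<close>.

  Both claims are dual to statements about polynomials in \<open>s\<^sub>1, \<dots>, s\<^sub>d, t\<^sub>1, \<dots>, t\<^sub>d\<close>: a linear functional is encoded
  by its generating polynomials, the values on the products of \<open>d\<close> series \<open>x\<^sub>i(s\<^sub>a)\<close> and \<open>d\<close> series \<open>y\<^sub>j(t\<^sub>b)\<close>.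
  A functional on polynomials in the \<open>z\<^sub>i\<^sub>j\<close> that kills the minors gives polynomials on the subspaces \<open>s\<^sub>a = t\<^bsub>\<sigma> a\<^esub>\<close>
  that agree where two subspaces for permutations differing by a transposition meet, and such a family extends to
  a polynomial in \<open>s\<close> and \<open>t\<close>; thus the functional extends along \<open>phi\<close>. A functional that kills the range of
  \<open>phi\<close> has generating polynomials vanishing on all these subspaces, hence in the ideal of the coefficients of
  \<open>\<Prod>\<^sub>a (\<xi> - s\<^sub>a) - \<Prod>\<^sub>b (\<xi> - t\<^sub>b)\<close>. Multiplication by these two products is dual to scaling \<open>x\<close>, respectively \<open>y\<close>,
  by \<open>\<xi> - t\<close>, so the functional kills every invariant.

  If a quotient of invariants is integral over the invariants, then it is a polynomial because polynomial rings are
  integrally closed, and it is again invariant because the arc group acts by injective ring endomorphisms.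
\<close>

section \<open>Polynomials and substitution\<close>

text \<open>The permuted diagonals arise because equal parameters s_a = t_b turn x_i(s_a) y_j(t_b)
  into the image of the series z_ij at that parameter: composing a functional with
  \<open>phi\<close> amounts to restricting its generating polynomials to these subspaces. Three
  obstacles shape the rest. Truncated series multiply correctly only up to their order, so
  functionals are first cut down to one degree and one order n; terms of order above n are then
  invisible, and the generating functions are polynomials. Interpolation chooses an extension for
  each labelling separately, without symmetry between the letters, so it yields a functional only
  after summing over S_d x S_d; the resulting factor is nonzero in characteristic 0. Finally, the
  elements of the function algebras are functions on points, so an arc gives a homomorphism only by
  expanding functions along an actual curve. Arcs are therefore replaced by polynomial curves that
  agree with them up to the order in question, and inverses on the group by expansions of rational
  functions.\<close>

abbreviation (input) plookup where "plookup \<equiv> Poly_Mapping.lookup"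
abbreviation (input) pkeys where "pkeys \<equiv> Poly_Mapping.keys"
abbreviation (input) psingle where "psingle \<equiv> Poly_Mapping.single"

definition mval :: "('v \<Rightarrow> 'b::comm_ring_1) \<Rightarrow> ('v \<Rightarrow>\<^sub>0 nat) \<Rightarrow> 'b" where
  "mval h \<mu> = (\<Prod>v\<in>pkeys \<mu>. h v ^ plookup \<mu> v)"

lemma mval_superset:
  assumes "finite K" "pkeys \<mu> \<subseteq> K"
  shows "mval h \<mu> = (\<Prod>v\<in>K. h v ^ plookup \<mu> v)"
  unfolding mval_def
  by (rule prod.mono_neutral_left[OF assms]) (auto simp: in_keys_iff)

lemma mval_zero [simp]: "mval h 0 = 1"
  by (simp add: mval_def)

lemma mval_single [simp]: "mval h (psingle v n) = h v ^ n"
  by (simp add: mval_def)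

lemma mval_add: "mval h (\<mu> + \<nu>) = mval h \<mu> * mval h \<nu>"
proof -
  let ?K = "pkeys \<mu> \<union> pkeys \<nu>"
  have "mval h (\<mu> + \<nu>) = (\<Prod>v\<in>?K. h v ^ plookup (\<mu> + \<nu>) v)"
    by (rule mval_superset) (use Poly_Mapping.keys_add[of \<mu> \<nu>] in auto)
  also have "\<dots> = (\<Prod>v\<in>?K. h v ^ plookup \<mu> v) * (\<Prod>v\<in>?K. h v ^ plookup \<nu> v)"
    by (simp add: lookup_add power_add prod.distrib)
  also have "\<dots> = mval h \<mu> * mval h \<nu>"
    by (subst (1 2) mval_superset[of ?K]) auto
  finally show ?thesis .
qed

lemma mval_sum: "finite A \<Longrightarrow> mval h (sum f A) = (\<Prod>a\<in>A. mval h (f a))"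
  by (induction A rule: finite_induct) (auto simp: mval_add)

lemma mval_cong: "(\<And>v. v \<in> pkeys \<mu> \<Longrightarrow> h v = h' v) \<Longrightarrow> mval h \<mu> = mval h' \<mu>"
  unfolding mval_def by (rule prod.cong) auto

lemma cpoly_eq_sum_single: "p = (\<Sum>\<mu>\<in>pkeys p. psingle \<mu> (plookup p \<mu>))"
proof (rule poly_mapping_eqI)
  fix k
  have "plookup (\<Sum>\<mu>\<in>pkeys p. psingle \<mu> (plookup p \<mu>)) k
      = (\<Sum>\<mu>\<in>pkeys p. if \<mu> = k then plookup p k else 0)"
    unfolding lookup_sum by (rule sum.cong) (auto simp: lookup_single when_def)
  then show "plookup p k = plookup (\<Sum>\<mu>\<in>pkeys p. psingle \<mu> (plookup p \<mu>)) k"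
    by (auto simp: sum.delta' in_keys_iff)
qed

text \<open>The coefficient map is a parameter so that evaluation at complex points
  (\<open>c\<close> the identity) and substitution of polynomials (\<open>c = pconst\<close>) share
  one theory.\<close>

definition coef_hom :: "(complex \<Rightarrow> 'b::comm_ring_1) \<Rightarrow> bool" where
  "coef_hom c \<longleftrightarrow> c 0 = 0 \<and> c 1 = 1 \<and> (\<forall>x y. c (x + y) = c x + c y) \<and> (\<forall>x y. c (x * y) = c x * c y)"

lemma coef_hom_id: "coef_hom (\<lambda>x. x)"
  by (simp add: coef_hom_def)

lemma coef_hom_pconst: "coef_hom pconst"
  by (simp add: coef_hom_def pconst_def single_add mult_single)

definition psub :: "(complex \<Rightarrow> 'b::comm_ring_1) \<Rightarrow> ('v \<Rightarrow> 'b) \<Rightarrow> 'v cpoly \<Rightarrow> 'b" where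
  "psub c h p = (\<Sum>\<mu>\<in>pkeys p. c (plookup p \<mu>) * mval h \<mu>)"

context
  fixes c :: "complex \<Rightarrow> 'b::comm_ring_1"
  assumes c: "coef_hom c"
begin

lemma psub_superset:
  assumes "finite K" "pkeys p \<subseteq> K"
  shows "psub c h p = (\<Sum>\<mu>\<in>K. c (plookup p \<mu>) * mval h \<mu>)"
  unfolding psub_def
  by (rule sum.mono_neutral_left[OF assms]) (use c in \<open>auto simp: in_keys_iff coef_hom_def\<close>)

lemma psub_add: "psub c h (p + q) = psub c h p + psub c h q"
proof -
  let ?K = "pkeys p \<union> pkeys q"
  have "psub c h (p + q) = (\<Sum>\<mu>\<in>?K. c (plookup (p + q) \<mu>) * mval h \<mu>)"
    by (rule psub_superset) (use Poly_Mapping.keys_add[of p q] in auto)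
  also have "\<dots> = (\<Sum>\<mu>\<in>?K. c (plookup p \<mu>) * mval h \<mu>) + (\<Sum>\<mu>\<in>?K. c (plookup q \<mu>) * mval h \<mu>)"
    using c by (simp add: lookup_add coef_hom_def distrib_right sum.distrib)
  also have "\<dots> = psub c h p + psub c h q"
    by (subst (1 2) psub_superset[of ?K]) auto
  finally show ?thesis .
qed

lemma psub_single: "psub c h (psingle \<mu> a) = c a * mval h \<mu>"
  by (subst psub_superset[of "{\<mu>}"]) auto

lemma psub_zero: "psub c h 0 = 0"
  by (simp add: psub_def)

lemma psub_sum: "psub c h (sum f A) = (\<Sum>a\<in>A. psub c h (f a))"
  by (induction A rule: infinite_finite_induct) (auto simp: psub_add psub_zero)

lemma psub_one: "psub c h 1 = 1"
  using psub_single[of h 0 1] c by (simp add: coef_hom_def)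

lemma psub_mult: "psub c h (p * q) = psub c h p * psub c h q"
proof -
  have "p * q = (\<Sum>\<mu>\<in>pkeys p. psingle \<mu> (plookup p \<mu>)) * (\<Sum>\<nu>\<in>pkeys q. psingle \<nu> (plookup q \<nu>))"
    by (simp flip: cpoly_eq_sum_single)
  also have "\<dots> = (\<Sum>\<mu>\<in>pkeys p. \<Sum>\<nu>\<in>pkeys q. psingle (\<mu> + \<nu>) (plookup p \<mu> * plookup q \<nu>))"
    by (simp add: sum_product mult_single)
  finally have "psub c h (p * q) = (\<Sum>\<mu>\<in>pkeys p. \<Sum>\<nu>\<in>pkeys q.
      c (plookup p \<mu> * plookup q \<nu>) * mval h (\<mu> + \<nu>))"
    by (simp add: psub_sum psub_single)
  also have "\<dots> = psub c h p * psub c h q"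
    unfolding psub_def sum_product using c
    by (simp add: coef_hom_def mval_add mult_ac)
  finally show ?thesis .
qed

lemma psub_prod: "psub c h (prod f A) = (\<Prod>a\<in>A. psub c h (f a))"
  by (induction A rule: infinite_finite_induct) (auto simp: psub_mult psub_one)

lemma psub_power: "psub c h (p ^ n) = psub c h p ^ n"
  by (induction n) (auto simp: psub_mult psub_one)

lemma psub_uminus: "psub c h (- p) = - psub c h p"
  using psub_add[of h p "- p"] by (simp add: psub_zero eq_neg_iff_add_eq_0 add.commute)

lemma psub_diff: "psub c h (p - q) = psub c h p - psub c h q"
  using psub_add[of h p "- q"] by (simp add: psub_uminus)

lemma psub_pconst: "psub c h (pconst a) = c a"
  by (simp add: pconst_def psub_single)

lemma psub_pvar: "psub c h (pvar v) = h v"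
  using c by (simp add: pvar_def psub_single coef_hom_def)

lemmas psub_simps = psub_add psub_zero psub_sum psub_one psub_mult psub_prod psub_power psub_uminus
  psub_diff psub_pconst psub_pvar

end

section \<open>Variables of a polynomial, and induction over polynomials in given variables\<close>

definition pvars :: "'v cpoly \<Rightarrow> 'v set" where
  "pvars p = (\<Union>\<mu>\<in>pkeys p. pkeys \<mu>)"

lemma finite_pvars [simp]: "finite (pvars p)"
  by (simp add: pvars_def)

lemma pvars_add: "pvars (p + q) \<subseteq> pvars p \<union> pvars q"
  using Poly_Mapping.keys_add[of p q] by (auto simp: pvars_def)

lemma pvars_uminus [simp]: "pvars (- p) = pvars p"
  by (simp add: pvars_def Poly_Mapping.keys_def)

lemma pvars_diff: "pvars (p - q) \<subseteq> pvars p \<union> pvars q"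
  using pvars_add[of p "- q"] by simp

lemma pvars_mult: "pvars (p * q) \<subseteq> pvars p \<union> pvars q"
  using Poly_Mapping.keys_mult[of p q] Poly_Mapping.keys_add
  by (fastforce simp: pvars_def)

lemma pvars_zero [simp]: "pvars 0 = {}"
  by (simp add: pvars_def)

lemma pvars_one [simp]: "pvars 1 = {}"
  by (simp add: pvars_def)

lemma pvars_pvar [simp]: "pvars (pvar v) = {v}"
  by (simp add: pvars_def pvar_def)

lemma pvars_pconst [simp]: "pvars (pconst a) = {}"
  by (simp add: pvars_def pconst_def)

lemma pvars_sum: "pvars (sum f A) \<subseteq> (\<Union>a\<in>A. pvars (f a))"
proof (induction A rule: infinite_finite_induct)
  case (insert a A)
  then show ?case using pvars_add[of "f a" "sum f A"] by auto
qed auto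

lemma pvars_add_subset: "pvars p \<subseteq> S \<Longrightarrow> pvars q \<subseteq> S \<Longrightarrow> pvars (p + q) \<subseteq> S"
  and pvars_diff_subset: "pvars p \<subseteq> S \<Longrightarrow> pvars q \<subseteq> S \<Longrightarrow> pvars (p - q) \<subseteq> S"
  and pvars_mult_subset: "pvars p \<subseteq> S \<Longrightarrow> pvars q \<subseteq> S \<Longrightarrow> pvars (p * q) \<subseteq> S"
  using pvars_add[of p q] pvars_diff[of p q] pvars_mult[of p q] by auto

lemma psub_cong:
  assumes "\<And>v. v \<in> pvars p \<Longrightarrow> h v = h' v"
  shows "psub c h p = psub c h' p"
  unfolding psub_def by (rule sum.cong) (use assms in \<open>auto intro!: arg_cong2[of _ _ _ _ "(*)"] mval_cong simp: pvars_def\<close>)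

lemma single_eq_pvar_prod: "psingle \<mu> a = pconst a * mval pvar \<mu>"
proof -
  have pv: "pvar v ^ n = psingle (psingle v n) 1" for v :: 'a and n
    by (induction n) (auto simp: pvar_def mult_single single_add[symmetric] simp flip: single_one)
  have "mval pvar \<mu> = psingle \<mu> 1"
  proof -
    have "(\<Prod>v\<in>K. psingle (psingle v (plookup \<mu> v)) (1::complex)) = psingle (\<Sum>v\<in>K. psingle v (plookup \<mu> v)) 1"
      if "finite K" for K
      using that by (induction K rule: finite_induct) (auto simp: mult_single simp flip: single_one)
    moreover have "(\<Sum>v\<in>pkeys \<mu>. psingle v (plookup \<mu> v)) = \<mu>"
    proof (rule poly_mapping_eqI)
      fix k
      have "plookup (\<Sum>v\<in>pkeys \<mu>. psingle v (plookup \<mu> v)) k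
          = (\<Sum>v\<in>pkeys \<mu>. if v = k then plookup \<mu> k else 0)"
        unfolding lookup_sum by (rule sum.cong) (auto simp: lookup_single when_def)
      then show "plookup (\<Sum>v\<in>pkeys \<mu>. psingle v (plookup \<mu> v)) k = plookup \<mu> k"
        by (auto simp: sum.delta' in_keys_iff)
    qed
    ultimately show ?thesis by (simp add: mval_def pv)
  qed
  then show ?thesis by (simp add: pconst_def mult_single)
qed

text \<open>The bound \<open>S\<close> is carried along because the carriers of the jet rings
  consist of polynomials in restricted variables.\<close>

lemma cpoly_induct [consumes 1, case_names const var add mult]:
  assumes "pvars p \<subseteq> S"
    and "\<And>a. P (pconst a)" "\<And>v. v \<in> S \<Longrightarrow> P (pvar v)"
    and "\<And>p q. pvars p \<subseteq> S \<Longrightarrow> pvars q \<subseteq> S \<Longrightarrow> P p \<Longrightarrow> P q \<Longrightarrow> P (p + q)"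
    and "\<And>p q. pvars p \<subseteq> S \<Longrightarrow> pvars q \<subseteq> S \<Longrightarrow> P p \<Longrightarrow> P q \<Longrightarrow> P (p * q)"
  shows "P p"
proof -
  have P0: "P 0" using assms(2)[of 0] by (simp add: pconst_def)
  have P1: "P 1" using assms(2)[of 1] by (simp add: pconst_def)
  have Pm: "P (mval pvar \<mu>) \<and> pvars (mval pvar \<mu>) \<subseteq> S" if "pkeys \<mu> \<subseteq> S" for \<mu> :: "'a \<Rightarrow>\<^sub>0 nat"
  proof -
    have pw: "P (pvar v ^ n) \<and> pvars (pvar v ^ n) \<subseteq> S" if "v \<in> S" for v :: 'a and n
    proof (induction n)
      case (Suc n)
      then show ?case using assms(3)[OF that] assms(5)[of "pvar v" "pvar v ^ n"] that
          pvars_mult[of "pvar v" "pvar v ^ n"] by auto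
    qed (use P1 in auto)
    have "P (\<Prod>v\<in>K. pvar v ^ plookup \<mu> v) \<and> pvars (\<Prod>v\<in>K. pvar v ^ plookup \<mu> v) \<subseteq> S"
      if "finite K" "K \<subseteq> S" for K
      using that
    proof (induction K rule: finite_induct)
      case (insert v K)
      then show ?case using pw[of v "plookup \<mu> v"] assms(5)[of "pvar v ^ plookup \<mu> v"]
        pvars_mult_subset[of "pvar v ^ plookup \<mu> v" S] by simp
    qed (use P1 in auto)
    then show ?thesis using that by (simp add: mval_def)
  qed
  have "P (\<Sum>\<mu>\<in>K. psingle \<mu> (plookup p \<mu>)) \<and> pvars (\<Sum>\<mu>\<in>K. psingle \<mu> (plookup p \<mu>)) \<subseteq> S"
    if "finite K" "K \<subseteq> pkeys p" for K
    using that
  proof (induction K rule: finite_induct)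
    case (insert \<mu> K)
    have k: "pkeys \<mu> \<subseteq> S" using insert.prems assms(1) by (auto simp: pvars_def)
    have "P (psingle \<mu> (plookup p \<mu>)) \<and> pvars (psingle \<mu> (plookup p \<mu>)) \<subseteq> S"
      unfolding single_eq_pvar_prod
      using Pm[OF k] assms(2) assms(5)[of "pconst (plookup p \<mu>)" "mval pvar \<mu>"]
        pvars_mult[of "pconst (plookup p \<mu>)" "mval pvar \<mu>"] by auto
    then show ?case using insert assms(4)[of "psingle \<mu> (plookup p \<mu>)"] pvars_add_subset[of "psingle \<mu> (plookup p \<mu>)" S] by simp
  qed (use P0 in auto)
  from this[of "pkeys p"] show ?thesis by (simp flip: cpoly_eq_sum_single)
qed

lemma cpoly_induct' [case_names const var add mult]:
  assumes "\<And>a. P (pconst a)" "\<And>v. P (pvar v)"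
    and "\<And>p q. P p \<Longrightarrow> P q \<Longrightarrow> P (p + q)" "\<And>p q. P p \<Longrightarrow> P q \<Longrightarrow> P (p * q)"
  shows "P p"
  by (rule cpoly_induct[of p UNIV]) (use assms in auto)

abbreviation peval :: "('v \<Rightarrow> complex) \<Rightarrow> 'v cpoly \<Rightarrow> complex" where
  "peval \<equiv> psub (\<lambda>x. x)"

abbreviation psubst :: "('v \<Rightarrow> 'w cpoly) \<Rightarrow> 'v cpoly \<Rightarrow> 'w cpoly" where
  "psubst \<equiv> psub pconst"

lemmas peval_simps [simp] = psub_simps[OF coef_hom_id]
lemmas psubst_simps [simp] = psub_simps[OF coef_hom_pconst]

lemma psub_psubst:
  assumes "coef_hom c"
  shows "psub c h (psubst g p) = psub c (\<lambda>v. psub c h (g v)) p"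
  by (induction p rule: cpoly_induct') (simp_all add: psub_simps[OF assms])

lemmas peval_psubst = psub_psubst[OF coef_hom_id]
lemmas psubst_psubst = psub_psubst[OF coef_hom_pconst]

lemma psubst_pvar [simp]: "psubst pvar p = p"
  by (induction p rule: cpoly_induct') simp_all

lemma prename_eq: "prename \<phi> p = psubst (\<lambda>v. pvar (\<phi> v)) p"
  by (simp add: prename_def psub_def mval_def)

lemma pvars_psubst:
  "pvars (psubst g p) \<subseteq> (\<Union>v\<in>pvars p. pvars (g v))"
proof -
  let ?S = "\<Union>v\<in>pvars p. pvars (g v)"
  have "pvars (psubst g q) \<subseteq> ?S" if "pvars q \<subseteq> pvars p" for q
    using that
  proof (induction q rule: cpoly_induct)
    case (add a b) then show ?case using pvars_add_subset by simp
  next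
    case (mult a b) then show ?case using pvars_mult_subset by simp
  qed auto
  then show ?thesis by simp
qed

text \<open>Monomials are pairwise distinct characters of the monoid of points, so Dedekind's argument applies.\<close>

lemma sum_characters_eq_0:
  fixes \<chi> :: "'i \<Rightarrow> 'p \<Rightarrow> 'c::idom" and m :: "'p \<Rightarrow> 'p \<Rightarrow> 'p"
  assumes "finite K"
    and "\<And>i a b. i \<in> K \<Longrightarrow> \<chi> i (m a b) = \<chi> i a * \<chi> i b"
    and "\<And>i. i \<in> K \<Longrightarrow> \<exists>a. \<chi> i a \<noteq> 0"
    and "\<And>i j. i \<in> K \<Longrightarrow> j \<in> K \<Longrightarrow> i \<noteq> j \<Longrightarrow> \<exists>a. \<chi> i a \<noteq> \<chi> j a"
    and "\<And>a. (\<Sum>i\<in>K. c i * \<chi> i a) = 0"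
    and "i \<in> K"
  shows "c i = 0"
  using assms
proof (induction K arbitrary: c i rule: finite_induct)
  case (insert j K)
  have "c i = 0" if i: "i \<in> K" for i
  proof -
    obtain b where b: "\<chi> i b \<noteq> \<chi> j b"
      using insert.prems(3)[of i j] insert.hyps i by auto
    have "(\<Sum>i\<in>K. c i * (\<chi> i b - \<chi> j b) * \<chi> i a) = 0" for a
    proof -
      have "(\<Sum>i\<in>insert j K. c i * \<chi> i (m a b)) - \<chi> j b * (\<Sum>i\<in>insert j K. c i * \<chi> i a) = 0"
        using insert.prems(4) by simp
      moreover have "(\<Sum>i\<in>insert j K. c i * \<chi> i (m a b)) = (\<Sum>i\<in>insert j K. c i * (\<chi> i a * \<chi> i b))"
        by (rule sum.cong) (use insert.prems(1) in auto)
      ultimately have "(\<Sum>i\<in>insert j K. c i * (\<chi> i a * \<chi> i b) - \<chi> j b * (c i * \<chi> i a)) = 0"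
        by (simp only: sum_subtractf sum_distrib_left)
      then show ?thesis using insert.hyps by (simp add: algebra_simps)
    qed
    then have "c i * (\<chi> i b - \<chi> j b) = 0"
      using insert.IH[of "\<lambda>i. c i * (\<chi> i b - \<chi> j b)" i] insert.prems(1,2,3) i by blast
    then show ?thesis using b by simp
  qed
  moreover from this have "c j * \<chi> j a = 0" for a
    using insert.prems(4)[of a] insert.hyps by simp
  then have "c j = 0" using insert.prems(2)[of j] by auto
  ultimately show ?case using insert.prems(5) by auto
qed auto

lemma peval_eq_0D:
  assumes "\<And>a. peval a p = 0"
  shows "p = 0"
proof -
  have "plookup p \<mu> = 0" if mu: "\<mu> \<in> pkeys p" for \<mu>
  proof -
    have 1: "mval (\<lambda>v. a v * b v) \<mu> = mval a \<mu> * mval b \<mu>" for \<mu> and a b :: "'a \<Rightarrow> complex"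
      by (simp add: mval_def power_mult_distrib prod.distrib)
    have 2: "\<exists>a. mval a \<mu> \<noteq> (0::complex)" for \<mu> :: "'a \<Rightarrow>\<^sub>0 nat"
      by (rule exI[of _ "\<lambda>_. 1"]) (simp add: mval_def)
    have 3: "\<exists>a. mval a \<mu> \<noteq> (mval a \<nu> :: complex)" if ne: "\<mu> \<noteq> \<nu>" for \<mu> \<nu> :: "'a \<Rightarrow>\<^sub>0 nat"
    proof -
      have "\<exists>v. plookup \<mu> v \<noteq> plookup \<nu> v"
      proof (rule ccontr)
        assume *: "\<not> (\<exists>v. plookup \<mu> v \<noteq> plookup \<nu> v)"
        have "\<mu> = \<nu>" by (rule poly_mapping_eqI) (use * in simp)
        then show False using ne by simp
      qed
      then obtain v where v: "plookup \<mu> v \<noteq> plookup \<nu> v" ..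
      \<comment> \<open>The point with coordinate 2 at \<open>v\<close> and 1 elsewhere reads off
        the exponent of \<open>v\<close>; norms turn the powers into real ones, where the exponent
        is determined.\<close>
      have m: "mval (\<lambda>w. if w = v then 2 else 1 :: complex) \<mu> = 2 ^ plookup \<mu> v" for \<mu>
      proof -
        have "mval (\<lambda>w. if w = v then 2 else 1 :: complex) \<mu> =
            (\<Prod>w\<in>insert v (pkeys \<mu>). (if w = v then 2 else 1) ^ plookup \<mu> w)"
          by (rule mval_superset) auto
        also have "\<dots> = (\<Prod>w\<in>insert v (pkeys \<mu>). if w = v then 2 ^ plookup \<mu> v else 1)"
          by (rule prod.cong) auto
        finally show ?thesis by simp
      qed
      have "(2::complex) ^ plookup \<mu> v \<noteq> 2 ^ plookup \<nu> v"
      proof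
        assume "(2::complex) ^ plookup \<mu> v = 2 ^ plookup \<nu> v"
        then have "norm ((2::complex) ^ plookup \<mu> v) = norm ((2::complex) ^ plookup \<nu> v)" by simp
        then show False using v by (simp add: norm_power)
      qed
      then show ?thesis
        using m[of \<mu>] m[of \<nu>] by (intro exI[of _ "\<lambda>w. if w = v then 2 else 1"]) simp
    qed
    show ?thesis
      by (rule sum_characters_eq_0[where K = "pkeys p" and c = "plookup p" and i = \<mu>
            and \<chi> = "\<lambda>\<mu> a. mval a \<mu>" and m = "\<lambda>a b v. a v * b v", OF finite_keys 1 2 3 _ mu])
        (use assms in \<open>simp_all add: psub_def\<close>)
  qed
  then have "plookup p \<mu> = 0" for \<mu> by (cases "\<mu> \<in> pkeys p") (auto simp: in_keys_iff)
  then show ?thesis by (simp add: poly_mapping_eqI)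
qed

lemma peval_eqI:
  assumes "\<And>a. peval a p = peval a q"
  shows "p = q"
  using peval_eq_0D[of "p - q"] assms by simp

section \<open>Interpolation on the permuted diagonals\<close>

text \<open>Both substitutions agree modulo \<open>d\<close> on variables, and congruences are
  preserved by sums and products.\<close>

lemma psubst_dvd_diff:
  fixes h h' :: "'v \<Rightarrow> 'w cpoly"
  assumes "\<And>v. d dvd h v - h' v"
  shows "d dvd psubst h p - psubst h' p"
proof (induction p rule: cpoly_induct')
  case (add p q)
  then show ?case by (simp add: add_diff_add)
next
  case (mult p q)
  have "psubst h (p * q) - psubst h' (p * q) =
      (psubst h p - psubst h' p) * psubst h q + psubst h' p * (psubst h q - psubst h' q)"
    by (simp add: algebra_simps)
  then show ?case using mult by (simp add: dvd_add dvd_mult dvd_mult2)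
qed (use assms in auto)

lemma pvar_inject [simp]: "pvar u = pvar v \<longleftrightarrow> u = v"
  by (metis pvars_pvar singleton_inject)

text \<open>Replacing \<open>u\<close> by \<open>v\<close> changes nothing modulo
  \<open>pvar u - pvar v\<close>; the polynomial \<open>y\<close> itself is its substitution along
  \<open>pvar\<close>.\<close>

lemma pvar_diff_dvd:
  fixes y :: "'v cpoly"
  assumes "psubst (pvar(u := pvar v)) y = 0"
  shows "pvar u - pvar v dvd y"
  using psubst_dvd_diff[of "pvar u - pvar v" pvar "pvar(u := pvar v)" y] assms by simp

lemma psubst_eq_0_of_pvar_diff_dvd:
  assumes "pvar u - pvar v dvd x"
  shows "psubst (pvar(u := pvar v)) x = 0"
  using assms by (auto simp: dvd_def)

text \<open>\<open>pvar u - pvar v\<close> is prime, as it generates the kernel of the substitution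
  \<open>u := v\<close> into an integral domain.\<close>

lemma pvar_diff_dvd_cancel:
  fixes x y :: "nat cpoly"
  assumes "pvar u - pvar v dvd x * y" "psubst (pvar(u := pvar v)) x \<noteq> 0"
  shows "pvar u - pvar v dvd y"
  by (rule pvar_diff_dvd) (use psubst_eq_0_of_pvar_diff_dvd[OF assms(1)] assms(2) in simp)

lemma prod_pvar_diff_dvd:
  fixes x :: "nat cpoly"
  assumes "finite C" "b \<notin> C" "\<And>c. c \<in> C \<Longrightarrow> pvar b - pvar c dvd x"
  shows "(\<Prod>c\<in>C. pvar b - pvar c) dvd x"
  using assms
proof (induction C rule: finite_induct)
  case (insert c C)
  then obtain y where y: "x = (\<Prod>c\<in>C. pvar b - pvar c) * y" by (auto simp: dvd_def)
  have "pvar b - pvar c dvd y"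
    by (rule pvar_diff_dvd_cancel[of _ _ "\<Prod>c\<in>C. pvar b - pvar c"])
      (use insert y in \<open>auto simp: prod_zero_iff\<close>)
  then show ?case using insert.hyps y by (auto simp: dvd_def mult_ac)
qed auto

text \<open>Values outside \<open>A\<close> are frozen to those of \<open>\<omega>\<close>: once
  \<open>a0\<close> is matched with \<open>b\<close>, the match is recorded in
  \<open>\<omega>\<close> and the induction runs over smaller sets, while
  \<open>diag \<sigma>\<close> still sees all variables.\<close>

definition pairings :: "nat set \<Rightarrow> nat set \<Rightarrow> (nat \<Rightarrow> nat) \<Rightarrow> (nat \<Rightarrow> nat) set" where
  "pairings A B \<omega> = {\<sigma>. bij_betw \<sigma> A B \<and> (\<forall>a. a \<notin> A \<longrightarrow> \<sigma> a = \<omega> a)}"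

text \<open>The polynomial ring in variables \<open>s\<^sub>a = (False, a)\<close> and \<open>t\<^sub>b = (True, b)\<close>; \<open>diag \<sigma>\<close> restricts
  to the subspace \<open>s\<^sub>a = t\<^bsub>\<sigma> a\<^esub>\<close>.\<close>

definition diag :: "(nat \<Rightarrow> nat) \<Rightarrow> (bool \<times> nat) cpoly \<Rightarrow> nat cpoly" where
  "diag \<sigma> = psubst (\<lambda>(k, a). pvar (if k then a else \<sigma> a))"

lemma diag_simps [simp]:
  "diag \<sigma> (p + q) = diag \<sigma> p + diag \<sigma> q" "diag \<sigma> (p * q) = diag \<sigma> p * diag \<sigma> q"
  "diag \<sigma> (p - q) = diag \<sigma> p - diag \<sigma> q" "diag \<sigma> (prod f A) = (\<Prod>a\<in>A. diag \<sigma> (f a))"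
  "diag \<sigma> (pvar (k, a)) = pvar (if k then a else \<sigma> a)"
  by (simp_all add: diag_def)

text \<open>The subspaces for the two permutations meet where t_u = t_v. So these congruences are
  necessary for a family to come from one polynomial; interpolation shows that they suffice.\<close>

lemma diag_transpose_dvd: "pvar u - pvar v dvd diag \<sigma> G - diag (transpose u v \<circ> \<sigma>) G"
  unfolding diag_def
proof (rule psubst_dvd_diff)
  fix ka :: "bool \<times> nat"
  obtain k a where ka: "ka = (k, a)" by (cases ka)
  have "pvar u - pvar v dvd (pvar v - pvar u :: nat cpoly)"
    by (metis dvd_minus_iff dvd_refl minus_diff_eq)
  then show "pvar u - pvar v dvd (case ka of (k, a) \<Rightarrow> pvar (if k then a else \<sigma> a)) -
      (case ka of (k, a) \<Rightarrow> pvar (if k then a else (transpose u v \<circ> \<sigma>) a))"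
    by (auto simp: ka transpose_def)
qed

lemma transpose_pairing:
  assumes "\<sigma> \<in> pairings A B \<omega>" "u \<in> B" "v \<in> B" "\<And>a. a \<notin> A \<Longrightarrow> \<omega> a \<notin> B"
  shows "transpose u v \<circ> \<sigma> \<in> pairings A B \<omega>"
proof -
  have "bij_betw (transpose u v) B B"
    using permutes_swap_id[OF assms(2,3)] by (rule permutes_imp_bij)
  then have "bij_betw (transpose u v \<circ> \<sigma>) A B"
    using assms(1) bij_betw_trans unfolding pairings_def by blast
  moreover have "transpose u v (\<omega> a) = \<omega> a" if "a \<notin> A" for a
    using assms(2-4) that by (metis transpose_apply_other)
  ultimately show ?thesis using assms(1) by (auto simp: pairings_def)
qed

lemma pairings_fix:
  assumes "a0 \<in> A" "b \<in> B"
  shows "{\<sigma> \<in> pairings A B \<omega>. \<sigma> a0 = b} = pairings (A - {a0}) (B - {b}) (\<omega>(a0 := b))"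
proof (intro equalityI subsetI)
  fix \<sigma> assume s: "\<sigma> \<in> {\<sigma> \<in> pairings A B \<omega>. \<sigma> a0 = b}"
  then have "bij_betw \<sigma> (A - {a0}) (B - {b})"
    using assms bij_betw_DiffI[of \<sigma> A B "{a0}" "{b}"] by (auto simp: pairings_def bij_betw_def)
  then show "\<sigma> \<in> pairings (A - {a0}) (B - {b}) (\<omega>(a0 := b))"
    using s by (auto simp: pairings_def)
next
  fix \<sigma> assume s: "\<sigma> \<in> pairings (A - {a0}) (B - {b}) (\<omega>(a0 := b))"
  then have b: "\<sigma> a0 = b" by (auto simp: pairings_def)
  have "bij_betw \<sigma> (insert a0 (A - {a0})) (insert b (B - {b}))"
    using s b by (subst b[symmetric], intro notIn_Un_bij_betw3[THEN iffD1, of a0 "A - {a0}" \<sigma> "B - {b}", unfolded Un_insert_right Un_empty_right])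
      (auto simp: pairings_def)
  then have "bij_betw \<sigma> A B" using assms by (simp add: insert_absorb)
  then show "\<sigma> \<in> {\<sigma> \<in> pairings A B \<omega>. \<sigma> a0 = b}"
    using s b assms by (auto simp: pairings_def)
qed

text \<open>Newton interpolation in \<open>s\<^bsub>a0\<^esub>\<close> at the nodes \<open>t\<^sub>b\<close>; the divided differences stay polynomial
  because of the congruences.\<close>

theorem diag_interpolation:
  fixes f :: "(nat \<Rightarrow> nat) \<Rightarrow> nat cpoly"
  assumes "finite A" "finite B" "card A = card B" "\<And>a. a \<notin> A \<Longrightarrow> \<omega> a \<notin> B"
    and "\<And>\<sigma> u v. \<sigma> \<in> pairings A B \<omega> \<Longrightarrow> u \<in> B \<Longrightarrow> v \<in> B \<Longrightarrow> u \<noteq> v \<Longrightarrow>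
      pvar u - pvar v dvd f \<sigma> - f (transpose u v \<circ> \<sigma>)"
  shows "\<exists>G. \<forall>\<sigma>\<in>pairings A B \<omega>. diag \<sigma> G = f \<sigma>"
  using assms
proof (induction "card A" arbitrary: A B \<omega> f)
  case 0
  then have "A = {}" "B = {}" by auto
  then have "\<sigma> = \<omega>" if "\<sigma> \<in> pairings A B \<omega>" for \<sigma>
    using that by (auto simp: pairings_def)
  moreover have "diag \<omega> (psubst (\<lambda>b. pvar (True, b)) (f \<omega>)) = f \<omega>"
    by (simp add: diag_def psubst_psubst)
  ultimately show ?case by blast
next
  case (Suc n)
  then obtain a0 where a0: "a0 \<in> A" by (metis card.empty ex_in_conv nat.distinct(1))
  \<comment> \<open>\<open>C\<close> collects the values of \<open>\<sigma> a0\<close> for which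
    \<open>G\<close> is already correct.\<close>
  have "\<exists>G. \<forall>\<sigma>\<in>pairings A B \<omega>. \<sigma> a0 \<in> C \<longrightarrow> diag \<sigma> G = f \<sigma>" if "finite C" "C \<subseteq> B" for C
    using that
  proof (induction C rule: finite_induct)
    case (insert b C)
    then obtain G0 where G0: "\<And>\<sigma>. \<sigma> \<in> pairings A B \<omega> \<Longrightarrow> \<sigma> a0 \<in> C \<Longrightarrow> diag \<sigma> G0 = f \<sigma>" by auto
    have b: "b \<in> B" using insert by simp
    let ?P = "\<Prod>c\<in>C. pvar b - pvar c :: nat cpoly"
    let ?S = "pairings (A - {a0}) (B - {b}) (\<omega>(a0 := b))"
    note S = pairings_fix[OF a0 b, of \<omega>]
    have SD: "\<sigma> \<in> pairings A B \<omega> \<and> \<sigma> a0 = b" if "\<sigma> \<in> ?S" for \<sigma> using that S by blast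
    \<comment> \<open>For \<open>c\<close> in \<open>C\<close>, composing \<open>\<sigma>\<close>
      with the transposition of \<open>b\<close> and \<open>c\<close> gives a pairing with value
      \<open>c\<close> at \<open>a0\<close>, where \<open>G0\<close> is correct; hence the error at
      \<open>\<sigma>\<close> is divisible by t_b - t_c.\<close>
    have "?P dvd f \<sigma> - diag \<sigma> G0" if s: "\<sigma> \<in> ?S" for \<sigma>
    proof (rule prod_pvar_diff_dvd)
      fix c assume c: "c \<in> C"
      let ?\<sigma>' = "transpose b c \<circ> \<sigma>"
      have s': "?\<sigma>' \<in> pairings A B \<omega>"
        by (rule transpose_pairing) (use SD[OF s] b c insert.prems Suc.prems in auto)
      have "?\<sigma>' a0 = c" using SD[OF s] by simp
      then have e: "diag ?\<sigma>' G0 = f ?\<sigma>'" using G0[OF s'] c by simp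
      have "pvar b - pvar c dvd diag \<sigma> G0 - diag ?\<sigma>' G0"
        by (rule diag_transpose_dvd)
      moreover have "pvar b - pvar c dvd f \<sigma> - f ?\<sigma>'"
        by (rule Suc.prems(5)) (use SD[OF s] b c insert.prems insert.hyps in auto)
      ultimately have "pvar b - pvar c dvd (f \<sigma> - f ?\<sigma>') - (diag \<sigma> G0 - diag ?\<sigma>' G0)"
        by (rule dvd_diff[rotated])
      then show "pvar b - pvar c dvd f \<sigma> - diag \<sigma> G0" using e by simp
    qed (use insert in auto)
    then have "\<forall>\<sigma>\<in>?S. \<exists>y. f \<sigma> - diag \<sigma> G0 = ?P * y" by (simp add: dvd_def)
    then obtain f' where f': "\<And>\<sigma>. \<sigma> \<in> ?S \<Longrightarrow> f \<sigma> - diag \<sigma> G0 = ?P * f' \<sigma>" by (metis (no_types))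
    have "\<exists>G. \<forall>\<sigma>\<in>?S. diag \<sigma> G = f' \<sigma>"
    proof (rule Suc.hyps(1))
      show "n = card (A - {a0})" "card (A - {a0}) = card (B - {b})"
        using Suc.hyps(2) Suc.prems(1-3) a0 b by auto
      fix \<sigma> u v assume s: "\<sigma> \<in> ?S" and u: "u \<in> B - {b}" and v: "v \<in> B - {b}" and uv: "u \<noteq> v"
      let ?\<sigma>' = "transpose u v \<circ> \<sigma>"
      have s': "?\<sigma>' \<in> ?S"
        by (rule transpose_pairing) (use s u v Suc.prems(4) in auto)
      have "pvar u - pvar v dvd diag \<sigma> G0 - diag ?\<sigma>' G0"
        by (rule diag_transpose_dvd)
      moreover have "pvar u - pvar v dvd f \<sigma> - f ?\<sigma>'"
        by (rule Suc.prems(5)) (use SD[OF s] u v uv in auto)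
      ultimately have "pvar u - pvar v dvd (f \<sigma> - f ?\<sigma>') - (diag \<sigma> G0 - diag ?\<sigma>' G0)"
        by (rule dvd_diff[rotated])
      moreover have "(f \<sigma> - f ?\<sigma>') - (diag \<sigma> G0 - diag ?\<sigma>' G0) = ?P * (f' \<sigma> - f' ?\<sigma>')"
        using f'[OF s] f'[OF s'] by (simp add: algebra_simps)
      ultimately have "pvar u - pvar v dvd ?P * (f' \<sigma> - f' ?\<sigma>')" by simp
      \<comment> \<open>\<open>u\<close> and \<open>v\<close> differ from \<open>b\<close>, so no
        factor t_b - t_c of \<open>?P\<close> vanishes when t_u is replaced by t_v.\<close>
      then show "pvar u - pvar v dvd f' \<sigma> - f' ?\<sigma>'"
        by (rule pvar_diff_dvd_cancel) (use insert u v uv in \<open>auto simp: prod_zero_iff\<close>)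
    qed (use Suc.prems in auto)
    then obtain G1 where G1: "\<And>\<sigma>. \<sigma> \<in> ?S \<Longrightarrow> diag \<sigma> G1 = f' \<sigma>" by blast
    \<comment> \<open>The correction vanishes on pairings with \<open>\<sigma> a0\<close> in
      \<open>C\<close> and becomes \<open>?P * f' \<sigma>\<close> on those with value
      \<open>b\<close>.\<close>
    let ?G = "G0 + (\<Prod>c\<in>C. pvar (False, a0) - pvar (True, c)) * G1"
    have "diag \<sigma> ?G = f \<sigma>" if s: "\<sigma> \<in> pairings A B \<omega>" "\<sigma> a0 \<in> insert b C" for \<sigma>
    proof (cases "\<sigma> a0 = b")
      case True
      then have s': "\<sigma> \<in> ?S" using s S by blast
      show ?thesis using f'[OF s'] G1[OF s'] True by (simp add: algebra_simps)
    next
      case False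
      then have "\<sigma> a0 \<in> C" using s by simp
      then have "(\<Prod>c\<in>C. pvar (\<sigma> a0) - pvar c :: nat cpoly) = 0"
        using insert.hyps by (auto simp: prod_zero_iff)
      then show ?thesis using G0[OF s(1) \<open>\<sigma> a0 \<in> C\<close>] by simp
    qed
    then show ?case by blast
  qed auto
  from this[of B] obtain G where "\<forall>\<sigma>\<in>pairings A B \<omega>. \<sigma> a0 \<in> B \<longrightarrow> diag \<sigma> G = f \<sigma>"
    using Suc.prems(2) by blast
  moreover have "\<sigma> a0 \<in> B" if "\<sigma> \<in> pairings A B \<omega>" for \<sigma>
    using that a0 by (auto simp: pairings_def bij_betw_def)
  ultimately show ?case by blast
qed

text \<open>Unlike for \<open>diag\<close>, the target is again the ring in all s and t, and only
  the s_a with \<open>a\<close> in \<open>A\<close> are replaced, so that the equations s_a = t_b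
  can be imposed one after the other.\<close>

definition pdiag :: "nat set \<Rightarrow> (nat \<Rightarrow> nat) \<Rightarrow> (bool \<times> nat) cpoly \<Rightarrow> (bool \<times> nat) cpoly" where
  "pdiag A \<sigma> = psubst (\<lambda>(k, a). if \<not> k \<and> a \<in> A then pvar (True, \<sigma> a) else pvar (k, a))"

lemma pdiag_simps [simp]:
  "pdiag A \<sigma> (p + q) = pdiag A \<sigma> p + pdiag A \<sigma> q" "pdiag A \<sigma> (p * q) = pdiag A \<sigma> p * pdiag A \<sigma> q"
  "pdiag A \<sigma> (p - q) = pdiag A \<sigma> p - pdiag A \<sigma> q" "pdiag A \<sigma> (prod f C) = (\<Prod>a\<in>C. pdiag A \<sigma> (f a))"
  "pdiag A \<sigma> (sum f C) = (\<Sum>a\<in>C. pdiag A \<sigma> (f a))"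
  "pdiag A \<sigma> 0 = 0" "pdiag A \<sigma> 1 = 1"
  "pdiag A \<sigma> (pvar (k, a)) = (if \<not> k \<and> a \<in> A then pvar (True, \<sigma> a) else pvar (k, a))"
  by (simp_all add: pdiag_def)

text \<open>Up to sign, the coefficients are the differences of the elementary symmetric polynomials
  in the s_a and in the t_b.\<close>

definition root_diff :: "nat set \<Rightarrow> nat set \<Rightarrow> (bool \<times> nat) cpoly poly" where
  "root_diff A B = (\<Prod>a\<in>A. [:- pvar (False, a), 1:]) - (\<Prod>b\<in>B. [:- pvar (True, b), 1:])"

section \<open>Ideals generated by the coefficients of a polynomial\<close>

definition coeff_ideal :: "'a::comm_ring_1 poly \<Rightarrow> 'a set" where
  "coeff_ideal E = {p. \<exists>H. p = (\<Sum>k\<le>degree E. coeff E k * H k)}"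

lemma coeff_ideal_add: "p \<in> coeff_ideal E \<Longrightarrow> q \<in> coeff_ideal E \<Longrightarrow> p + q \<in> coeff_ideal E"
  unfolding coeff_ideal_def
proof safe
  fix H H' show "\<exists>K. (\<Sum>k\<le>degree E. coeff E k * H k) + (\<Sum>k\<le>degree E. coeff E k * H' k) =
      (\<Sum>k\<le>degree E. coeff E k * K k)"
    by (rule exI[of _ "\<lambda>k. H k + H' k"]) (simp add: algebra_simps sum.distrib)
qed

lemma coeff_ideal_mult: "p \<in> coeff_ideal E \<Longrightarrow> p * q \<in> coeff_ideal E"
  unfolding coeff_ideal_def
proof safe
  fix H show "\<exists>K. (\<Sum>k\<le>degree E. coeff E k * H k) * q = (\<Sum>k\<le>degree E. coeff E k * K k)"
    by (rule exI[of _ "\<lambda>k. H k * q"]) (simp add: sum_distrib_right mult.assoc)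
qed

lemma coeff_ideal_0: "0 \<in> coeff_ideal E"
  unfolding coeff_ideal_def by (auto intro!: exI[of _ "\<lambda>_. 0"])

lemma coeff_in_coeff_ideal: "coeff E k \<in> coeff_ideal E"
proof (cases "k \<le> degree E")
  case True
  then show ?thesis unfolding coeff_ideal_def
    by (auto intro!: exI[of _ "\<lambda>j. if j = k then 1 else 0"] simp: if_distrib cong: if_cong)
next
  case False
  then show ?thesis by (simp add: coeff_eq_0 coeff_ideal_0)
qed

lemma coeff_ideal_sum: "(\<And>a. a \<in> A \<Longrightarrow> f a \<in> coeff_ideal E) \<Longrightarrow> sum f A \<in> coeff_ideal E"
  by (induction A rule: infinite_finite_induct) (auto simp: coeff_ideal_0 coeff_ideal_add)

lemma poly_in_coeff_ideal: "poly E x \<in> coeff_ideal E"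
  unfolding poly_altdef by (intro coeff_ideal_sum coeff_ideal_mult coeff_in_coeff_ideal)

lemma coeff_linear_mult:
  "coeff ([:- x, 1:] * p) k = (case k of 0 \<Rightarrow> 0 | Suc k \<Rightarrow> coeff p k) - x * coeff p k"
  for x :: "'a::comm_ring_1"
  by (cases k) (simp_all add: coeff_pCons)

lemma pdiag_coeff_roots:
  assumes "finite C"
  shows "pdiag A \<sigma> (coeff (\<Prod>a\<in>C. [:- x a, 1:]) k) = coeff (\<Prod>a\<in>C. [:- pdiag A \<sigma> (x a), 1:]) k"
  using assms
proof (induction C arbitrary: k rule: finite_induct)
  case empty
  then show ?case by (cases k) auto
next
  case (insert a C)
  then show ?case
    by (simp add: coeff_linear_mult del: mult_pCons_left split: nat.split)
qed

lemma pdiag_coeff_root_diff: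
  assumes "finite A" "finite B" "bij_betw \<sigma> A B"
  shows "pdiag A \<sigma> (coeff (root_diff A B) k) = 0"
proof -
  have "(\<Prod>a\<in>A. [:- pdiag A \<sigma> (pvar (False, a)), 1:]) = (\<Prod>a\<in>A. [:- pvar (True, \<sigma> a), 1:])"
    by (rule prod.cong) auto
  also have "\<dots> = (\<Prod>b\<in>B. [:- pvar (True, b), 1:])"
    by (rule prod.reindex_bij_betw[OF assms(3)])
  finally show ?thesis
    using assms(1,2) by (simp add: root_diff_def pdiag_coeff_roots)
qed

lemma pdiag_coeff_ideal:
  assumes "finite A" "finite B" "bij_betw \<sigma> A B" "x \<in> coeff_ideal (root_diff A B)"
  shows "pdiag A \<sigma> x = 0"
  using assms(4) pdiag_coeff_root_diff[OF assms(1-3)] by (auto simp: coeff_ideal_def)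

text \<open>The linear factor is monic: modulo \<open>K\<close>, \<open>coeff q k\<close> is
  \<open>t\<close> times \<open>coeff q (Suc k)\<close>, so membership descends from the degree of
  \<open>q\<close>.\<close>

lemma coeff_mem_of_linear_mult:
  fixes q :: "'a::comm_ring_1 poly"
  assumes "\<And>k. coeff ([:- t, 1:] * q) k \<in> K" "0 \<in> K"
    and "\<And>x y. x \<in> K \<Longrightarrow> y \<in> K \<Longrightarrow> x + y \<in> K" "\<And>x y. x \<in> K \<Longrightarrow> x * y \<in> K"
  shows "coeff q k \<in> K"
proof -
  have "coeff q k \<in> K" if "degree q - k \<le> n \<and> degree q \<le> k + n" for n k
    using that
  proof (induction n arbitrary: k)
    case 0
    have "coeff ([:- t, 1:] * q) (Suc k) = coeff q k - t * coeff q (Suc k)"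
      by (simp add: coeff_linear_mult del: mult_pCons_left)
    then have "coeff ([:- t, 1:] * q) (Suc k) = coeff q k"
      using 0 by (simp add: coeff_eq_0)
    then show ?case using assms(1) by metis
  next
    case (Suc n)
    have "coeff q k = coeff ([:- t, 1:] * q) (Suc k) + coeff q (Suc k) * t"
      by (simp add: coeff_linear_mult algebra_simps del: mult_pCons_left)
    moreover have "coeff q (Suc k) \<in> K" by (rule Suc.IH) (use Suc.prems in auto)
    ultimately show ?case using assms by metis
  qed
  from this[of k "degree q"] show ?thesis by simp
qed

text \<open>For a fixed \<open>a0\<close>, \<open>G\<close> is divided successively by the s_a0 -
  t_c modulo the ideal. The remainder at a node \<open>b\<close> is the restriction to s_a0 = t_b;
  it vanishes on the diagonals of the remaining indices, so by induction it lies in the smaller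
  coefficient ideal, which is contained in the large one modulo s_a0 - t_b.\<close>

theorem vanishing_on_diagonals:
  assumes "finite A" "finite B" "card A = card B"
    and "\<And>\<sigma>. bij_betw \<sigma> A B \<Longrightarrow> pdiag A \<sigma> G = 0"
  shows "G \<in> coeff_ideal (root_diff A B)"
  using assms
proof (induction "card A" arbitrary: A B G)
  case 0
  then have AB: "A = {}" "B = {}" by auto
  have "pdiag {} \<sigma> G = psubst pvar G" for \<sigma>
    unfolding pdiag_def by (rule psub_cong) auto
  moreover have "pdiag A id G = 0" by (rule 0) (simp add: AB bij_betw_def)
  ultimately have "G = 0" using AB by simp
  then show ?case by (simp add: coeff_ideal_0)
next
  case (Suc n)
  then obtain a0 where a0: "a0 \<in> A" by (metis card.empty ex_in_conv nat.distinct(1))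
  let ?J = "coeff_ideal (root_diff A B)"
  let ?s = "pvar (False, a0) :: (bool \<times> nat) cpoly" and ?t = "\<lambda>b. pvar (True, b) :: (bool \<times> nat) cpoly"
  have "\<exists>j\<in>?J. \<exists>H. G = j + (\<Prod>c\<in>C. ?s - ?t c) * H" if "finite C" "C \<subseteq> B" for C
    using that
  proof (induction C rule: finite_induct)
    case empty
    show ?case by (intro bexI[of _ 0] exI[of _ G]) (simp_all add: coeff_ideal_0)
  next
    case (insert b C)
    then obtain j H where j: "j \<in> ?J" and G: "G = j + (\<Prod>c\<in>C. ?s - ?t c) * H" by auto
    let ?A = "A - {a0}" and ?B = "B - {b}"
    have b: "b \<in> B" using insert by simp
    let ?H = "pdiag {a0} (\<lambda>_. b) H"
    let ?K = "{x. \<exists>j\<in>?J. \<exists>q. x = j + (?s - ?t b) * q}"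
    have "?H \<in> coeff_ideal (root_diff ?A ?B)"
    proof (rule Suc.hyps(1))
      show "n = card ?A" "card ?A = card ?B"
        using Suc.hyps(2) Suc.prems(1-3) a0 b by auto
      fix \<sigma> assume s: "bij_betw \<sigma> ?A ?B"
      let ?\<sigma> = "\<sigma>(a0 := b)"
      have "bij_betw ?\<sigma> ?A ?B" using s by (subst bij_betw_cong[of _ _ \<sigma>]) auto
      then have "bij_betw ?\<sigma> (?A \<union> {a0}) (?B \<union> {?\<sigma> a0})"
        by (intro notIn_Un_bij_betw) auto
      then have s': "bij_betw ?\<sigma> A B" using a0 b by (simp add: insert_absorb)
      have "pdiag A ?\<sigma> G = 0" by (rule Suc.prems(4)[OF s'])
      moreover have "pdiag A ?\<sigma> j = 0" by (rule pdiag_coeff_ideal[OF _ _ s' j]) (use Suc.prems in auto)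
      ultimately have "(\<Prod>c\<in>C. ?t b - ?t c) * pdiag A ?\<sigma> H = 0"
        using a0 by (simp add: G)
      moreover have "(\<Prod>c\<in>C. ?t b - ?t c) \<noteq> 0" using insert.hyps by (auto simp: prod_zero_iff)
      ultimately have "pdiag A ?\<sigma> H = 0" by simp
      moreover have "pdiag ?A \<sigma> ?H = pdiag A ?\<sigma> H"
        unfolding pdiag_def psubst_psubst by (rule psub_cong) (use a0 in auto)
      ultimately show "pdiag ?A \<sigma> ?H = 0" by simp
    qed (use Suc.prems in auto)
    \<comment> \<open>Modulo s_a0 - t_b, both products in \<open>root_diff A B\<close> contain the
      linear factor with root t_b, and this monic factor can be cancelled.\<close>
    moreover have "coeff (root_diff ?A ?B) k \<in> ?K" for k
    proof (rule coeff_mem_of_linear_mult)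
      have A: "(\<Prod>a\<in>A. [:- pvar (False, a), 1:] :: (bool \<times> nat) cpoly poly) =
            [:- ?s, 1:] * (\<Prod>a\<in>?A. [:- pvar (False, a), 1:])"
        using Suc.prems(1) a0 by (subst prod.remove[of _ a0]) auto
      have B: "(\<Prod>a\<in>B. [:- ?t a, 1:]) = [:- ?t b, 1:] * (\<Prod>a\<in>?B. [:- ?t a, 1:])"
        using Suc.prems(2) b by (subst prod.remove[of _ b]) auto
      have L: "[:- ?t b, 1:] * root_diff ?A ?B = root_diff A B +
          smult (?s - ?t b) (\<Prod>a\<in>?A. [:- pvar (False, a), 1:])"
      proof -
        have "[:- ?t b, 1:] = [:- ?s, 1:] + [:?s - ?t b:]" by simp
        then have "[:- ?t b, 1:] * (\<Prod>a\<in>?A. [:- pvar (False, a), 1:]) =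
            [:- ?s, 1:] * (\<Prod>a\<in>?A. [:- pvar (False, a), 1:]) +
            smult (?s - ?t b) (\<Prod>a\<in>?A. [:- pvar (False, a), 1:])"
          by (simp only: distrib_right) simp
        then show ?thesis unfolding root_diff_def A B right_diff_distrib by simp
      qed
      show "coeff ([:- ?t b, 1:] * root_diff ?A ?B) k \<in> ?K" for k
        unfolding L using coeff_in_coeff_ideal[of "root_diff A B" k] by auto
      show "0 \<in> ?K" using coeff_ideal_0 by (auto intro!: bexI[of _ 0] exI[of _ 0])
      show "x + y \<in> ?K" if "x \<in> ?K" "y \<in> ?K" for x y
      proof -
        from that obtain j q j' q' where jj: "j \<in> ?J" "j' \<in> ?J"
            and xy: "x = j + (?s - ?t b) * q" "y = j' + (?s - ?t b) * q'"
          by blast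
        have "x + y = (j + j') + (?s - ?t b) * (q + q')"
          unfolding xy by (simp add: algebra_simps)
        then show ?thesis using coeff_ideal_add[OF jj] by blast
      qed
      show "x * y \<in> ?K" if "x \<in> ?K" for x y
      proof -
        from that obtain j q where j: "j \<in> ?J" and x: "x = j + (?s - ?t b) * q" by blast
        have "x * y = j * y + (?s - ?t b) * (q * y)"
          unfolding x by (simp add: algebra_simps)
        then show ?thesis using coeff_ideal_mult[OF j] by blast
      qed
    qed
    then have "\<exists>j q. \<forall>k. j k \<in> ?J \<and> coeff (root_diff ?A ?B) k = j k + (?s - ?t b) * q k"
      by (simp add: Bex_def) metis
    then obtain jk qk where jk: "\<And>k. jk k \<in> ?J"
        "\<And>k. coeff (root_diff ?A ?B) k = jk k + (?s - ?t b) * qk k" by blast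
    ultimately obtain h where h: "?H = (\<Sum>k\<le>degree (root_diff ?A ?B). (jk k + (?s - ?t b) * qk k) * h k)"
      by (auto simp: coeff_ideal_def)
    define j1 where "j1 = (\<Sum>k\<le>degree (root_diff ?A ?B). jk k * h k)"
    have j1: "j1 \<in> ?J" unfolding j1_def by (intro coeff_ideal_sum coeff_ideal_mult jk)
    have H1: "?H = j1 + (?s - ?t b) * (\<Sum>k\<le>degree (root_diff ?A ?B). qk k * h k)"
      unfolding h j1_def by (simp add: algebra_simps sum.distrib sum_distrib_left sum_subtractf)
    have "?s - ?t b dvd psubst pvar H - ?H"
      unfolding pdiag_def by (rule psubst_dvd_diff) auto
    then obtain q where "H - ?H = (?s - ?t b) * q" by (auto simp: dvd_def)
    then have H2: "H = j1 + (?s - ?t b) * ((\<Sum>k\<le>degree (root_diff ?A ?B). qk k * h k) + q)"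
      using H1 by (simp add: algebra_simps)
    have "G = (j + (\<Prod>c\<in>C. ?s - ?t c) * j1) +
        (\<Prod>c\<in>insert b C. ?s - ?t c) * ((\<Sum>k\<le>degree (root_diff ?A ?B). qk k * h k) + q)"
      unfolding G prod.insert[OF insert.hyps(1,2)]
      by (subst H2) (simp only: distrib_left mult_ac add_ac)
    moreover have "j + (\<Prod>c\<in>C. ?s - ?t c) * j1 \<in> ?J"
      using coeff_ideal_add[OF j coeff_ideal_mult[OF j1, of "\<Prod>c\<in>C. ?s - ?t c"]] by (simp add: mult.commute)
    ultimately show ?case by blast
  qed
  from this[of B] obtain j H where jH: "j \<in> ?J" "G = j + (\<Prod>c\<in>B. ?s - ?t c) * H"
    using Suc.prems(2) by blast
  \<comment> \<open>The product over \<open>A\<close> vanishes at its root s_a0, so the full product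
    of the s_a0 - t_c is minus a value of \<open>root_diff A B\<close> and belongs to the
    ideal.\<close>
  have "poly (root_diff A B) ?s = - (\<Prod>c\<in>B. ?s - ?t c)"
    using Suc.prems(1) a0 by (auto simp: root_diff_def poly_prod prod_zero_iff)
  then have "poly (root_diff A B) ?s * - H = (\<Prod>c\<in>B. ?s - ?t c) * H" by simp
  then have "(\<Prod>c\<in>B. ?s - ?t c) * H \<in> ?J"
    using coeff_ideal_mult[OF poly_in_coeff_ideal, of "root_diff A B" ?s "- H"] by simp
  then show ?case using jH coeff_ideal_add by blast
qed

section \<open>Linear functionals on polynomial rings\<close>

lemma pconst_zero [simp]: "pconst 0 = 0" and pconst_one [simp]: "pconst 1 = 1"
  and pconst_add: "pconst (a + b) = pconst a + pconst b"
  and pconst_mult: "pconst (a * b) = pconst a * pconst b"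
  by (simp_all add: pconst_def single_add mult_single)

lemma pconst_uminus: "pconst (- a) = - pconst a"
  by (simp add: pconst_def single_uminus)

lemma pconst_power: "pconst (a ^ n) = pconst a ^ n"
  by (induction n) (auto simp: pconst_mult)

lemma pconst_prod: "pconst (prod f A) = (\<Prod>a\<in>A. pconst (f a))"
  by (induction A rule: infinite_finite_induct) (auto simp: pconst_mult)

interpretation cpoly: vector_space "\<lambda>c (p :: 'v cpoly). pconst c * p"
  by unfold_locales (simp_all add: pconst_add pconst_mult algebra_simps)

text \<open>Monomials form a basis, so every linear functional has this form; working with the
  values on monomials gives direct access to gradings and generating polynomials.\<close>

definition lext :: "(('v \<Rightarrow>\<^sub>0 nat) \<Rightarrow> complex) \<Rightarrow> 'v cpoly \<Rightarrow> complex" where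
  "lext \<phi> p = (\<Sum>m\<in>pkeys p. plookup p m * \<phi> m)"

lemma lext_superset:
  assumes "finite K" "pkeys p \<subseteq> K"
  shows "lext \<phi> p = (\<Sum>m\<in>K. plookup p m * \<phi> m)"
  unfolding lext_def
  by (rule sum.mono_neutral_left[OF assms]) (auto simp: in_keys_iff)

lemma lext_zero [simp]: "lext \<phi> 0 = 0"
  by (simp add: lext_def)

lemma lext_add [simp]: "lext \<phi> (p + q) = lext \<phi> p + lext \<phi> q"
proof -
  let ?K = "pkeys p \<union> pkeys q"
  have "lext \<phi> (p + q) = (\<Sum>\<mu>\<in>?K. plookup (p + q) \<mu> * \<phi> \<mu>)"
    by (rule lext_superset) (use Poly_Mapping.keys_add[of p q] in auto)
  also have "\<dots> = (\<Sum>\<mu>\<in>?K. plookup p \<mu> * \<phi> \<mu>) + (\<Sum>\<mu>\<in>?K. plookup q \<mu> * \<phi> \<mu>)"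
    by (simp add: lookup_add distrib_right sum.distrib)
  also have "\<dots> = lext \<phi> p + lext \<phi> q"
    by (subst (1 2) lext_superset[of ?K]) auto
  finally show ?thesis .
qed

lemma lext_single [simp]: "lext \<phi> (psingle m c) = c * \<phi> m"
  by (subst lext_superset[of "{m}"]) auto

lemma lext_sum [simp]: "lext \<phi> (sum f A) = (\<Sum>a\<in>A. lext \<phi> (f a))"
  by (induction A rule: infinite_finite_induct) auto

lemma lext_uminus [simp]: "lext \<phi> (- p) = - lext \<phi> p"
  using lext_add[of \<phi> p "- p"] by (simp add: eq_neg_iff_add_eq_0 add.commute)

lemma lext_diff [simp]: "lext \<phi> (p - q) = lext \<phi> p - lext \<phi> q"
  using lext_add[of \<phi> p "- q"] by simp

lemma single_mult_eq_sum: "psingle m c * p = (\<Sum>\<mu>\<in>pkeys p. psingle (m + \<mu>) (c * plookup p \<mu>))"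
proof -
  have "psingle m c * p = psingle m c * (\<Sum>\<mu>\<in>pkeys p. psingle \<mu> (plookup p \<mu>))"
    by (simp flip: cpoly_eq_sum_single)
  then show ?thesis by (simp add: sum_distrib_left mult_single)
qed

lemma lext_single_mult: "lext \<phi> (psingle m c * p) = c * lext (\<lambda>\<mu>. \<phi> (m + \<mu>)) p"
  unfolding single_mult_eq_sum lext_def[of _ p] by (simp add: sum_distrib_left mult_ac)

lemma lext_pconst_mult [simp]: "lext \<phi> (pconst c * p) = c * lext \<phi> p"
  by (simp add: pconst_def lext_single_mult)

lemma lookup_pconst_mult [simp]: "plookup (pconst c * p) m = c * plookup p m"
  by (simp add: pconst_def single_mult_eq_sum lookup_sum lookup_single when_def in_keys_iff)

lemma single_eq_pconst_mult: "psingle m c = pconst c * psingle m 1"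
  by (simp add: pconst_def mult_single)

lemma lext_psubst: "lext \<phi> (psubst h p) = lext (\<lambda>m. lext \<phi> (psubst h (psingle m 1))) p"
proof -
  have "psubst h p = (\<Sum>m\<in>pkeys p. pconst (plookup p m) * psubst h (psingle m 1))"
    by (simp add: psub_single[OF coef_hom_pconst] psub_def)
  then show ?thesis by (simp add: lext_def[of _ p])
qed

text \<open>A basis of the span of \<open>S\<close> stays independent when \<open>f\<close> is
  added, and a linear map can be prescribed on it.\<close>

lemma functional_separation:
  assumes "f \<notin> cpoly.span S"
  obtains \<phi> where "\<And>s. s \<in> S \<Longrightarrow> lext \<phi> s = 0" "lext \<phi> f \<noteq> 0"
proof -
  interpret c: vector_space "(*) :: complex \<Rightarrow> complex \<Rightarrow> complex"
    by unfold_locales (simp_all add: algebra_simps)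
  interpret vp: vector_space_pair "\<lambda>c (p :: 'a cpoly). pconst c * p" "(*) :: complex \<Rightarrow> complex \<Rightarrow> complex" ..
  obtain B where B: "B \<subseteq> S" "cpoly.independent B" "S \<subseteq> cpoly.span B"
    using cpoly.maximal_independent_subset by blast
  have fB: "f \<notin> cpoly.span B" using assms cpoly.span_mono[OF B(1)] by blast
  then have "cpoly.independent (insert f B)"
    using B(2) by (simp add: cpoly.independent_insert)
  from vp.linear_independent_extend[OF this, of "\<lambda>x. if x = f then 1 else 0"]
  obtain g where g: "Vector_Spaces.linear (\<lambda>c (p :: 'a cpoly). pconst c * p) (*) g"
    and gB: "\<And>x. x \<in> insert f B \<Longrightarrow> g x = (if x = f then 1 else 0)" by blast
  interpret g: Vector_Spaces.linear "\<lambda>c (p :: 'a cpoly). pconst c * p" "(*)" g by (rule g)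
  have g0: "g x = 0" if "x \<in> cpoly.span B" for x
    using that
  proof (induction rule: cpoly.span_induct_alt)
    case base show ?case by (rule g.zero)
  next
    case (step c x y)
    have "x \<noteq> f" using fB step(1) cpoly.span_base by blast
    then show ?case using step gB[of x] by (simp add: g.add g.scale)
  qed
  have ge: "lext (\<lambda>m. g (psingle m 1)) p = g p" for p
  proof -
    have "g p = g (\<Sum>m\<in>pkeys p. pconst (plookup p m) * psingle m 1)"
      by (simp flip: single_eq_pconst_mult cpoly_eq_sum_single)
    then show ?thesis by (simp add: g.sum g.scale lext_def)
  qed
  show ?thesis
    by (rule that[of "\<lambda>m. g (psingle m 1)"]) (use g0 B(3) gB[of f] in \<open>auto simp: ge\<close>)
qed

text \<open>Each element of \<open>S\<close> is homogeneous, so every homogeneous component of a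
  functional killing \<open>S\<close> kills \<open>S\<close> as well, and some component is nonzero
  at \<open>f\<close>.\<close>

lemma graded_functional_separation:
  fixes gr :: "('v \<Rightarrow>\<^sub>0 nat) \<Rightarrow> 'g"
  assumes "f \<notin> cpoly.span S" and hom: "\<And>s. s \<in> S \<Longrightarrow> \<exists>g. \<forall>m\<in>pkeys s. gr m = g"
  obtains \<phi> g where "\<And>s. s \<in> S \<Longrightarrow> lext \<phi> s = 0" "lext \<phi> f \<noteq> 0" "\<And>m. gr m \<noteq> g \<Longrightarrow> \<phi> m = 0"
proof -
  obtain \<phi> where \<phi>: "\<And>s. s \<in> S \<Longrightarrow> lext \<phi> s = 0" "lext \<phi> f \<noteq> 0"
    using functional_separation[OF assms(1)] by blast
  define \<psi> where "\<psi> g m = (if gr m = g then \<phi> m else 0)" for g m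
  have "lext \<phi> f = (\<Sum>m\<in>pkeys f. \<Sum>g\<in>gr ` pkeys f. plookup f m * \<psi> g m)"
    unfolding lext_def by (rule sum.cong) (auto simp: \<psi>_def if_distrib cong: if_cong)
  also have "\<dots> = (\<Sum>g\<in>gr ` pkeys f. lext (\<psi> g) f)"
    unfolding lext_def by (rule sum.swap)
  finally have "\<exists>g. lext (\<psi> g) f \<noteq> 0"
    using \<phi>(2) by (metis (mono_tags, lifting) sum.neutral)
  then obtain g where g: "lext (\<psi> g) f \<noteq> 0" ..
  have "lext (\<psi> g) s = 0" if s: "s \<in> S" for s
  proof -
    obtain g' where g': "\<forall>m\<in>pkeys s. gr m = g'" using hom[OF s] by blast
    then have "lext (\<psi> g) s = (if g' = g then lext \<phi> s else 0)"
      unfolding lext_def \<psi>_def by (auto intro!: sum.cong sum.neutral)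
    then show ?thesis using \<phi>(1)[OF s] by simp
  qed
  then show ?thesis using g by (intro that[of "\<psi> g" g]) (auto simp: \<psi>_def)
qed

text \<open>\<open>wsum (\<lambda>_. 1)\<close> is the degree of a monomial and
  \<open>wsum snd\<close> its total order in the arc parameter; weights 0 and 1 count the letters of
  one kind.\<close>

definition wsum :: "('v \<Rightarrow> nat) \<Rightarrow> ('v \<Rightarrow>\<^sub>0 nat) \<Rightarrow> nat" where
  "wsum w m = (\<Sum>v\<in>pkeys m. plookup m v * w v)"

lemma wsum_superset:
  assumes "finite K" "pkeys m \<subseteq> K"
  shows "wsum w m = (\<Sum>v\<in>K. plookup m v * w v)"
  unfolding wsum_def
  by (rule sum.mono_neutral_left[OF assms]) (auto simp: in_keys_iff)

lemma wsum_add [simp]: "wsum w (m + n) = wsum w m + wsum w n"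
proof -
  let ?K = "pkeys m \<union> pkeys n"
  have "wsum w (m + n) = (\<Sum>\<mu>\<in>?K. plookup (m + n) \<mu> * w \<mu>)"
    by (rule wsum_superset) (use Poly_Mapping.keys_add[of m n] in auto)
  also have "\<dots> = (\<Sum>\<mu>\<in>?K. plookup m \<mu> * w \<mu>) + (\<Sum>\<mu>\<in>?K. plookup n \<mu> * w \<mu>)"
    by (simp add: lookup_add distrib_right sum.distrib)
  also have "\<dots> = wsum w m + wsum w n"
    by (subst (1 2) wsum_superset[of ?K]) auto
  finally show ?thesis .
qed

lemma wsum_zero [simp]: "wsum w 0 = 0"
  by (simp add: wsum_def)

lemma wsum_single [simp]: "wsum w (psingle v n) = n * w v"
  by (subst wsum_superset[of "{v}"]) auto

lemma wsum_sum [simp]: "wsum w (sum f A) = (\<Sum>a\<in>A. wsum w (f a))"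
  by (induction A rule: infinite_finite_induct) auto

lemma monomial_induct [case_names zero add]:
  fixes m :: "'v \<Rightarrow>\<^sub>0 nat"
  assumes "P 0" "\<And>m v. P m \<Longrightarrow> P (m + psingle v 1)"
  shows "P m"
proof (induction "wsum (\<lambda>_. 1) m" arbitrary: m)
  case 0
  then have "plookup m v = 0" for v
    by (cases "v \<in> pkeys m") (auto simp: wsum_def in_keys_iff)
  then have "m = 0" by (simp add: poly_mapping_eqI)
  then show ?case using assms by simp
next
  case (Suc n)
  then have "m \<noteq> 0" by auto
  then obtain v where v: "v \<in> pkeys m" by (metis keys_eq_empty all_not_in_conv poly_mapping_eqI lookup_zero in_keys_iff)
  define m' where "m' = m - psingle v 1"
  have m: "m = m' + psingle v 1"
    by (rule poly_mapping_eqI)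
      (use v in \<open>auto simp: m'_def lookup_add lookup_minus lookup_single when_def in_keys_iff\<close>)
  then have "n = wsum (\<lambda>_. 1) m'" using Suc(2) by simp
  then show ?case using Suc(1) assms(2) m by metis
qed

text \<open>In a product of two series truncated at \<open>n\<close>, the coefficients up to
  \<open>n\<close> are complete Cauchy sums; the remaining terms all have order above
  \<open>n\<close>.\<close>

lemma sum_square_split:
  fixes g :: "nat \<Rightarrow> nat \<Rightarrow> 'a::comm_monoid_add"
  shows "(\<Sum>k\<le>n. \<Sum>l\<le>n. g k l) =
    (\<Sum>c\<le>n. \<Sum>k\<le>c. g k (c - k)) + (\<Sum>(k, l)\<in>{(k, l). k \<le> n \<and> l \<le> n \<and> n < k + l}. g k l)"
proof -
  have fin: "finite {(k, l). k \<le> n \<and> l \<le> n \<and> n < k + l}"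
    by (rule finite_subset[of _ "{..n} \<times> {..n}"]) auto
  have fin': "finite {(k, l). k + l \<le> n}"
    by (rule finite_subset[of _ "{..n} \<times> {..n}"]) auto
  have "(\<Sum>k\<le>n. \<Sum>l\<le>n. g k l) = (\<Sum>(k, l)\<in>{..n} \<times> {..n}. g k l)"
    by (simp add: sum.cartesian_product)
  also have "{..n} \<times> {..n} = {(k, l). k + l \<le> n} \<union> {(k, l). k \<le> n \<and> l \<le> n \<and> n < k + l}" by auto
  also have "(\<Sum>(k, l)\<in>\<dots>. g k l) = (\<Sum>(k, l)\<in>{(k, l). k + l \<le> n}. g k l) +
      (\<Sum>(k, l)\<in>{(k, l). k \<le> n \<and> l \<le> n \<and> n < k + l}. g k l)"
    by (rule sum.union_disjoint) (use fin fin' in auto)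
  also have "(\<Sum>(k, l)\<in>{(k, l). k + l \<le> n}. g k l) = (\<Sum>c\<le>n. \<Sum>k\<le>c. g k (c - k))"
    by (rule sum.triangle_reindex_eq)
  finally show ?thesis .
qed

section \<open>Symmetrized coefficient functionals\<close>

text \<open>Letters of a word sit at the places \<open>(b, a)\<close>, \<open>a < d\<close>: the place carries the variable of
  label \<open>(b, lab (b, a))\<close> and order \<open>e (b, a)\<close>. The variables \<open>x\<^sub>i\<^sup>(\<^sup>k\<^sup>)\<close> and \<open>y\<^sub>j\<^sup>(\<^sup>k\<^sup>)\<close> are
  \<open>((False, i), k)\<close> and \<open>((True, j), k)\<close>.\<close>

type_synonym place = "bool \<times> nat"
type_synonym xy_poly = "((bool \<times> nat) \<times> nat) cpoly"

definition letter :: "(place \<Rightarrow> nat) \<Rightarrow> (place \<Rightarrow> nat) \<Rightarrow> place \<Rightarrow> (bool \<times> nat) \<times> nat" where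
  "letter lab e p = ((fst p, lab p), e p)"

definition word :: "place set \<Rightarrow> (place \<Rightarrow> nat) \<Rightarrow> (place \<Rightarrow> nat) \<Rightarrow> (bool \<times> nat) \<times> nat \<Rightarrow>\<^sub>0 nat" where
  "word P lab e = (\<Sum>p\<in>P. psingle (letter lab e p) 1)"

text \<open>A place does double duty: it holds a letter of a word, and it is one of the variables
  s_a, t_b, whose exponent records the order of that letter.\<close>

definition expo :: "place set \<Rightarrow> (place \<Rightarrow> nat) \<Rightarrow> place \<Rightarrow>\<^sub>0 nat" where
  "expo P e = (\<Sum>p\<in>P. psingle p (e p))"

definition places :: "nat \<Rightarrow> place set" where
  "places d = UNIV \<times> {..<d}"

definition place_perms :: "nat \<Rightarrow> (place \<Rightarrow> place) set" where
  "place_perms d = {\<pi>. \<pi> permutes places d \<and> (\<forall>p. fst (\<pi> p) = fst p)}"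

lemma finite_places [simp]: "finite (places d)"
  by (simp add: places_def)

lemma finite_place_perms [simp]: "finite (place_perms d)"
  by (rule finite_subset[OF _ finite_permutations[of "places d"]]) (auto simp: place_perms_def)

lemma id_in_place_perms: "id \<in> place_perms d"
  by (simp add: place_perms_def permutes_id)

lemma place_perms_compose:
  "\<alpha> \<in> place_perms d \<Longrightarrow> \<pi> \<in> place_perms d \<Longrightarrow> \<alpha> \<circ> \<pi> \<in> place_perms d"
  by (auto simp: place_perms_def intro: permutes_compose simp del: split_paired_All)

lemma place_perms_inv:
  assumes "\<alpha> \<in> place_perms d"
  shows "inv_into UNIV \<alpha> \<in> place_perms d"
proof -
  have p: "\<alpha> permutes places d" using assms by (simp add: place_perms_def)
  have "fst (inv_into UNIV \<alpha> p) = fst p" for p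
    using assms permutes_inverses(1)[OF p, of p] unfolding place_perms_def
    by (metis (mono_tags, lifting) mem_Collect_eq)
  then show ?thesis using permutes_inv[OF p] by (simp add: place_perms_def)
qed

lemma sum_place_perms_compose:
  assumes "\<alpha> \<in> place_perms d"
  shows "(\<Sum>\<pi>\<in>place_perms d. f (\<alpha> \<circ> \<pi>)) = (\<Sum>\<pi>\<in>place_perms d. f \<pi>)"
proof (rule sum.reindex_bij_witness[of _ "\<lambda>\<pi>. inv_into UNIV \<alpha> \<circ> \<pi>" "\<lambda>\<pi>. \<alpha> \<circ> \<pi>"])
  have p: "\<alpha> permutes places d" using assms by (simp add: place_perms_def)
  show "inv_into UNIV \<alpha> \<circ> (\<alpha> \<circ> \<pi>) = \<pi>" "\<alpha> \<circ> (inv_into UNIV \<alpha> \<circ> \<pi>) = \<pi>" for \<pi>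
    using permutes_inverses[OF p] by (auto simp: fun_eq_iff)
qed (use assms place_perms_compose place_perms_inv in auto)

text \<open>The coefficient of \<open>H lab\<close> at \<open>expo (places d) e\<close> is meant as
  a value on \<open>word (places d) lab e\<close>, but \<open>H\<close> need not respect
  rearrangements of the letters; the sum over S_d x S_d enforces this. It is not divided by the
  group order, hence the later factor \<open>card (place_perms d)\<close>. \<open>restrict\<close>
  makes labels off the places irrelevant.\<close>

definition sym_coeff ::
    "((place \<Rightarrow> nat) \<Rightarrow> place cpoly) \<Rightarrow> nat \<Rightarrow> (place \<Rightarrow> nat) \<Rightarrow> (place \<Rightarrow> nat) \<Rightarrow> complex" where
  "sym_coeff H d lab e = (\<Sum>\<pi>\<in>place_perms d.
     plookup (H (restrict (lab \<circ> \<pi>) (places d))) (expo (places d) (e \<circ> \<pi>)))"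

text \<open>A word determines \<open>lab\<close> and \<open>e\<close> only up to \<open>place_perms d\<close>, under which \<open>sym_coeff\<close> is invariant, so the
  choice in \<open>word_val\<close> does not matter.\<close>

definition word_val ::
    "((place \<Rightarrow> nat) \<Rightarrow> place cpoly) \<Rightarrow> nat \<Rightarrow> ((bool \<times> nat) \<times> nat \<Rightarrow>\<^sub>0 nat) \<Rightarrow> complex" where
  "word_val H d m = (if \<exists>lab e. m = word (places d) lab e
     then let (lab, e) = SOME (lab, e). m = word (places d) lab e in sym_coeff H d lab e else 0)"

definition Psi :: "((place \<Rightarrow> nat) \<Rightarrow> place cpoly) \<Rightarrow> nat \<Rightarrow> xy_poly \<Rightarrow> complex" where
  "Psi H d = lext (word_val H d)"

lemma lookup_word: 
  assumes "finite P"
  shows "plookup (word P lab e) v = card {p \<in> P. letter lab e p = v}"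
  using assms by (simp add: word_def lookup_sum lookup_single when_def sum.If_cases Int_def)

text \<open>Equal words have equal multisets of letters. The kind x or y is part of the letter, so a
  matching permutation preserves it.\<close>

lemma word_eq_imp_perm:
  assumes "word (places d) lab e = word (places d) lab' e'"
  obtains \<alpha> where "\<alpha> \<in> place_perms d"
    "\<And>p. p \<in> places d \<Longrightarrow> lab p = lab' (\<alpha> p) \<and> e p = e' (\<alpha> p)"
proof -
  have "image_mset (letter lab e) (mset_set (places d)) = image_mset (letter lab' e') (mset_set (places d))"
  proof (rule multiset_eqI)
    fix v
    have "{p \<in> places d. letter lab e p = v} = {p. p \<in> places d \<and> v = letter lab e p}"
      "{p \<in> places d. letter lab' e' p = v} = {p. p \<in> places d \<and> v = letter lab' e' p}" by auto
    then show "count (image_mset (letter lab e) (mset_set (places d))) v =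
        count (image_mset (letter lab' e') (mset_set (places d))) v"
      using arg_cong[OF assms, of "\<lambda>m. plookup m v"]
      by (simp add: lookup_word count_image_mset' sum.If_cases Int_def conj_commute)
  qed
  from image_mset_eq_implies_permutes[OF finite_places this]
  obtain \<alpha> where a: "\<alpha> permutes places d" "\<forall>p\<in>places d. letter lab e p = letter lab' e' (\<alpha> p)" by blast
  have "fst (\<alpha> p) = fst p" for p
    using a by (cases "p \<in> places d") (auto simp: letter_def permutes_not_in)
  then show ?thesis using a by (intro that[of \<alpha>]) (auto simp: place_perms_def letter_def)
qed

lemma expo_cong: "(\<And>p. p \<in> P \<Longrightarrow> e p = e' p) \<Longrightarrow> expo P e = expo P e'"
  unfolding expo_def by (rule sum.cong) auto

lemma word_cong:
  "(\<And>p. p \<in> P \<Longrightarrow> lab p = lab' p \<and> e p = e' p) \<Longrightarrow> word P lab e = word P lab' e'"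
  unfolding word_def letter_def by (rule sum.cong) auto

lemma sym_coeff_word_cong:
  assumes "word (places d) lab e = word (places d) lab' e'"
  shows "sym_coeff H d lab e = sym_coeff H d lab' e'"
proof -
  obtain \<alpha> where a: "\<alpha> \<in> place_perms d"
    "\<And>p. p \<in> places d \<Longrightarrow> lab p = lab' (\<alpha> p) \<and> e p = e' (\<alpha> p)"
    using word_eq_imp_perm[OF assms] by blast
  have "sym_coeff H d lab e = (\<Sum>\<pi>\<in>place_perms d.
     plookup (H (restrict (lab' \<circ> (\<alpha> \<circ> \<pi>)) (places d))) (expo (places d) (e' \<circ> (\<alpha> \<circ> \<pi>))))"
    unfolding sym_coeff_def
  proof (rule sum.cong[OF refl])
    fix \<pi> assume "\<pi> \<in> place_perms d"
    then have pp: "lab (\<pi> p) = lab' (\<alpha> (\<pi> p)) \<and> e (\<pi> p) = e' (\<alpha> (\<pi> p))" if "p \<in> places d" for p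
      using that a(2)[of "\<pi> p"] by (simp add: place_perms_def permutes_in_image)
    have "restrict (lab \<circ> \<pi>) (places d) = restrict (lab' \<circ> (\<alpha> \<circ> \<pi>)) (places d)"
      by (rule restrict_ext) (use pp in simp)
    moreover have "expo (places d) (e \<circ> \<pi>) = expo (places d) (e' \<circ> (\<alpha> \<circ> \<pi>))"
      by (rule expo_cong) (use pp in simp)
    ultimately show "plookup (H (restrict (lab \<circ> \<pi>) (places d))) (expo (places d) (e \<circ> \<pi>)) =
        plookup (H (restrict (lab' \<circ> (\<alpha> \<circ> \<pi>)) (places d))) (expo (places d) (e' \<circ> (\<alpha> \<circ> \<pi>)))"
      by simp
  qed
  also have "\<dots> = sym_coeff H d lab' e'"
    unfolding sym_coeff_def
    by (rule sum_place_perms_compose[OF a(1), of "\<lambda>\<pi>. plookup (H (restrict (lab' \<circ> \<pi>) (places d)))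
        (expo (places d) (e' \<circ> \<pi>))"])
  finally show ?thesis .
qed

lemma word_val_word: "word_val H d (word (places d) lab e) = sym_coeff H d lab e"
proof -
  have ex: "\<exists>le. (case le of (lab', e') \<Rightarrow> word (places d) lab e = word (places d) lab' e')"
    by auto
  obtain lab' e' where s: "(SOME (lab', e'). word (places d) lab e = word (places d) lab' e') = (lab', e')"
    by (metis surj_pair)
  then have "word (places d) lab e = word (places d) lab' e'"
    using someI_ex[OF ex] by simp
  then show ?thesis
    unfolding word_val_def using s sym_coeff_word_cong[of d lab' e' lab e H] by auto
qed

lemma word_degree: 
  assumes "finite P"
  shows "wsum (\<lambda>v. if fst (fst v) = b then 1 else 0) (word P lab e) = card {p \<in> P. fst p = b}"
  using assms by (simp add: word_def letter_def sum.If_cases Int_def)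

text \<open>Unequal numbers of x and y letters are needed to write every monomial as a word; only
  words on \<open>places d\<close> can have a nonzero \<open>word_val\<close>.\<close>

definition places2 :: "nat \<Rightarrow> nat \<Rightarrow> place set" where
  "places2 d e = {False} \<times> {..<d} \<union> {True} \<times> {..<e}"

lemma finite_places2 [simp]: "finite (places2 d e)"
  by (simp add: places2_def)

lemma places2_same: "places2 d d = places d"
  by (auto simp: places2_def places_def)

lemma card_places2: "card {p \<in> places2 d e. fst p = b} = (if b then e else d)"
proof -
  have "{p \<in> places2 d e. fst p = b} = {b} \<times> {..<(if b then e else d)}"
    by (auto simp: places2_def)
  then show ?thesis by simp
qed

lemma word_val_places2:
  assumes "(d1, d2) \<noteq> (d, d)"
  shows "word_val H d (word (places2 d1 d2) lab e) = 0"
proof -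
  have "word (places2 d1 d2) lab e \<noteq> word (places d) lab' e'" for lab' e'
  proof
    assume "word (places2 d1 d2) lab e = word (places d) lab' e'"
    then have "wsum (\<lambda>v. if fst (fst v) = b then 1 else 0) (word (places2 d1 d2) lab e) =
      wsum (\<lambda>v. if fst (fst v) = b then 1 else 0) (word (places2 d d) lab' e')" for b
      by (simp add: places2_same)
    then show False using assms by (simp add: word_degree card_places2 split: if_splits) (metis (full_types))
  qed
  then show ?thesis by (simp add: word_val_def)
qed

lemma monomial_is_word:
  fixes m :: "(bool \<times> nat) \<times> nat \<Rightarrow>\<^sub>0 nat"
  shows "\<exists>d1 d2 lab e. m = word (places2 d1 d2) lab e"
proof (induction m rule: monomial_induct)
  case zero
  then show ?case by (intro exI[of _ 0]) (simp add: word_def places2_def)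
next
  case (add m v)
  then obtain d1 d2 lab e where m: "m = word (places2 d1 d2) lab e" by blast
  obtain b i k where v: "v = ((b, i), k)" by (metis surj_pair)
  define p where "p = (b, if b then d2 else d1)"
  have "places2 (if b then d1 else Suc d1) (if b then Suc d2 else d2) = insert p (places2 d1 d2)"
    by (auto simp: places2_def p_def)
  moreover have "p \<notin> places2 d1 d2" by (auto simp: places2_def p_def)
  ultimately have "word (places2 (if b then d1 else Suc d1) (if b then Suc d2 else d2)) (lab(p := i)) (e(p := k)) =
      psingle v 1 + word (places2 d1 d2) (lab(p := i)) (e(p := k))"
    by (simp add: word_def letter_def v p_def)
  also have "word (places2 d1 d2) (lab(p := i)) (e(p := k)) = m"
    unfolding m by (rule word_cong) (use \<open>p \<notin> places2 d1 d2\<close> in auto)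
  finally have E: "word (places2 (if b then d1 else Suc d1) (if b then Suc d2 else d2)) (lab(p := i)) (e(p := k)) =
      psingle v 1 + m" .
  show ?case unfolding add.commute[of m] E[symmetric] by blast
qed

lemma single_sum_eq_prod: "psingle (\<Sum>p\<in>P. f p) (1::complex) = (\<Prod>p\<in>P. psingle (f p) 1)"
proof (induction P rule: infinite_finite_induct)
  case (insert p P)
  have "psingle (f p + sum f P) (1::complex) = psingle (f p) 1 * psingle (sum f P) 1"
    by (simp add: mult_single)
  then show ?case using insert by simp
qed simp_all

lemma pvar_power: "pvar v ^ n = psingle (psingle v n) 1"
  by (induction n) (auto simp: pvar_def mult_single single_add[symmetric] simp flip: single_one)

lemma single_word: "psingle (word P lab e) 1 = (\<Prod>p\<in>P. pvar (letter lab e p))"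
  by (simp add: word_def single_sum_eq_prod pvar_def)

lemma single_expo: "psingle (expo P e) 1 = (\<Prod>p\<in>P. pvar p ^ e p)"
  by (simp add: expo_def single_sum_eq_prod pvar_power)

lemma lookup_expo: "finite P \<Longrightarrow> plookup (expo P e) p = (if p \<in> P then e p else 0)"
  by (simp add: expo_def lookup_sum lookup_single when_def)

section \<open>Arcs on the determinantal variety of matrices of rank at most one\<close>

type_synonym z_poly = "((nat \<times> nat) \<times> nat) cpoly"

definition phi :: "z_poly \<Rightarrow> xy_poly" where
  "phi = psubst (\<lambda>((i, j), k). \<Sum>u\<le>k. pvar ((False, i), u) * pvar ((True, j), k - u))"

definition minor :: "nat \<Rightarrow> nat \<Rightarrow> nat \<Rightarrow> nat \<Rightarrow> nat \<Rightarrow> z_poly" where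
  "minor i j i' j' k = (\<Sum>u\<le>k. pvar ((i, j), u) * pvar ((i', j'), k - u)) -
     (\<Sum>u\<le>k. pvar ((i, j'), u) * pvar ((i', j), k - u))"

definition minor_multiples :: "z_poly set" where
  "minor_multiples = {psingle m 1 * minor i j i' j' k | m i j i' j' k. True}"

lemma pvar_mult: "pvar v * pvar w = psingle (psingle v 1 + psingle w 1) 1"
  by (simp add: pvar_def mult_single)

text \<open>The link between functionals and generating polynomials: the value on a product of
  series is polynomial in the parameters, with the values on monomials as coefficients.\<close>

lemma lext_prod_series:
  assumes "finite P" "\<And>p. p \<in> P \<Longrightarrow> finite (B p)"
  shows "lext \<phi> (\<Prod>p\<in>P. \<Sum>k\<in>B p. pconst (c p k) * pvar (w p k)) =
    (\<Sum>e\<in>PiE P B. (\<Prod>p\<in>P. c p (e p)) * \<phi> (\<Sum>p\<in>P. psingle (w p (e p)) 1))"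
proof -
  have "(\<Prod>p\<in>P. pconst (c p (e p)) * pvar (w p (e p))) =
      pconst (\<Prod>p\<in>P. c p (e p)) * psingle (\<Sum>p\<in>P. psingle (w p (e p)) 1) 1" for e
    by (simp add: prod.distrib pconst_prod single_sum_eq_prod pvar_def)
  then show ?thesis by (simp add: prod_sum_PiE[OF assms])
qed

lemma peval_sum_single:
  "peval t (\<Sum>e\<in>M. psingle (\<Sum>p\<in>P. psingle (v p) (e p)) (C e)) = (\<Sum>e\<in>M. C e * (\<Prod>p\<in>P. t (v p) ^ e p))"
  if "finite P"
  using that by (simp add: psub_single[OF coef_hom_id] mval_sum)

lemma series_mult:
  fixes p q :: "nat \<Rightarrow> 'v cpoly"
  shows "(\<Sum>k\<le>n. pconst (\<tau> ^ k) * p k) * (\<Sum>k\<le>n. pconst (\<tau> ^ k) * q k) =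
    (\<Sum>c\<le>n. pconst (\<tau> ^ c) * (\<Sum>u\<le>c. p u * q (c - u))) +
    (\<Sum>(k, l)\<in>{(k, l). k \<le> n \<and> l \<le> n \<and> n < k + l}. pconst (\<tau> ^ (k + l)) * (p k * q l))"
proof -
  have "(\<Sum>k\<le>n. pconst (\<tau> ^ k) * p k) * (\<Sum>k\<le>n. pconst (\<tau> ^ k) * q k) =
      (\<Sum>k\<le>n. \<Sum>l\<le>n. pconst (\<tau> ^ (k + l)) * (p k * q l))"
    by (simp add: sum_product power_add pconst_mult mult_ac)
  also have "\<dots> = (\<Sum>c\<le>n. \<Sum>k\<le>c. pconst (\<tau> ^ (k + (c - k))) * (p k * q (c - k))) +
      (\<Sum>(k, l)\<in>{(k, l). k \<le> n \<and> l \<le> n \<and> n < k + l}. pconst (\<tau> ^ (k + l)) * (p k * q l))"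
    by (rule sum_square_split)
  finally show ?thesis by (simp add: sum_distrib_left)
qed

text \<open>Truncated series obey the identities of power series only up to terms of this kind, and
  functionals concentrated in order \<open>n\<close> annihilate them.\<close>

definition high_weight :: "nat \<Rightarrow> ('v \<times> nat) cpoly \<Rightarrow> bool" where
  "high_weight n p \<longleftrightarrow> (\<forall>m\<in>pkeys p. n < wsum snd m)"

lemma high_weight_zero [simp]: "high_weight n 0"
  by (simp add: high_weight_def)

lemma high_weight_add: "high_weight n p \<Longrightarrow> high_weight n q \<Longrightarrow> high_weight n (p + q)"
  using Poly_Mapping.keys_add[of p q] by (auto simp: high_weight_def)

lemma high_weight_uminus: "high_weight n p \<Longrightarrow> high_weight n (- p)"
  by (simp add: high_weight_def Poly_Mapping.keys_def)

lemma high_weight_diff: "high_weight n p \<Longrightarrow> high_weight n q \<Longrightarrow> high_weight n (p - q)"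
  using high_weight_add[of n p "- q"] high_weight_uminus by auto

lemma high_weight_mult: "high_weight n p \<Longrightarrow> high_weight n (p * q)"
  using Poly_Mapping.keys_mult[of p q] by (fastforce simp: high_weight_def)

lemma high_weight_sum: "(\<And>a. a \<in> A \<Longrightarrow> high_weight n (f a)) \<Longrightarrow> high_weight n (sum f A)"
  by (induction A rule: infinite_finite_induct) (auto simp: high_weight_add)

lemma high_weight_prod_diff:
  assumes "\<And>a. a \<in> A \<Longrightarrow> high_weight n (f a - g a)"
  shows "high_weight n (prod f A - prod g A)"
  using assms
proof (induction A rule: infinite_finite_induct)
  case (insert a A)
  have "prod f (insert a A) - prod g (insert a A) = (f a - g a) * prod f A + (prod f A - prod g A) * g a"
    using insert.hyps by (simp add: algebra_simps)
  then show ?case using insert by (simp add: high_weight_add high_weight_mult)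
qed auto

lemma high_weight_tail:
  "high_weight n (\<Sum>(k, l)\<in>{(k, l). k \<le> n \<and> l \<le> n \<and> n < k + l}. pconst (\<tau> (k + l)) * (pvar (v, k) * pvar (w, l)))"
proof (rule high_weight_sum)
  fix kl assume "kl \<in> {(k, l). k \<le> n \<and> l \<le> n \<and> n < k + l}"
  then obtain k l where kl: "kl = (k, l)" "n < k + l" by auto
  have "high_weight n (pvar (v, k) * pvar (w, l))"
    using kl by (simp add: pvar_mult high_weight_def)
  then show "high_weight n (case kl of (k, l) \<Rightarrow> pconst (\<tau> (k + l)) * (pvar (v, k) * pvar (w, l)))"
    using high_weight_mult[of n "pvar (v, k) * pvar (w, l)" "pconst (\<tau> (k + l))"]
    by (simp add: kl mult.commute)
qed

lemma lext_high_weight: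
  assumes "\<And>m. wsum snd m \<noteq> n \<Longrightarrow> L m = 0" "high_weight n p"
  shows "lext L p = 0"
  unfolding lext_def by (rule sum.neutral) (use assms in \<open>force simp: high_weight_def\<close>)

definition z_series :: "nat \<Rightarrow> complex \<Rightarrow> nat \<Rightarrow> nat \<Rightarrow> z_poly" where
  "z_series n \<tau> i j = (\<Sum>k\<le>n. pconst (\<tau> ^ k) * pvar ((i, j), k))"

text \<open>Up to order \<open>n\<close>, the coefficients of the difference of the two products of
  series are the minors, which \<open>L\<close> kills even after multiplication by \<open>R\<close>;
  the truncation error has order above \<open>n\<close>.\<close>

lemma lext_minor_relation:
  assumes "\<And>s. s \<in> minor_multiples \<Longrightarrow> lext L s = 0" "\<And>m. wsum snd m \<noteq> n \<Longrightarrow> L m = 0"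
  shows "lext L (z_series n \<tau> i j * z_series n \<tau> i' j' * R) = lext L (z_series n \<tau> i j' * z_series n \<tau> i' j * R)"
proof -
  have mR: "lext L (minor i j i' j' k * R) = 0" for k
  proof -
    have "minor i j i' j' k * R = minor i j i' j' k * (\<Sum>m\<in>pkeys R. pconst (plookup R m) * psingle m 1)"
      by (simp flip: single_eq_pconst_mult cpoly_eq_sum_single)
    also have "\<dots> = (\<Sum>m\<in>pkeys R. pconst (plookup R m) * (psingle m 1 * minor i j i' j' k))"
      by (simp add: sum_distrib_left mult_ac)
    finally have "lext L (minor i j i' j' k * R) =
        (\<Sum>m\<in>pkeys R. plookup R m * lext L (psingle m 1 * minor i j i' j' k))" by simp
    moreover have "lext L (psingle m 1 * minor i j i' j' k) = 0" for m
      by (rule assms(1)) (unfold minor_multiples_def, blast)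
    ultimately show ?thesis by simp
  qed
  let ?T = "\<lambda>j j'. (\<Sum>(k, l)\<in>{(k, l). k \<le> n \<and> l \<le> n \<and> n < k + l}.
      pconst (\<tau> ^ (k + l)) * (pvar ((i, j), k) * pvar ((i', j'), l)))"
  have "(z_series n \<tau> i j * z_series n \<tau> i' j' - z_series n \<tau> i j' * z_series n \<tau> i' j) * R =
      (\<Sum>c\<le>n. pconst (\<tau> ^ c) * (minor i j i' j' c * R)) + (?T j j' - ?T j' j) * R"
    unfolding z_series_def series_mult minor_def
    by (simp add: algebra_simps sum_subtractf sum_distrib_left)
  moreover have "high_weight n ((?T j j' - ?T j' j) * R)"
    by (intro high_weight_mult high_weight_diff high_weight_tail)
  ultimately have "lext L ((z_series n \<tau> i j * z_series n \<tau> i' j' - z_series n \<tau> i j' * z_series n \<tau> i' j) * R) = 0"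
    using lext_high_weight[OF assms(2)] by (simp add: mR)
  then show ?thesis by (simp add: left_diff_distrib)
qed

section \<open>Generating polynomials of functionals on polynomials in the z_ij\<close>

definition zword :: "nat \<Rightarrow> (nat \<Rightarrow> nat) \<Rightarrow> (place \<Rightarrow> nat) \<Rightarrow> (nat \<Rightarrow> nat) \<Rightarrow> (nat \<times> nat) \<times> nat \<Rightarrow>\<^sub>0 nat" where
  "zword d \<sigma> lab e = (\<Sum>a<d. psingle ((lab (False, a), lab (True, \<sigma> a)), e a) 1)"

text \<open>As a polynomial in the t_b, this is the value of \<open>L\<close> on the product of the
  series for the index pairs \<open>(lab (False, a), lab (True, \<sigma> a))\<close> at the
  parameters t_b with \<open>b = \<sigma> a\<close>. When \<open>L\<close> lives in order
  \<open>n\<close>, exponents above \<open>n\<close> contribute nothing.\<close>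

definition gen_poly ::
    "((((nat \<times> nat) \<times> nat) \<Rightarrow>\<^sub>0 nat) \<Rightarrow> complex) \<Rightarrow> nat \<Rightarrow> nat \<Rightarrow> (place \<Rightarrow> nat) \<Rightarrow> (nat \<Rightarrow> nat) \<Rightarrow> nat cpoly" where
  "gen_poly L n d lab \<sigma> = (\<Sum>e\<in>PiE {..<d} (\<lambda>_. {..n}). psingle (\<Sum>a<d. psingle (\<sigma> a) (e a)) (L (zword d \<sigma> lab e)))"

lemma peval_gen_poly:
  "peval t (gen_poly L n d lab \<sigma>) = lext L (\<Prod>a<d. z_series n (t (\<sigma> a)) (lab (False, a)) (lab (True, \<sigma> a)))"
  unfolding gen_poly_def z_series_def zword_def peval_sum_single[OF finite_lessThan]
  by (subst lext_prod_series) (simp_all add: mult.commute)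

lemma pairings_permutes: "\<sigma> \<in> pairings {..<d} {..<d} id \<longleftrightarrow> \<sigma> permutes {..<d}"
  unfolding pairings_def by (auto simp: permutes_imp_bij permutes_not_in intro: bij_imp_permutes)

text \<open>Once t_u = t_v, the two factors with columns \<open>lab (True, u)\<close> and
  \<open>lab (True, v)\<close> have the same parameter, and the minor relation exchanges these
  columns.\<close>

lemma gen_poly_compatible:
  assumes "\<And>s. s \<in> minor_multiples \<Longrightarrow> lext L s = 0" "\<And>m. wsum snd m \<noteq> n \<Longrightarrow> L m = 0"
    and \<sigma>: "\<sigma> permutes {..<d}" and u: "u < d" and v: "v < d" and uv: "u \<noteq> v"
  shows "pvar u - pvar v dvd gen_poly L n d lab \<sigma> - gen_poly L n d lab (transpose u v \<circ> \<sigma>)"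
proof (rule pvar_diff_dvd, rule peval_eqI)
  fix t :: "nat \<Rightarrow> complex"
  let ?t = "t(u := t v)"
  have t: "peval t (psubst (pvar(u := pvar v)) x) = peval ?t x" for x
    unfolding peval_psubst by (rule psub_cong) auto
  obtain a where a: "a < d" "\<sigma> a = u" using permutes_surj[OF \<sigma>] u permutes_in_image[OF \<sigma>] by (metis lessThan_iff surjD)
  obtain b where b: "b < d" "\<sigma> b = v" using permutes_surj[OF \<sigma>] v permutes_in_image[OF \<sigma>] by (metis lessThan_iff surjD)
  have ab: "a \<noteq> b" using a b uv by auto
  define R where "R = (\<Prod>c\<in>{..<d} - {a, b}. z_series n (?t (\<sigma> c)) (lab (False, c)) (lab (True, \<sigma> c)))"
  have split: "(\<Prod>c<d. h c) = h a * h b * (\<Prod>c\<in>{..<d} - {a, b}. h c)" for h :: "nat \<Rightarrow> z_poly"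
  proof -
    have "{..<d} = insert a (insert b ({..<d} - {a, b}))" using a b by auto
    then have "(\<Prod>c<d. h c) = prod h (insert a (insert b ({..<d} - {a, b})))" by simp
    then show ?thesis using ab by (simp add: mult.assoc)
  qed
  let ?\<sigma> = "transpose u v \<circ> \<sigma>"
  have R': "(\<Prod>c\<in>{..<d} - {a, b}. z_series n (?t (?\<sigma> c)) (lab (False, c)) (lab (True, ?\<sigma> c))) = R"
    unfolding R_def
  proof (rule prod.cong[OF refl])
    fix c assume "c \<in> {..<d} - {a, b}"
    then have "\<sigma> c \<noteq> u" "\<sigma> c \<noteq> v" using a b permutes_inj[OF \<sigma>] by (auto dest: injD)
    then show "z_series n (?t (?\<sigma> c)) (lab (False, c)) (lab (True, ?\<sigma> c)) =
        z_series n (?t (\<sigma> c)) (lab (False, c)) (lab (True, \<sigma> c))" by simp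
  qed
  have "peval ?t (gen_poly L n d lab \<sigma>) = lext L (z_series n (t v) (lab (False, a)) (lab (True, u)) *
      z_series n (t v) (lab (False, b)) (lab (True, v)) * R)"
    unfolding peval_gen_poly split R_def using a b uv by simp
  also have "\<dots> = lext L (z_series n (t v) (lab (False, a)) (lab (True, v)) *
      z_series n (t v) (lab (False, b)) (lab (True, u)) * R)"
    by (rule lext_minor_relation[OF assms(1,2)])
  also have "\<dots> = peval ?t (gen_poly L n d lab ?\<sigma>)"
    unfolding peval_gen_poly split R' using a b uv by simp
  finally show "peval t (psubst (pvar(u := pvar v)) (gen_poly L n d lab \<sigma> - gen_poly L n d lab ?\<sigma>)) = peval t 0"
    unfolding t by simp
qed

text \<open>The choice of one summand in each coefficient of a product series: order
  \<open>u a\<close> for the x letter and the rest of \<open>k a\<close> for the y letter.\<close>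

definition split_expo :: "(nat \<Rightarrow> nat) \<Rightarrow> (nat \<Rightarrow> nat) \<Rightarrow> place \<Rightarrow> nat" where
  "split_expo k u p = (if fst p then k (snd p) - u (snd p) else u (snd p))"

lemma prod_places: "prod f (places d) = (\<Prod>a<d. f (False, a) * f (True, a))"
proof -
  have "prod f (places d) = (\<Prod>b\<in>UNIV. \<Prod>a<d. f (b, a))"
    by (simp add: places_def prod.cartesian_product)
  then show ?thesis by (simp add: UNIV_bool prod.distrib mult.commute)
qed

lemma sum_places: "sum f (places d) = (\<Sum>a<d. f (False, a) + f (True, a))"
proof -
  have "sum f (places d) = (\<Sum>b\<in>UNIV. \<Sum>a<d. f (b, a))"
    by (simp add: places_def sum.cartesian_product)
  then show ?thesis by (simp add: UNIV_bool sum.distrib add.commute)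
qed

lemma phi_single_zword:
  "phi (psingle (zword d id lab k) 1) =
    (\<Sum>u\<in>PiE {..<d} (\<lambda>a. {..k a}). psingle (word (places d) lab (split_expo k u)) 1)"
proof -
  have "phi (psingle (zword d id lab k) 1) = (\<Prod>a<d. \<Sum>u\<le>k a.
      pvar ((False, lab (False, a)), u) * pvar ((True, lab (True, a)), k a - u))"
    by (simp add: phi_def zword_def psub_single[OF coef_hom_pconst] mval_sum)
  also have "\<dots> = (\<Sum>u\<in>PiE {..<d} (\<lambda>a. {..k a}). \<Prod>a<d.
      pvar ((False, lab (False, a)), u a) * pvar ((True, lab (True, a)), k a - u a))"
    by (rule prod_sum_PiE) auto
  finally show ?thesis
    by (simp add: single_word prod_places letter_def split_expo_def)
qed

lemma psubst_pvar_single: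
  "psubst (\<lambda>p. pvar (f p)) (psingle m c) = psingle (\<Sum>p\<in>pkeys m. psingle (f p) (plookup m p)) c"
proof -
  have "psubst (\<lambda>p. pvar (f p)) (psingle m c) = pconst c * (\<Prod>p\<in>pkeys m. psingle (psingle (f p) (plookup m p)) 1)"
    by (simp add: psub_single[OF coef_hom_pconst] mval_def pvar_power)
  then show ?thesis
    by (simp add: pconst_def mult_single flip: single_sum_eq_prod)
qed

text \<open>Sending each place \<open>p\<close> to the variable \<open>snd (\<pi> p)\<close>
  identifies the variables in pairs, and the exponents of \<open>G\<close> that become
  \<open>k\<close> are exactly the splittings of \<open>k\<close> over these pairs. This turns
  composition with \<open>phi\<close> into restriction to a permuted diagonal.\<close>

lemma sum_lookup_split_expo:
  assumes \<pi>: "\<pi> \<in> place_perms d"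
  shows "(\<Sum>u\<in>PiE {..<d} (\<lambda>a. {..k a}). plookup G (expo (places d) (split_expo k u \<circ> \<pi>))) =
    plookup (psubst (\<lambda>p. pvar (snd (\<pi> p))) G) (\<Sum>a<d. psingle a (k a))"
proof -
  let ?U = "PiE {..<d} (\<lambda>a. {..k a})" and ?E = "\<lambda>u. expo (places d) (split_expo k u \<circ> \<pi>)"
  let ?K = "\<Sum>a<d. psingle a (k a)"
  let ?push = "\<lambda>m. \<Sum>p\<in>pkeys m. psingle (snd (\<pi> p)) (plookup m p) :: nat \<Rightarrow>\<^sub>0 nat"
  have perm: "\<pi> permutes places d" and fst: "\<And>p. fst (\<pi> p) = fst p" using \<pi> by (auto simp: place_perms_def)
  have inP: "\<pi> p \<in> places d \<longleftrightarrow> p \<in> places d" for p by (rule permutes_in_image[OF perm])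
  have lookup_push: "plookup (?push m) a = (\<Sum>p\<in>P. if snd (\<pi> p) = a then plookup m p else 0)"
    if "finite P" "pkeys m \<subseteq> P" for m a P
  proof -
    have "plookup (?push m) a = (\<Sum>p\<in>pkeys m. if snd (\<pi> p) = a then plookup m p else 0)"
      by (simp add: lookup_sum lookup_single when_def)
    also have "\<dots> = (\<Sum>p\<in>P. if snd (\<pi> p) = a then plookup m p else 0)"
      by (rule sum.mono_neutral_left) (use that in \<open>auto simp: in_keys_iff\<close>)
    finally show ?thesis .
  qed
  have reindex: "(\<Sum>p\<in>places d. f (\<pi> p)) = sum f (places d)" for f :: "place \<Rightarrow> nat"
    by (rule sum.reindex_bij_betw[OF permutes_imp_bij[OF perm]])
  have lookK: "plookup ?K a = (if a < d then k a else 0)" for a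
    by (simp add: lookup_sum lookup_single when_def)
  have keysE: "pkeys (expo (places d) e) \<subseteq> places d" for e
    by (auto simp: in_keys_iff lookup_expo split: if_splits)
  have pushE: "?push (?E u) = ?K" if u: "u \<in> ?U" for u
  proof (rule poly_mapping_eqI)
    fix a
    have "plookup (?push (?E u)) a = (\<Sum>p\<in>places d. if snd (\<pi> p) = a then plookup (?E u) p else 0)"
      by (rule lookup_push[OF finite_places keysE])
    also have "\<dots> = (\<Sum>p\<in>places d. if snd (\<pi> p) = a then split_expo k u (\<pi> p) else 0)"
      by (rule sum.cong) (auto simp: lookup_expo)
    also have "\<dots> = (\<Sum>p\<in>places d. if snd p = a then split_expo k u p else 0)"
      by (rule reindex)
    also have "\<dots> = (\<Sum>c<d. if c = a then k a else 0)"
      unfolding sum_places by (rule sum.cong) (use u in \<open>auto simp: split_expo_def PiE_iff\<close>)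
    finally show "plookup (?push (?E u)) a = plookup ?K a" by (simp add: lookK)
  qed
  have inj: "inj_on ?E ?U"
  proof (rule inj_onI, rule PiE_ext)
    fix u u' a assume u: "u \<in> ?U" "u' \<in> ?U" and e: "?E u = ?E u'" and a: "a \<in> {..<d}"
    define p where "p = inv_into UNIV \<pi> (False, a)"
    have p: "\<pi> p = (False, a)" unfolding p_def by (rule permutes_inverses(1)[OF perm])
    then have "p \<in> places d" using inP[of p] a by (simp add: places_def)
    then show "u a = u' a" using arg_cong[OF e, of "\<lambda>m. plookup m p"] p by (simp add: lookup_expo split_expo_def)
  qed
  \<comment> \<open>An exponent that is pushed to \<open>?K\<close> has no key off the places, and
    its values at the two preimages of \<open>a\<close> add up to \<open>k a\<close>.\<close>
  have surj: "m \<in> ?E ` ?U" if m: "?push m = ?K" for m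
  proof -
    have km: "pkeys m \<subseteq> places d"
    proof
      fix p assume p: "p \<in> pkeys m"
      show "p \<in> places d"
      proof (rule ccontr)
        assume np: "p \<notin> places d"
        then have pp: "\<pi> p = p" using perm by (simp add: permutes_not_in)
        have "plookup m p \<le> (\<Sum>q\<in>pkeys m. if snd (\<pi> q) = snd p then plookup m q else 0)"
          using member_le_sum[of p "pkeys m" "\<lambda>q. if snd (\<pi> q) = snd p then plookup m q else 0"] p pp by simp
        also have "\<dots> = plookup ?K (snd p)" using lookup_push[of "pkeys m" m "snd p"] m by simp
        also have "\<dots> = 0" using np by (cases p) (auto simp: lookK places_def)
        finally show False using p by (simp add: in_keys_iff)
      qed
    qed
    define q where "q p = inv_into UNIV \<pi> p" for p
    have q: "\<pi> (q p) = p" "q (\<pi> p) = p" for p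
      unfolding q_def using permutes_inverses[OF perm] by auto
    define u where "u = restrict (\<lambda>a. plookup m (q (False, a))) {..<d}"
    have kk: "k a = plookup m (q (False, a)) + plookup m (q (True, a))" if "a < d" for a
    proof -
      have "k a = plookup (?push m) a" using m lookK that by simp
      also have "\<dots> = (\<Sum>p\<in>places d. if snd (\<pi> p) = a then plookup m (q (\<pi> p)) else 0)"
        unfolding q by (rule lookup_push[OF finite_places km])
      also have "\<dots> = (\<Sum>p\<in>places d. if snd p = a then plookup m (q p) else 0)"
        by (rule reindex)
      also have "\<dots> = (\<Sum>c<d. if c = a then plookup m (q (False, a)) + plookup m (q (True, a)) else 0)"
        unfolding sum_places by (rule sum.cong) auto
      finally show ?thesis using that by simp
    qed
    have "u \<in> ?U" using kk by (auto simp: u_def)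
    moreover have "m = ?E u"
    proof (rule poly_mapping_eqI)
      fix p
      show "plookup m p = plookup (?E u) p"
      proof (cases "p \<in> places d")
        case True
        obtain b a where ba: "\<pi> p = (b, a)" by (metis surj_pair)
        then have "a < d" using True inP[of p] by (simp add: places_def)
        moreover have "p = q (b, a)" using q(2)[of p] ba by simp
        ultimately show ?thesis using True ba kk by (cases b) (auto simp: lookup_expo split_expo_def u_def)
      next
        case False
        then have "p \<notin> pkeys m" using km by auto
        then show ?thesis using False by (simp add: lookup_expo in_keys_iff)
      qed
    qed
    ultimately show ?thesis by blast
  qed
  have "plookup (psubst (\<lambda>p. pvar (snd (\<pi> p))) G) ?K =
      plookup (psubst (\<lambda>p. pvar (snd (\<pi> p))) (\<Sum>m\<in>pkeys G. psingle m (plookup G m))) ?K"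
    by (simp only: cpoly_eq_sum_single[symmetric])
  also have "\<dots> = (\<Sum>m\<in>pkeys G. if ?push m = ?K then plookup G m else 0)"
    by (simp add: psubst_pvar_single lookup_sum lookup_single when_def)
  also have "\<dots> = (\<Sum>m\<in>{m \<in> pkeys G. ?push m = ?K}. plookup G m)"
    by (simp add: sum.inter_filter)
  also have "\<dots> = (\<Sum>m\<in>?E ` ?U. plookup G m)"
    by (rule sum.mono_neutral_left) (use surj pushE in \<open>auto simp: in_keys_iff intro!: finite_PiE\<close>)
  also have "\<dots> = (\<Sum>u\<in>?U. plookup G (?E u))"
    by (simp add: sum.reindex[OF inj])
  finally show ?thesis by simp
qed

lemma place_perms_component:
  assumes \<pi>: "\<pi> \<in> place_perms d"
  shows "(\<lambda>a. snd (\<pi> (b, a))) permutes {..<d}"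
proof -
  have perm: "\<pi> permutes places d" and fst: "\<And>p. fst (\<pi> p) = fst p" using \<pi> by (auto simp: place_perms_def)
  have pe: "\<pi> (b, a) = (b, snd (\<pi> (b, a)))" for a using fst[of "(b, a)"] by (simp add: prod_eq_iff)
  have out: "snd (\<pi> (b, a)) = a" if "a \<notin> {..<d}" for a
    using that permutes_not_in[OF perm, of "(b, a)"] by (simp add: places_def)
  have "inj_on (\<lambda>a. snd (\<pi> (b, a))) {..<d}"
  proof (rule inj_onI)
    fix x y assume "snd (\<pi> (b, x)) = snd (\<pi> (b, y))"
    then have "\<pi> (b, x) = \<pi> (b, y)" using pe by metis
    then show "x = y" using permutes_inj[OF perm] by (auto dest: injD)
  qed
  moreover have "(\<lambda>a. snd (\<pi> (b, a))) ` {..<d} \<subseteq> {..<d}"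
  proof (rule image_subsetI)
    fix a assume "a \<in> {..<d}"
    then have "\<pi> (b, a) \<in> places d" using permutes_in_image[OF perm] by (simp add: places_def)
    then show "snd (\<pi> (b, a)) \<in> {..<d}" by (auto simp: places_def)
  qed
  ultimately have "bij_betw (\<lambda>a. snd (\<pi> (b, a))) {..<d} {..<d}"
    by (simp add: bij_betw_def endo_inj_surj)
  then show ?thesis using out by (rule bij_imp_permutes)
qed

lemma monomial_is_zword:
  fixes m :: "(nat \<times> nat) \<times> nat \<Rightarrow>\<^sub>0 nat"
  shows "\<exists>d lab e. m = zword d id lab e"
proof (induction m rule: monomial_induct)
  case zero
  then show ?case by (intro exI[of _ 0]) (simp add: zword_def)
next
  case (add m v)
  then obtain d lab e where m: "m = zword d id lab e" by blast
  obtain i j k where v: "v = ((i, j), k)" by (metis surj_pair)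
  have "zword (Suc d) id (lab((False, d) := i, (True, d) := j)) (e(d := k)) =
      zword d id (lab((False, d) := i, (True, d) := j)) (e(d := k)) + psingle v 1"
    by (simp add: zword_def v)
  also have "zword d id (lab((False, d) := i, (True, d) := j)) (e(d := k)) = m"
    unfolding m zword_def by (rule sum.cong) auto
  finally have E: "zword (Suc d) id (lab((False, d) := i, (True, d) := j)) (e(d := k)) = m + psingle v 1" .
  show ?case unfolding E[symmetric] by blast
qed

lemma lookup_gen_poly_id:
  assumes "\<And>m. wsum snd m \<noteq> n \<Longrightarrow> L m = 0"
  shows "plookup (gen_poly L n d lab id) (\<Sum>a<d. psingle a (k a)) = L (zword d id lab k)"
proof -
  let ?K = "\<lambda>e. \<Sum>a<d. psingle a (e a) :: nat \<Rightarrow>\<^sub>0 nat"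
  have lookK: "plookup (?K e) a = (if a < d then e a else 0)" for a e
    by (simp add: lookup_sum lookup_single when_def)
  have eq: "?K e = ?K k \<longleftrightarrow> e = restrict k {..<d}" if "e \<in> PiE {..<d} (\<lambda>_. {..n})" for e
  proof
    assume e: "?K e = ?K k"
    have "e a = k a" if "a < d" for a using arg_cong[OF e, of "\<lambda>m. plookup m a"] that lookK by simp
    then show "e = restrict k {..<d}" using that by (auto simp: PiE_iff extensional_def restrict_def)
  qed (auto intro!: sum.cong)
  have "plookup (gen_poly L n d lab id) (?K k) =
      (\<Sum>e\<in>PiE {..<d} (\<lambda>_. {..n}). if e = restrict k {..<d} then L (zword d id lab k) else 0)"
    unfolding gen_poly_def lookup_sum
  proof (rule sum.cong[OF refl])
    fix e assume e: "e \<in> PiE {..<d} (\<lambda>_. {..n})"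
    have "zword d id lab e = zword d id lab k" if "e = restrict k {..<d}"
      unfolding zword_def by (rule sum.cong) (use that in auto)
    then show "plookup (psingle (\<Sum>a<d. psingle (id a) (e a)) (L (zword d id lab e))) (?K k) =
        (if e = restrict k {..<d} then L (zword d id lab k) else 0)"
      using eq[OF e] by (simp add: lookup_single when_def)
  qed
  also have "\<dots> = (if restrict k {..<d} \<in> PiE {..<d} (\<lambda>_. {..n}) then L (zword d id lab k) else 0)"
    by (simp add: finite_PiE)
  \<comment> \<open>An exponent above \<open>n\<close> is not listed in \<open>gen_poly\<close>, but
    then the order of the monomial exceeds \<open>n\<close> and \<open>L\<close> is zero there
    too.\<close>
  also have "\<dots> = L (zword d id lab k)"
  proof (cases "\<forall>a<d. k a \<le> n")
    case True
    then show ?thesis by auto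
  next
    case False
    then obtain a where a: "a < d" "k a > n" by (auto simp: not_le)
    have "k a \<le> (\<Sum>a<d. k a)" using member_le_sum[of a "{..<d}" k] a by simp
    then have "wsum snd (zword d id lab k) \<noteq> n" using a by (simp add: zword_def)
    then show ?thesis using assms by simp
  qed
  finally show ?thesis .
qed

text \<open>A functional \<open>L\<close> that kills the multiples of the minors gives generating polynomials on the subspaces
  \<open>s\<^sub>a = t\<^bsub>\<sigma> a\<^esub>\<close> that can be interpolated; the functional \<open>Psi\<close> of the interpolants restricts along \<open>phi\<close> to a
  nonzero multiple of \<open>L\<close>.\<close>

theorem kernel_phi:
  assumes "phi r = 0"
  shows "r \<in> cpoly.span minor_multiples"
proof (rule ccontr)
  assume "r \<notin> cpoly.span minor_multiples"
  \<comment> \<open>The minors are homogeneous for degree and order: each term has degree 2 and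
    order \<open>k\<close>.\<close>
  moreover have "\<exists>g. \<forall>m\<in>pkeys s. (wsum (\<lambda>_. 1) m, wsum snd m) = g" if s: "s \<in> minor_multiples" for s
  proof -
    obtain m i j i' j' k where s: "s = psingle m 1 * minor i j i' j' k"
      using s by (auto simp: minor_multiples_def)
    have "(wsum (\<lambda>_. 1) \<mu>, wsum snd \<mu>) = (2, k)" if "\<mu> \<in> pkeys (minor i j i' j' k)" for \<mu>
    proof -
      have "\<exists>u\<le>k. \<exists>v w. \<mu> = psingle (v, u) 1 + psingle (w, k - u) 1"
      proof (rule ccontr)
        assume n: "\<not> ?thesis"
        have "plookup (\<Sum>u\<le>k. pvar (v, u) * pvar (w, k - u) :: z_poly) \<mu> = 0" for v w
          unfolding lookup_sum pvar_mult
        proof (intro sum.neutral ballI)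
          fix u assume "u \<in> {..k}"
          then have "psingle (v, u) 1 + psingle (w, k - u) 1 \<noteq> \<mu>" using n by blast
          then show "plookup (psingle (psingle (v, u) 1 + psingle (w, k - u) 1) (1::complex)) \<mu> = 0"
            by (simp only: lookup_single when_simps)
        qed
        then show False using that by (simp add: minor_def lookup_minus in_keys_iff)
      qed
      then show ?thesis by auto
    qed
    then have "(wsum (\<lambda>_. 1) \<mu>, wsum snd \<mu>) = (wsum (\<lambda>_. 1) m + 2, wsum snd m + k)" if "\<mu> \<in> pkeys s" for \<mu>
      using that Poly_Mapping.keys_mult[of "psingle m 1" "minor i j i' j' k"] unfolding s by fastforce
    then show ?thesis by blast
  qed
  ultimately obtain L g where L: "\<And>s. s \<in> minor_multiples \<Longrightarrow> lext L s = 0" "lext L r \<noteq> 0"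
      "\<And>m. (wsum (\<lambda>_. 1) m, wsum snd m) \<noteq> g \<Longrightarrow> L m = 0"
    by (rule graded_functional_separation) auto
  obtain d n where g: "g = (d, n)" by (metis surj_pair)
  have Ln: "L m = 0" if "wsum snd m \<noteq> n" for m using L(3) that by (auto simp: g)
  have "\<forall>lab. \<exists>G. \<forall>\<sigma>\<in>pairings {..<d} {..<d} id. diag \<sigma> G = gen_poly L n d lab \<sigma>"
    by (intro allI diag_interpolation) (use gen_poly_compatible[OF L(1) Ln] in \<open>auto simp: pairings_permutes\<close>)
  then obtain G where "\<And>lab \<sigma>. \<sigma> \<in> pairings {..<d} {..<d} id \<Longrightarrow> diag \<sigma> (G lab) = gen_poly L n d lab \<sigma>"
    by metis
  then have G: "diag \<sigma> (G lab) = gen_poly L n d lab \<sigma>" if "\<sigma> permutes {..<d}" for lab \<sigma>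
    using that by (simp add: pairings_permutes)
  \<comment> \<open>Let \<rho> and \<tau> be the actions of \<open>\<pi>\<close> on the two kinds of
    places. The substitution is the diagonal for the inverse of \<tau> after \<rho>, followed by
    renaming along \<tau>; permuting labels and parameters together does not change the product of
    series. Hence all summands of \<open>sym_coeff\<close> give the same value.\<close>
  have key: "psubst (\<lambda>p. pvar (snd (\<pi> p))) (G (restrict (lab \<circ> \<pi>) (places d))) = gen_poly L n d lab id"
    if \<pi>: "\<pi> \<in> place_perms d" for \<pi> lab
  proof (rule peval_eqI)
    fix w :: "nat \<Rightarrow> complex"
    let ?lab = "restrict (lab \<circ> \<pi>) (places d)"
    define \<rho> \<tau> where "\<rho> a = snd (\<pi> (False, a))" and "\<tau> a = snd (\<pi> (True, a))" for a
    have \<rho>: "\<rho> permutes {..<d}" and \<tau>: "\<tau> permutes {..<d}"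
      using place_perms_component[OF \<pi>] unfolding \<rho>_def \<tau>_def by auto
    define \<sigma> where "\<sigma> = inv_into UNIV \<tau> \<circ> \<rho>"
    have \<sigma>: "\<sigma> permutes {..<d}" unfolding \<sigma>_def by (intro permutes_compose permutes_inv \<rho> \<tau>)
    have \<tau>\<sigma>: "\<tau> (\<sigma> a) = \<rho> a" for a unfolding \<sigma>_def using permutes_inverses(1)[OF \<tau>] by simp
    have pe: "\<pi> (False, a) = (False, \<rho> a)" "\<pi> (True, a) = (True, \<tau> a)" for a
      using \<pi> by (auto simp: place_perms_def \<rho>_def \<tau>_def prod_eq_iff)
    have "peval w (psubst (\<lambda>p. pvar (snd (\<pi> p))) (G ?lab)) = peval (\<lambda>p. w (snd (\<pi> p))) (G ?lab)"
      by (simp add: peval_psubst)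
    also have "\<dots> = peval (w \<circ> \<tau>) (diag \<sigma> (G ?lab))"
      unfolding diag_def peval_psubst by (rule psub_cong) (auto simp: pe \<tau>\<sigma>)
    also have "\<dots> = lext L (\<Prod>a<d. z_series n (w (\<tau> (\<sigma> a))) (?lab (False, a)) (?lab (True, \<sigma> a)))"
      by (simp add: G[OF \<sigma>] peval_gen_poly)
    also have "(\<Prod>a<d. z_series n (w (\<tau> (\<sigma> a))) (?lab (False, a)) (?lab (True, \<sigma> a))) =
        (\<Prod>a<d. z_series n (w (\<rho> a)) (lab (False, \<rho> a)) (lab (True, \<rho> a)))"
    proof (rule prod.cong[OF refl])
      fix a assume a: "a \<in> {..<d}"
      then have "\<sigma> a < d" using permutes_in_image[OF \<sigma>] by simp
      then show "z_series n (w (\<tau> (\<sigma> a))) (?lab (False, a)) (?lab (True, \<sigma> a)) =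
          z_series n (w (\<rho> a)) (lab (False, \<rho> a)) (lab (True, \<rho> a))"
        using a by (simp add: places_def pe \<tau>\<sigma>)
    qed
    also have "\<dots> = (\<Prod>a<d. z_series n (w a) (lab (False, a)) (lab (True, a)))"
      by (rule prod.reindex_bij_betw[OF permutes_imp_bij[OF \<rho>]])
    also have "lext L \<dots> = peval w (gen_poly L n d lab id)"
      by (simp add: peval_gen_poly)
    finally show "peval w (psubst (\<lambda>p. pvar (snd (\<pi> p))) (G ?lab)) = peval w (gen_poly L n d lab id)" .
  qed
  let ?N = "of_nat (card (place_perms d)) :: complex"
  have val: "Psi G d (phi (psingle m 1)) = ?N * L m" for m
  proof -
    obtain e lab k where m: "m = zword e id lab k" using monomial_is_zword by blast
    show ?thesis
    proof (cases "e = d")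
      case True
      have "Psi G d (phi (psingle m 1)) = (\<Sum>u\<in>PiE {..<d} (\<lambda>a. {..k a}). sym_coeff G d lab (split_expo k u))"
        by (simp add: m True phi_single_zword Psi_def word_val_word)
      also have "\<dots> = (\<Sum>\<pi>\<in>place_perms d. \<Sum>u\<in>PiE {..<d} (\<lambda>a. {..k a}).
          plookup (G (restrict (lab \<circ> \<pi>) (places d))) (expo (places d) (split_expo k u \<circ> \<pi>)))"
        unfolding sym_coeff_def by (rule sum.swap)
      also have "\<dots> = (\<Sum>\<pi>\<in>place_perms d. L m)"
      proof (rule sum.cong[OF refl])
        fix \<pi> assume \<pi>: "\<pi> \<in> place_perms d"
        show "(\<Sum>u\<in>PiE {..<d} (\<lambda>a. {..k a}). plookup (G (restrict (lab \<circ> \<pi>) (places d)))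
            (expo (places d) (split_expo k u \<circ> \<pi>))) = L m"
          unfolding sum_lookup_split_expo[OF \<pi>] key[OF \<pi>] m True by (rule lookup_gen_poly_id[OF Ln])
      qed
      finally show ?thesis by simp
    next
      case False
      have "wsum (\<lambda>_. 1) m = e" by (simp add: m zword_def)
      then have "L m = 0" using L(3)[of m] False by (simp add: g)
      moreover have "word_val G d (word (places e) lab' e') = 0" for lab' e'
        using word_val_places2[of e e d] False by (simp add: places2_same)
      ultimately show ?thesis by (simp add: m phi_single_zword Psi_def)
    qed
  qed
  have "0 = Psi G d (phi r)" by (simp add: assms Psi_def)
  also have "\<dots> = lext (\<lambda>m. ?N * L m) r"
    using val unfolding Psi_def phi_def lext_psubst[of _ _ r] by simp
  also have "\<dots> = ?N * lext L r"
    by (simp add: lext_def sum_distrib_left mult_ac)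
  finally have "?N * lext L r = 0" by simp
  moreover have "card (place_perms d) \<noteq> 0"
    using id_in_place_perms[of d] by (auto simp: card_eq_0_iff)
  ultimately show False using L(2) by simp
qed

section \<open>Invariants of the arc group\<close>

text \<open>\<open>arc_scale False g\<close> and \<open>arc_scale True g\<close> multiply the series \<open>x\<^sub>i(t)\<close>, respectively \<open>y\<^sub>j(t)\<close>,
  by \<open>g(t)\<close>.\<close>

definition arc_scale :: "bool \<Rightarrow> complex poly \<Rightarrow> xy_poly \<Rightarrow> xy_poly" where
  "arc_scale b g = psubst (\<lambda>((b', i), k).
     if b' = b then \<Sum>u\<le>k. pconst (coeff g u) * pvar ((b', i), k - u) else pvar ((b', i), k))"

text \<open>Invariance under (x, y) -> (g x, y / g), stated at the points (x, g y): the inverse of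
  \<open>g\<close> does not occur, and \<open>g\<close> can be a polynomial.\<close>

definition arc_invariant :: "xy_poly \<Rightarrow> bool" where
  "arc_invariant q \<longleftrightarrow> (\<forall>g. coeff g 0 \<noteq> 0 \<longrightarrow> arc_scale False g q = arc_scale True g q)"

lemma lookup_single_mult_add: "plookup (psingle m c * p) (m + \<mu>) = c * plookup p \<mu>"
  for p :: "'v cpoly"
  by (simp add: single_mult_eq_sum lookup_sum lookup_single when_def in_keys_iff)

lemma lookup_single_mult_eq_0:
  fixes p :: "'v cpoly"
  assumes "plookup \<mu> v < plookup m v"
  shows "plookup (psingle m c * p) \<mu> = 0"
  unfolding single_mult_eq_sum lookup_sum
proof (intro sum.neutral ballI)
  fix \<nu>
  have "plookup \<mu> v < plookup (m + \<nu>) v" using assms by (simp add: lookup_add)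
  then have "m + \<nu> \<noteq> \<mu>" by auto
  then show "plookup (psingle (m + \<nu>) (c * plookup p \<nu>)) \<mu> = 0" by (simp add: lookup_single)
qed

lemma expo_add: "expo P f + expo P g = expo P (\<lambda>p. f p + g p)"
  by (simp add: expo_def single_add sum.distrib)

text \<open>The truncated subtraction at order 0 is harmless, since such terms receive the
  coefficient 0.\<close>

definition lower :: "place set \<Rightarrow> (place \<Rightarrow> nat) \<Rightarrow> place \<Rightarrow> nat" where
  "lower C e p = (if p \<in> C then e p - 1 else e p)"

lemma word_val_eq_0_places2:
  assumes "(d1, d2) \<noteq> (d, d)"
  shows "lext (word_val H d) (\<Sum>C\<in>M. pconst (c C) * psingle (word (places2 d1 d2) lab (f C)) 1) = 0"
  using word_val_places2[OF assms] by simp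

text \<open>The scaling sends x^(k) to \<xi> x^(k) - x^(k-1). Both the scaled word and the product
  of the \<xi> - s_a expand over the sets \<open>C\<close> of places where the second term is
  chosen: the orders of the letters drop by 1 on \<open>C\<close>, which matches the shift of
  exponents caused by the factors s_a. For \<open>b = True\<close> the same holds with y and
  t_b.\<close>

lemma Psi_arc_scale:
  "Psi (\<lambda>lab. (\<Prod>a<d. pconst \<xi> - pvar (b, a)) * H lab) d p = Psi H d (arc_scale b [:\<xi>, - 1:] p)"
proof -
  define h :: "(bool \<times> nat) \<times> nat \<Rightarrow> xy_poly" where
    "h = (\<lambda>((b', i), k). if b' = b then \<Sum>u\<le>k. pconst (coeff [:\<xi>, - 1:] u) * pvar ((b', i), k - u)
       else pvar ((b', i), k))"
  let ?H = "\<lambda>lab. (\<Prod>a<d. pconst \<xi> - pvar (b, a)) * H lab"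
  \<comment> \<open>The value 0 at \<open>e p = 0\<close> stands for the missing coefficient of
    order -1.\<close>
  have h: "h (letter lab e p) = (if fst p = b then (if e p = 0 then 0 else - pvar (letter lab (lower {p} e) p)) +
      pconst \<xi> * pvar (letter lab e p) else pvar (letter lab e p))" for lab e p
  proof (cases "fst p = b")
    case True
    have "(\<Sum>u\<le>k. pconst (coeff [:\<xi>, - 1:] u) * pvar ((b, i), k - u)) =
        (if k = 0 then 0 else - pvar ((b, i), k - 1)) + pconst \<xi> * pvar ((b, i), k)" for i k
    proof (cases k)
      case (Suc k')
      have "(\<Sum>u\<le>k. pconst (coeff [:\<xi>, - 1:] u) * pvar ((b, i), k - u)) =
          (\<Sum>u\<in>{0, 1}. pconst (coeff [:\<xi>, - 1:] u) * pvar ((b, i), k - u))"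
        by (rule sum.mono_neutral_right)
          (use Suc in \<open>auto simp: coeff_pCons split: nat.splits\<close>)
      then show ?thesis using Suc by (simp add: pconst_uminus add.commute)
    qed simp
    note this[of "lab p" "e p"]
    moreover have "h (letter lab e p) =
        (\<Sum>u\<le>e p. pconst (coeff [:\<xi>, - 1:] u) * pvar ((b, lab p), e p - u))"
      using True by (simp only: h_def letter_def split_conv if_True simp_thms)
    ultimately show ?thesis using True by (simp only: letter_def lower_def insert_iff if_True simp_thms)
  qed (simp add: h_def letter_def)
  have mono: "word_val ?H d m = Psi H d (psubst h (psingle m 1))" for m
  proof -
    obtain d1 d2 lab e where m: "m = word (places2 d1 d2) lab e" using monomial_is_word by blast
    let ?Q = "places2 d1 d2"
    define B where "B = {p \<in> ?Q. fst p = b}"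
    have fB: "finite B" and BQ: "B \<subseteq> ?Q" by (auto simp: B_def)
    \<comment> \<open>The coefficient belonging to the subset \<open>C\<close>; it is 0 as soon as a
      letter of order 0 would have to be lowered.\<close>
    define cf where "cf C = (if \<forall>p\<in>C. e p \<noteq> 0 then (- 1) ^ card C * \<xi> ^ card (B - C) else 0 :: complex)" for C
    have "psubst h (psingle m 1) = (\<Prod>p\<in>?Q. h (letter lab e p))"
      by (simp add: m word_def psub_single[OF coef_hom_pconst] mval_sum)
    also have "\<dots> = (\<Prod>p\<in>B. h (letter lab e p)) * (\<Prod>p\<in>?Q - B. h (letter lab e p))"
      using prod.subset_diff[OF BQ, of "\<lambda>p. h (letter lab e p)"] by (simp add: mult.commute)
    also have "(\<Prod>p\<in>?Q - B. h (letter lab e p)) = (\<Prod>p\<in>?Q - B. pvar (letter lab e p))"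
      by (rule prod.cong) (auto simp: h B_def)
    also have "(\<Prod>p\<in>B. h (letter lab e p)) = (\<Prod>p\<in>B. (if e p = 0 then 0 else - pvar (letter lab (lower {p} e) p)) +
        pconst \<xi> * pvar (letter lab e p))"
      by (rule prod.cong) (auto simp: h B_def)
    also have "\<dots> = (\<Sum>C\<in>Pow B. (\<Prod>p\<in>C. if e p = 0 then 0 else - pvar (letter lab (lower {p} e) p)) *
        (\<Prod>p\<in>B - C. pconst \<xi> * pvar (letter lab e p)))"
      by (rule prod_add[OF fB])
    also have "\<dots> * (\<Prod>p\<in>?Q - B. pvar (letter lab e p)) =
        (\<Sum>C\<in>Pow B. pconst (cf C) * psingle (word ?Q lab (lower C e)) 1)"
      unfolding sum_distrib_right
    proof (rule sum.cong[OF refl])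
      fix C assume C: "C \<in> Pow B"
      then have fC: "finite C" using fB finite_subset by auto
      have f1: "(\<Prod>p\<in>C. if e p = 0 then 0 else - pvar (letter lab (lower {p} e) p)) =
          (if \<forall>p\<in>C. e p \<noteq> 0 then (- 1) ^ card C * (\<Prod>p\<in>C. pvar (letter lab (lower C e) p)) else 0)"
      proof (cases "\<forall>p\<in>C. e p \<noteq> 0")
        case True
        have "(\<Prod>p\<in>C. if e p = 0 then 0 else - pvar (letter lab (lower {p} e) p)) =
            (\<Prod>p\<in>C. (- 1) * pvar (letter lab (lower C e) p))"
          by (rule prod.cong) (use True in \<open>auto simp: lower_def letter_def\<close>)
        then show ?thesis using True by (simp only: prod.distrib) simp
      next
        case False
        then obtain p where p: "p \<in> C" "e p = 0" by blast
        have "(\<Prod>p\<in>C. if e p = 0 then 0 else - pvar (letter lab (lower {p} e) p)) = (0 :: xy_poly)"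
          by (rule prod_zero[OF fC], rule bexI[of _ p]) (use p in simp_all)
        then show ?thesis using False by (simp only: if_False)
      qed
      have f2: "(\<Prod>p\<in>B - C. pconst \<xi> * pvar (letter lab e p)) =
          pconst (\<xi> ^ card (B - C)) * (\<Prod>p\<in>B - C. pvar (letter lab (lower C e) p))"
      proof -
        have "(\<Prod>p\<in>B - C. pvar (letter lab e p)) = (\<Prod>p\<in>B - C. pvar (letter lab (lower C e) p))"
          by (rule prod.cong) (auto simp: lower_def letter_def)
        then show ?thesis by (simp add: prod.distrib pconst_power)
      qed
      have f3: "(\<Prod>p\<in>?Q - B. pvar (letter lab e p)) = (\<Prod>p\<in>?Q - B. pvar (letter lab (lower C e) p))"
        by (rule prod.cong) (use C in \<open>auto simp: lower_def letter_def\<close>)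
      have f4: "psingle (word ?Q lab (lower C e)) 1 = (\<Prod>p\<in>C. pvar (letter lab (lower C e) p)) *
          (\<Prod>p\<in>B - C. pvar (letter lab (lower C e) p)) * (\<Prod>p\<in>?Q - B. pvar (letter lab (lower C e) p))"
        unfolding single_word
        using prod.subset_diff[OF BQ, of "\<lambda>p. pvar (letter lab (lower C e) p)"]
          prod.subset_diff[of C B "\<lambda>p. pvar (letter lab (lower C e) p)"] C fB by (simp add: mult_ac)
      show "(\<Prod>p\<in>C. if e p = 0 then 0 else - pvar (letter lab (lower {p} e) p)) *
          (\<Prod>p\<in>B - C. pconst \<xi> * pvar (letter lab e p)) * (\<Prod>p\<in>?Q - B. pvar (letter lab e p)) =
          pconst (cf C) * psingle (word ?Q lab (lower C e)) 1"
      proof (cases "\<forall>p\<in>C. e p \<noteq> 0")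
        case True
        show ?thesis unfolding f1 f2 f3 f4 cf_def if_P[OF True]
          by (simp only: pconst_mult pconst_power pconst_uminus pconst_one mult_ac)
      next
        case False
        show ?thesis unfolding f1 f2 f3 f4 cf_def if_not_P[OF False] by simp
      qed
    qed
    finally have expand: "psubst h (psingle m 1) =
        (\<Sum>C\<in>Pow B. pconst (cf C) * psingle (word ?Q lab (lower C e)) 1)" .
    show ?thesis
    proof (cases "(d1, d2) = (d, d)")
      case False
      have "Psi H d (psubst h (psingle m 1)) = 0"
        unfolding expand Psi_def by (rule word_val_eq_0_places2[OF False])
      moreover have "word_val ?H d m = 0"
        unfolding m by (rule word_val_places2[OF False])
      ultimately show ?thesis by (simp only:)
    next
      case True
      then have Q: "?Q = places d" by (simp add: places2_same)
      have B: "B = (\<lambda>a. (b, a)) ` {..<d}" using True by (auto simp: B_def places2_def)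
      have "word_val ?H d m = sym_coeff ?H d lab e" unfolding m Q by (rule word_val_word)
      also have "\<dots> = (\<Sum>\<pi>\<in>place_perms d. \<Sum>C\<in>Pow B. cf C *
          plookup (H (restrict (lab \<circ> \<pi>) (places d))) (expo (places d) (lower C e \<circ> \<pi>)))"
        unfolding sym_coeff_def
      proof (rule sum.cong[OF refl])
        fix \<pi> assume \<pi>: "\<pi> \<in> place_perms d"
        let ?H\<pi> = "H (restrict (lab \<circ> \<pi>) (places d))"
        have perm: "\<pi> permutes places d" and fst: "\<And>p. fst (\<pi> p) = fst p" using \<pi> by (auto simp: place_perms_def)
        have "bij_betw \<pi> B B"
        proof -
          have "inj_on \<pi> B" using permutes_inj[OF perm] by (rule inj_on_subset) simp
          moreover have "\<pi> ` B \<subseteq> B" using fst permutes_in_image[OF perm] by (auto simp: B_def Q)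
          ultimately show ?thesis using fB by (simp add: bij_betw_def endo_inj_surj)
        qed
        then have bij: "bij_betw ((`) \<pi>) (Pow B) (Pow B)" by (rule bij_betw_Pow)
        have "(\<Prod>a<d. pconst \<xi> - pvar (b, a)) = (\<Prod>q\<in>B. - pvar q + pconst \<xi> :: place cpoly)"
          unfolding B by (subst prod.reindex) (auto simp: inj_on_def)
        also have "\<dots> = (\<Sum>C\<in>Pow B. (\<Prod>q\<in>C. - pvar q) * (\<Prod>q\<in>B - C. pconst \<xi>))"
          by (rule prod_add[OF fB])
        also have "\<dots> = (\<Sum>C\<in>Pow B. pconst ((- 1) ^ card C * \<xi> ^ card (B - C)) *
            psingle (expo (places d) (\<lambda>q. if q \<in> C then 1 else 0)) 1)"
        proof (rule sum.cong[OF refl])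
          fix C assume C: "C \<in> Pow B"
          have "(\<Prod>q\<in>C. - pvar q :: place cpoly) = (- 1) ^ card C * (\<Prod>q\<in>C. pvar q)"
            using prod.distrib[of "\<lambda>_. - 1" pvar C] by simp
          also have "(\<Prod>q\<in>C. pvar q :: place cpoly) = (\<Prod>q\<in>places d. pvar q ^ (if q \<in> C then 1 else 0))"
            by (rule prod.mono_neutral_cong_left) (use C BQ Q in auto)
          finally show "(\<Prod>q\<in>C. - pvar q) * (\<Prod>q\<in>B - C. pconst \<xi>) =
            pconst ((- 1) ^ card C * \<xi> ^ card (B - C)) *
            psingle (expo (places d) (\<lambda>q. if q \<in> C then 1 else 0)) (1 :: complex)"
            by (simp add: single_expo pconst_mult pconst_power pconst_uminus mult_ac)
        qed
        finally have P: "(\<Prod>a<d. pconst \<xi> - pvar (b, a)) = (\<Sum>C\<in>Pow B. pconst ((- 1) ^ card C * \<xi> ^ card (B - C)) *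
            psingle (expo (places d) (\<lambda>q. if q \<in> C then 1 else 0)) 1)" .
        have "plookup ((\<Prod>a<d. pconst \<xi> - pvar (b, a)) * ?H\<pi>) (expo (places d) (e \<circ> \<pi>)) =
            (\<Sum>C\<in>Pow B. (- 1) ^ card C * \<xi> ^ card (B - C) * plookup
              (psingle (expo (places d) (\<lambda>q. if q \<in> C then 1 else 0)) 1 * ?H\<pi>) (expo (places d) (e \<circ> \<pi>)))"
          unfolding P sum_distrib_right lookup_sum by (simp only: mult.assoc lookup_pconst_mult)
        \<comment> \<open>A factor at the place \<open>q\<close> of the generating polynomial lowers
          the letter at \<open>\<pi> q\<close>; since \<open>\<pi>\<close> permutes
          \<open>B\<close>, the subsets can then be reindexed.\<close>
        also have "\<dots> = (\<Sum>C\<in>Pow B. cf (\<pi> ` C) * plookup ?H\<pi> (expo (places d) (lower (\<pi> ` C) e \<circ> \<pi>)))"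
        proof (rule sum.cong[OF refl])
          fix C assume C: "C \<in> Pow B"
          have inj: "inj \<pi>" by (rule permutes_inj[OF perm])
          have card: "card (\<pi> ` C) = card C"
            by (rule card_image) (rule inj_on_subset[OF inj], simp)
          have "card (B - \<pi> ` C) = card (\<pi> ` (B - C))"
            using inj \<open>bij_betw \<pi> B B\<close> by (simp add: image_set_diff bij_betw_def)
          also have "\<dots> = card (B - C)" by (rule card_image) (rule inj_on_subset[OF inj], simp)
          finally have card': "card (B - \<pi> ` C) = card (B - C)" .
          show "(- 1) ^ card C * \<xi> ^ card (B - C) * plookup
              (psingle (expo (places d) (\<lambda>q. if q \<in> C then 1 else 0)) 1 * ?H\<pi>) (expo (places d) (e \<circ> \<pi>)) =
              cf (\<pi> ` C) * plookup ?H\<pi> (expo (places d) (lower (\<pi> ` C) e \<circ> \<pi>))"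
          proof (cases "\<forall>q\<in>C. e (\<pi> q) \<noteq> 0")
            case True
            have "expo (places d) (e \<circ> \<pi>) = expo (places d) (\<lambda>q. if q \<in> C then 1 else 0) +
                expo (places d) (lower (\<pi> ` C) e \<circ> \<pi>)"
              unfolding expo_add
            proof (rule expo_cong)
              fix q show "(e \<circ> \<pi>) q = (if q \<in> C then 1 else 0) + (lower (\<pi> ` C) e \<circ> \<pi>) q"
                using True inj by (auto simp: lower_def inj_image_mem_iff)
            qed
            then show ?thesis
              using True by (simp add: lookup_single_mult_add cf_def card card')
          next
            case False
            then obtain q where q: "q \<in> C" "e (\<pi> q) = 0" by auto
            then have "q \<in> places d" using C BQ Q by auto
            then have "plookup (expo (places d) (e \<circ> \<pi>)) q <
                plookup (expo (places d) (\<lambda>q. if q \<in> C then 1 else 0)) q"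
              using q by (simp add: lookup_expo)
            then have "plookup (psingle (expo (places d) (\<lambda>q. if q \<in> C then 1 else 0)) 1 * ?H\<pi>)
                (expo (places d) (e \<circ> \<pi>)) = 0"
              by (rule lookup_single_mult_eq_0)
            moreover have "\<not> (\<forall>p\<in>\<pi> ` C. e p \<noteq> 0)" using q by blast
            ultimately show ?thesis by (simp only: cf_def if_False mult_zero_left mult_zero_right)
          qed
        qed
        also have "\<dots> = (\<Sum>C\<in>Pow B. cf C * plookup ?H\<pi> (expo (places d) (lower C e \<circ> \<pi>)))"
          by (rule sum.reindex_bij_betw[OF bij,
                of "\<lambda>C. cf C * plookup ?H\<pi> (expo (places d) (lower C e \<circ> \<pi>))"])
        finally show "plookup ((\<Prod>a<d. pconst \<xi> - pvar (b, a)) * ?H\<pi>) (expo (places d) (e \<circ> \<pi>)) =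
            (\<Sum>C\<in>Pow B. cf C * plookup ?H\<pi> (expo (places d) (lower C e \<circ> \<pi>)))" .
      qed
      also have "\<dots> = (\<Sum>C\<in>Pow B. cf C * sym_coeff H d lab (lower C e))"
        unfolding sym_coeff_def sum_distrib_left by (rule sum.swap)
      also have "\<dots> = Psi H d (psubst h (psingle m 1))"
        unfolding expand Psi_def Q by (simp add: word_val_word)
      finally show ?thesis .
    qed
  qed
  have "Psi H d (arc_scale b [:\<xi>, - 1:] p) = lext (\<lambda>m. Psi H d (psubst h (psingle m 1))) p"
    unfolding Psi_def arc_scale_def h_def[symmetric] by (rule lext_psubst)
  also have "(\<lambda>m. Psi H d (psubst h (psingle m 1))) = word_val ?H d"
    by (rule ext) (rule mono[symmetric])
  finally show ?thesis by (simp only: Psi_def[of ?H])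
qed

lemma word_val_sum:
  "word_val (\<lambda>lab. \<Sum>k\<in>K. pconst (c k) * H k lab) d m = (\<Sum>k\<in>K. c k * word_val (H k) d m)"
proof -
  have "sym_coeff (\<lambda>lab. \<Sum>k\<in>K. pconst (c k) * H k lab) d lab e = (\<Sum>k\<in>K. c k * sym_coeff (H k) d lab e)" for lab e
    unfolding sym_coeff_def lookup_sum lookup_pconst_mult sum_distrib_left by (rule sum.swap)
  then show ?thesis by (simp add: word_val_def Let_def split: prod.splits)
qed

lemma Psi_sum:
  "Psi (\<lambda>lab. \<Sum>k\<in>K. pconst (c k) * H k lab) d p = (\<Sum>k\<in>K. c k * Psi (H k) d p)"
  unfolding Psi_def lext_def word_val_sum sum_distrib_left mult.left_commute[of "plookup p _"]
  by (rule sum.swap)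

text \<open>At \<xi>, \<open>root_diff\<close> takes the difference of the two products of
  \<open>Psi_arc_scale\<close> as its value, so the numbers in question, for all \<open>k\<close>,
  are the coefficients of a polynomial in \<xi> that vanishes at every nonzero \<xi>. At \<xi> = 0
  the series \<xi> - t is not invertible.\<close>

lemma Psi_coeff_root_diff:
  assumes "arc_invariant q" "k \<le> degree (root_diff {..<d} {..<d})"
  shows "Psi (\<lambda>lab. coeff (root_diff {..<d} {..<d}) k * H lab) d q = 0"
proof -
  let ?E = "root_diff {..<d} {..<d}"
  let ?c = "\<lambda>k. Psi (\<lambda>lab. coeff ?E k * H lab) d q"
  have poly0: "(\<Sum>k\<le>degree ?E. ?c k * \<xi> ^ k) = 0" if \<xi>: "\<xi> \<noteq> 0" for \<xi>
  proof -
    have E: "poly ?E (pconst \<xi>) = (\<Prod>a<d. pconst \<xi> - pvar (False, a)) - (\<Prod>a<d. pconst \<xi> - pvar (True, a))"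
      by (simp add: root_diff_def poly_prod)
    have "(\<Sum>k\<le>degree ?E. \<xi> ^ k * ?c k) = Psi (\<lambda>lab. \<Sum>k\<le>degree ?E. pconst (\<xi> ^ k) * (coeff ?E k * H lab)) d q"
      by (rule Psi_sum[symmetric])
    also have "(\<lambda>lab. \<Sum>k\<le>degree ?E. pconst (\<xi> ^ k) * (coeff ?E k * H lab)) = (\<lambda>lab. poly ?E (pconst \<xi>) * H lab)"
      unfolding poly_altdef sum_distrib_right pconst_power by (simp only: mult_ac)
    also have "\<dots> = (\<lambda>lab. \<Sum>b\<in>UNIV. pconst (if b then -1 else 1) * ((\<Prod>a<d. pconst \<xi> - pvar (b, a)) * H lab))"
      by (simp add: UNIV_bool E pconst_uminus algebra_simps)
    also have "Psi \<dots> d q = (\<Sum>b\<in>UNIV. (if b then -1 else 1) * Psi (\<lambda>lab. (\<Prod>a<d. pconst \<xi> - pvar (b, a)) * H lab) d q)"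
      by (rule Psi_sum)
    also have "\<dots> = Psi H d (arc_scale False [:\<xi>, - 1:] q) - Psi H d (arc_scale True [:\<xi>, - 1:] q)"
      unfolding Psi_arc_scale by (simp add: UNIV_bool)
    also have "\<dots> = 0" using assms(1) \<xi> by (simp add: arc_invariant_def)
    finally show ?thesis by (simp add: mult.commute)
  qed
  define P where "P = (\<Sum>k\<le>degree ?E. monom (?c k) k)"
  have "poly P \<xi> = 0" if "\<xi> \<noteq> 0" for \<xi>
    using poly0[OF that] by (simp add: P_def poly_sum poly_monom)
  then have "UNIV - {0} \<subseteq> {\<xi>. poly P \<xi> = 0}" by auto
  moreover have "infinite (UNIV - {0 :: complex})" by (simp add: infinite_UNIV_char_0)
  ultimately have "P = 0" using poly_roots_finite[of P] finite_subset by blast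
  then have "coeff P k = 0" by simp
  then show ?thesis using assms(2) by (simp add: P_def coeff_sum coeff_monom if_distrib cong: if_cong)
qed

lemma lookup_psubst_scale:
  "plookup (psubst (\<lambda>v. pconst (c v) * pvar v) q) m = plookup q m * mval c m"
proof -
  have "psubst (\<lambda>v. pconst (c v) * pvar v) (psingle \<mu> a) = psingle \<mu> (a * mval c \<mu>)" for \<mu> a
  proof -
    have "mval (\<lambda>v. pconst (c v) * pvar v) \<mu> = pconst (mval c \<mu>) * mval pvar \<mu>"
      by (simp add: mval_def power_mult_distrib prod.distrib pconst_prod pconst_power)
    then show ?thesis
      by (simp add: psub_single[OF coef_hom_pconst] single_eq_pvar_prod[of \<mu> "a * _"] pconst_mult mult_ac)
  qed
  then have "psubst (\<lambda>v. pconst (c v) * pvar v) (\<Sum>\<mu>\<in>pkeys q. psingle \<mu> (plookup q \<mu>)) =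
      (\<Sum>\<mu>\<in>pkeys q. psingle \<mu> (plookup q \<mu> * mval c \<mu>))" by simp
  then have "plookup (psubst (\<lambda>v. pconst (c v) * pvar v) q) m =
      plookup (\<Sum>\<mu>\<in>pkeys q. psingle \<mu> (plookup q \<mu> * mval c \<mu>)) m"
    by (simp flip: cpoly_eq_sum_single)
  then show ?thesis by (simp add: lookup_sum lookup_single when_def in_keys_iff)
qed

text \<open>The constant series \<open>g = 2\<close> multiplies a monomial by 2 to the power of its
  x-degree, respectively its y-degree.\<close>

lemma arc_invariant_balanced:
  assumes "arc_invariant q" "m \<in> pkeys q"
  shows "wsum (\<lambda>v. if fst (fst v) = False then 1 else 0) m = wsum (\<lambda>v. if fst (fst v) = True then 1 else 0) m"
proof -
  note l = lookup_psubst_scale[of _ q m]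
  have c2: "arc_scale b [:2:] = psubst (\<lambda>v. pconst (if fst (fst v) = b then 2 else 1) * pvar v)" for b
  proof -
    have "(\<Sum>u\<le>k. pconst (coeff [:2:] u) * pvar ((b, i), k - u)) = pconst 2 * pvar ((b, i), k)" for i k
    proof -
      have "(\<Sum>u\<le>k. pconst (coeff [:2:] u) * pvar ((b, i), k - u)) =
          (\<Sum>u\<in>{0}. pconst (coeff [:2:] u) * pvar ((b, i), k - u))"
        by (rule sum.mono_neutral_right) (auto simp: coeff_pCons split: nat.splits)
      then show ?thesis by simp
    qed
    then show ?thesis unfolding arc_scale_def by (intro arg_cong[of _ _ psubst] ext) auto
  qed
  have mv: "mval (\<lambda>v. if fst (fst v) = b then 2 else 1 :: complex) m = 2 ^ wsum (\<lambda>v. if fst (fst v) = b then 1 else 0) m" for b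
    unfolding mval_def wsum_def power_sum by (rule prod.cong) (auto simp: power_mult)
  have "arc_scale False [:2:] q = arc_scale True [:2:] q" using assms(1) by (simp add: arc_invariant_def)
  then have "(2::complex) ^ wsum (\<lambda>v. if fst (fst v) = False then 1 else 0) m =
      2 ^ wsum (\<lambda>v. if fst (fst v) = True then 1 else 0) m"
    using l[of "\<lambda>v. if fst (fst v) = False then 2 else 1"] l[of "\<lambda>v. if fst (fst v) = True then 2 else 1"]
      assms(2) unfolding c2 mv by (simp only: in_keys_iff mult_cancel_left) simp
  then have "norm ((2::complex) ^ wsum (\<lambda>v. if fst (fst v) = False then 1 else 0) m) =
      norm ((2::complex) ^ wsum (\<lambda>v. if fst (fst v) = True then 1 else 0) m)" by simp
  then show ?thesis by (simp only: norm_power norm_numeral power_inject_exp)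
qed

definition xy_series :: "nat \<Rightarrow> complex \<Rightarrow> bool \<Rightarrow> nat \<Rightarrow> xy_poly" where
  "xy_series n \<tau> b i = (\<Sum>k\<le>n. pconst (\<tau> ^ k) * pvar ((b, i), k))"

lemma high_weight_phi_series:
  "high_weight n (xy_series n \<tau> False i * xy_series n \<tau> True j - phi (z_series n \<tau> i j))"
proof -
  have "phi (z_series n \<tau> i j) = (\<Sum>c\<le>n. pconst (\<tau> ^ c) * (\<Sum>u\<le>c. pvar ((False, i), u) * pvar ((True, j), c - u)))"
    by (simp add: phi_def z_series_def)
  then show ?thesis
    unfolding xy_series_def series_mult by (simp add: high_weight_tail)
qed

lemma phi_single_homogeneous:
  assumes "\<mu> \<in> pkeys (phi (psingle m 1))"
  shows "wsum (\<lambda>v. if fst (fst v) = b then 1 else 0) \<mu> = wsum (\<lambda>_. 1) m \<and> wsum snd \<mu> = wsum snd m"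
proof -
  obtain e lab k where m: "m = zword e id lab k" using monomial_is_zword by blast
  have "\<exists>u\<in>PiE {..<e} (\<lambda>a. {..k a}). \<mu> = word (places e) lab (split_expo k u)"
  proof (rule ccontr)
    assume n: "\<not> ?thesis"
    have "plookup (phi (psingle m 1)) \<mu> = 0"
      unfolding m phi_single_zword lookup_sum
    proof (intro sum.neutral ballI)
      fix u assume "u \<in> PiE {..<e} (\<lambda>a. {..k a})"
      then have "word (places e) lab (split_expo k u) \<noteq> \<mu>" using n by blast
      then show "plookup (psingle (word (places e) lab (split_expo k u)) (1::complex)) \<mu> = 0"
        by (simp only: lookup_single when_simps)
    qed
    then show False using assms by (simp add: in_keys_iff)
  qed
  then obtain u where u: "u \<in> PiE {..<e} (\<lambda>a. {..k a})" "\<mu> = word (places e) lab (split_expo k u)" by blast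
  have "wsum snd \<mu> = (\<Sum>a<e. u a + (k a - u a))"
    by (simp add: u(2) word_def letter_def sum_places split_expo_def)
  also have "\<dots> = (\<Sum>a<e. k a)"
  proof (rule sum.cong[OF refl])
    fix a assume "a \<in> {..<e}"
    then have "u a \<le> k a" using PiE_mem[OF u(1)] by blast
    then show "u a + (k a - u a) = k a" by simp
  qed
  finally have "wsum snd \<mu> = wsum snd m" by (simp add: m zword_def)
  moreover have "wsum (\<lambda>v. if fst (fst v) = b then 1 else 0) \<mu> = e"
    unfolding u(2) by (subst word_degree) (simp_all add: card_places2 flip: places2_same)
  ultimately show ?thesis by (simp add: m zword_def)
qed

text \<open>A functional that kills the range of \<open>phi\<close> has generating polynomials that vanish on all the subspaces
  \<open>s\<^sub>a = t\<^bsub>\<sigma> a\<^esub>\<close>, so they lie in the ideal of the coefficients of \<open>root_diff\<close>, which kill invariants.\<close>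

theorem arc_invariant_in_range_phi:
  assumes q: "arc_invariant q"
  shows "q \<in> range phi"
proof (rule ccontr)
  assume nq: "q \<notin> range phi"
  let ?S = "range (\<lambda>m. phi (psingle m 1))"
  let ?deg = "\<lambda>b. wsum (\<lambda>v. if fst (fst v) = b then 1 else 0) :: ((bool \<times> nat) \<times> nat \<Rightarrow>\<^sub>0 nat) \<Rightarrow> nat"
  have "x \<in> range phi" if "x \<in> cpoly.span ?S" for x
    using that
  proof (induction rule: cpoly.span_induct_alt)
    case base
    show ?case by (rule range_eqI[of _ _ 0]) (simp add: phi_def)
  next
    case (step c x y)
    then obtain m r where "x = phi (psingle m 1)" "y = phi r" by blast
    then have "pconst c * x + y = phi (pconst c * psingle m 1 + r)" by (simp add: phi_def)
    then show ?case by blast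
  qed
  then have "q \<notin> cpoly.span ?S" using nq by blast
  moreover have "\<exists>g. \<forall>\<mu>\<in>pkeys s. (?deg False \<mu>, ?deg True \<mu>, wsum snd \<mu>) = g" if "s \<in> ?S" for s
    using that phi_single_homogeneous by blast
  ultimately obtain L g where L: "\<And>s. s \<in> ?S \<Longrightarrow> lext L s = 0" "lext L q \<noteq> 0"
      "\<And>m. (?deg False m, ?deg True m, wsum snd m) \<noteq> g \<Longrightarrow> L m = 0"
    by (rule graded_functional_separation) auto
  obtain d d' n where g: "g = (d, d', n)" by (metis surj_pair)
  have Ln: "L m = 0" if "wsum snd m \<noteq> n" for m using L(3) that by (auto simp: g)
  \<comment> \<open>All monomials of an invariant are balanced, so a functional in an unbalanced
    degree would kill \<open>q\<close>.\<close>
  have "d' = d"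
  proof (rule ccontr)
    assume dd: "d' \<noteq> d"
    have "lext L q = 0"
      unfolding lext_def
    proof (intro sum.neutral ballI)
      fix m assume m: "m \<in> pkeys q"
      have "?deg False m = ?deg True m" by (rule arc_invariant_balanced[OF q m])
      then have "L m = 0" using dd by (intro L(3)) (auto simp: g)
      then show "plookup q m * L m = 0" by simp
    qed
    then show False using L(2) by simp
  qed
  then have g: "g = (d, d, n)" using g by simp
  \<comment> \<open>These are the generating polynomials of \<open>L\<close>; exponents up to
    \<open>n\<close> suffice because \<open>L\<close> is concentrated in order
    \<open>n\<close>.\<close>
  define G where "G lab = (\<Sum>e\<in>PiE (places d) (\<lambda>_. {..n}). psingle (expo (places d) e) (L (word (places d) lab e)))" for lab
  have Lphi: "lext L (phi r) = 0" for r
    using L(1) unfolding phi_def by (subst lext_psubst) (auto simp: lext_def)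
  \<comment> \<open>On the diagonal, the x series and the y series of each pair share a parameter,
    so up to terms of order above \<open>n\<close> the product lies in the range of
    \<open>phi\<close>.\<close>
  have vanish: "pdiag {..<d} \<sigma> (G lab) = 0" if \<sigma>: "bij_betw \<sigma> {..<d} {..<d}" for \<sigma> lab
  proof (rule peval_eq_0D)
    fix a :: "place \<Rightarrow> complex"
    define a' where "a' p = (if \<not> fst p \<and> snd p < d then a (True, \<sigma> (snd p)) else a p)" for p
    have "peval a (pdiag {..<d} \<sigma> (G lab)) = peval a' (G lab)"
      unfolding pdiag_def peval_psubst by (rule psub_cong) (auto simp: a'_def)
    also have "\<dots> = (\<Sum>e\<in>PiE (places d) (\<lambda>_. {..n}). L (word (places d) lab e) * (\<Prod>p\<in>places d. a' p ^ e p))"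
      unfolding G_def expo_def by (rule peval_sum_single) simp
    also have "\<dots> = lext L (\<Prod>p\<in>places d. \<Sum>k\<le>n. pconst (a' p ^ k) * pvar ((fst p, lab p), k))"
      by (subst lext_prod_series) (simp_all add: word_def letter_def mult.commute)
    also have "(\<Prod>p\<in>places d. \<Sum>k\<le>n. pconst (a' p ^ k) * pvar ((fst p, lab p), k)) =
        (\<Prod>c<d. xy_series n (a' (False, c)) False (lab (False, c))) *
        (\<Prod>c<d. xy_series n (a (True, c)) True (lab (True, c)))"
      by (simp add: prod_places xy_series_def prod.distrib a'_def)
    also have "(\<Prod>c<d. xy_series n (a (True, c)) True (lab (True, c))) =
        (\<Prod>c<d. xy_series n (a (True, \<sigma> c)) True (lab (True, \<sigma> c)))"
      by (rule prod.reindex_bij_betw[OF \<sigma>, symmetric])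
    also have "(\<Prod>c<d. xy_series n (a' (False, c)) False (lab (False, c))) * \<dots> =
        (\<Prod>c<d. xy_series n (a (True, \<sigma> c)) False (lab (False, c)) * xy_series n (a (True, \<sigma> c)) True (lab (True, \<sigma> c)))"
      by (simp add: prod.distrib a'_def)
    finally have 1: "peval a (pdiag {..<d} \<sigma> (G lab)) = lext L (\<Prod>c<d.
        xy_series n (a (True, \<sigma> c)) False (lab (False, c)) * xy_series n (a (True, \<sigma> c)) True (lab (True, \<sigma> c)))" .
    have "lext L ((\<Prod>c<d. xy_series n (a (True, \<sigma> c)) False (lab (False, c)) * xy_series n (a (True, \<sigma> c)) True (lab (True, \<sigma> c))) -
        (\<Prod>c<d. phi (z_series n (a (True, \<sigma> c)) (lab (False, c)) (lab (True, \<sigma> c))))) = 0"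
      by (rule lext_high_weight[OF Ln], assumption) (intro high_weight_prod_diff high_weight_phi_series)
    moreover have "(\<Prod>c<d. phi (z_series n (a (True, \<sigma> c)) (lab (False, c)) (lab (True, \<sigma> c)))) =
        phi (\<Prod>c<d. z_series n (a (True, \<sigma> c)) (lab (False, c)) (lab (True, \<sigma> c)))"
      by (simp add: phi_def)
    ultimately show "peval a (pdiag {..<d} \<sigma> (G lab)) = 0"
      using 1 Lphi by simp
  qed
  let ?E = "root_diff {..<d} {..<d}"
  have "\<forall>lab. \<exists>H. G lab = (\<Sum>k\<le>degree ?E. coeff ?E k * H k)"
    using vanishing_on_diagonals[of "{..<d}" "{..<d}"] vanish by (auto simp: coeff_ideal_def)
  then obtain H where H: "\<And>lab. G lab = (\<Sum>k\<le>degree ?E. coeff ?E k * H lab k)" by metis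
  have "G = (\<lambda>lab. \<Sum>k\<le>degree ?E. pconst 1 * (coeff ?E k * H lab k))"
    using H by auto
  then have "Psi G d q = Psi (\<lambda>lab. \<Sum>k\<le>degree ?E. pconst 1 * (coeff ?E k * H lab k)) d q"
    by (rule arg_cong)
  also have "\<dots> = (\<Sum>k\<le>degree ?E. 1 * Psi (\<lambda>lab. coeff ?E k * H lab k) d q)"
    by (rule Psi_sum)
  also have "\<dots> = 0"
    using Psi_coeff_root_diff[OF q] by (intro sum.neutral) auto
  finally have Psi0: "Psi G d q = 0" .
  let ?N = "of_nat (card (place_perms d)) :: complex"
  have lookG: "plookup (G lab) (expo (places d) e) = L (word (places d) lab e)" for lab e
  proof -
    have eq: "expo (places d) e' = expo (places d) e \<longleftrightarrow> e' = restrict e (places d)"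
      if "e' \<in> PiE (places d) (\<lambda>_. {..n})" for e'
    proof
      assume E: "expo (places d) e' = expo (places d) e"
      have "e' p = e p" if "p \<in> places d" for p
        using arg_cong[OF E, of "\<lambda>m. plookup m p"] that by (simp add: lookup_expo)
      then show "e' = restrict e (places d)" using that by (auto simp: PiE_iff extensional_def restrict_def)
    qed (auto intro!: expo_cong)
    have "plookup (G lab) (expo (places d) e) =
        (\<Sum>e'\<in>PiE (places d) (\<lambda>_. {..n}). if e' = restrict e (places d) then L (word (places d) lab e) else 0)"
      unfolding G_def lookup_sum
    proof (rule sum.cong[OF refl])
      fix e' assume e': "e' \<in> PiE (places d) (\<lambda>_. {..n})"
      have "word (places d) lab e' = word (places d) lab e" if "e' = restrict e (places d)"
        by (rule word_cong) (use that in auto)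
      then show "plookup (psingle (expo (places d) e') (L (word (places d) lab e'))) (expo (places d) e) =
          (if e' = restrict e (places d) then L (word (places d) lab e) else 0)"
        using eq[OF e'] by (simp add: lookup_single when_def)
    qed
    also have "\<dots> = (if restrict e (places d) \<in> PiE (places d) (\<lambda>_. {..n}) then L (word (places d) lab e) else 0)"
      by (simp add: finite_PiE)
    also have "\<dots> = L (word (places d) lab e)"
    proof (cases "\<forall>p\<in>places d. e p \<le> n")
      case True
      then show ?thesis by auto
    next
      case False
      then obtain p where p: "p \<in> places d" "e p > n" by (auto simp: not_le)
      have "e p \<le> (\<Sum>p\<in>places d. e p)" using member_le_sum[of p "places d" e] p by simp
      then have "wsum snd (word (places d) lab e) \<noteq> n" using p by (simp add: word_def letter_def)
      then show ?thesis using Ln by simp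
    qed
    finally show ?thesis .
  qed
  \<comment> \<open>\<open>L\<close> depends only on the word, so all summands of the symmetrization
    are equal.\<close>
  have "word_val G d m = ?N * L m" for m
  proof -
    obtain d1 d2 lab e where m: "m = word (places2 d1 d2) lab e" using monomial_is_word by blast
    show ?thesis
    proof (cases "(d1, d2) = (d, d)")
      case True
      have "L (word (places d) (restrict (lab \<circ> \<pi>) (places d)) (e \<circ> \<pi>)) = L m" if \<pi>: "\<pi> \<in> place_perms d" for \<pi>
      proof -
        have perm: "\<pi> permutes places d" and fst: "\<And>p. fst (\<pi> p) = fst p" using \<pi> by (auto simp: place_perms_def)
        have "word (places d) (restrict (lab \<circ> \<pi>) (places d)) (e \<circ> \<pi>) = (\<Sum>p\<in>places d. psingle (letter lab e (\<pi> p)) 1)"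
          unfolding word_def by (rule sum.cong) (auto simp: letter_def fst)
        also have "\<dots> = word (places d) lab e"
          unfolding word_def by (rule sum.reindex_bij_betw[OF permutes_imp_bij[OF perm]])
        finally show ?thesis using True by (simp add: m places2_same)
      qed
      then have "sym_coeff G d lab e = ?N * L m"
        by (simp add: sym_coeff_def lookG)
      then show ?thesis using True by (simp add: m places2_same word_val_word)
    next
      case False
      have "?deg False m = d1" "?deg True m = d2" unfolding m word_degree[OF finite_places2] card_places2 by simp_all
      then have "L m = 0" using False by (intro L(3)) (auto simp: g)
      then show ?thesis using word_val_places2[OF False] m by simp
    qed
  qed
  then have "Psi G d q = ?N * lext L q"
    by (simp add: Psi_def lext_def sum_distrib_left mult_ac)
  moreover have "card (place_perms d) \<noteq> 0"
    using id_in_place_perms[of d] by (auto simp: card_eq_0_iff)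
  ultimately show False using L(2) Psi0 by simp
qed

section \<open>Polynomial rings are integrally closed\<close>

text \<open>\<open>f\<^sup>n + homog_eval f g [c\<^sub>1, \<dots>, c\<^sub>n]\<close> is \<open>g\<^sup>n\<close> times the value of \<open>x\<^sup>n + c\<^sub>1 x\<^sup>n\<^sup>-\<^sup>1 + \<dots> + c\<^sub>n\<close> at \<open>x = f / g\<close>.\<close>

primrec homog_eval :: "'a::comm_ring_1 \<Rightarrow> 'a \<Rightarrow> 'a list \<Rightarrow> 'a" where
  "homog_eval f g [] = 0"
| "homog_eval f g (c # cs) = c * f ^ length cs * g + g * homog_eval f g cs"

text \<open>The monic equation replaces f^n by terms with lower powers of f and compensating powers
  of g; by induction, g^n is a common denominator of all powers of f / g.\<close>

lemma almost_integral:
  fixes f g :: "'a::comm_ring_1"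
  assumes "f ^ length cs + homog_eval f g cs = 0"
  shows "g ^ k dvd g ^ length cs * f ^ k"
proof (induction k rule: less_induct)
  case (less k)
  let ?n = "length cs"
  show ?case
  proof (cases "k \<le> ?n")
    case True
    then show ?thesis by (simp add: le_imp_power_dvd dvd_mult2)
  next
    case False
    have "g ^ (k - ?n + length ds) dvd g ^ ?n * f ^ (k - ?n) * homog_eval f g ds" if "length ds \<le> ?n" for ds
      using that
    proof (induction ds)
      case (Cons c ds)
      have l: "k - ?n + length ds < k" using Cons.prems False by simp
      have "g ^ (k - ?n + length ds) dvd g ^ ?n * f ^ (k - ?n + length ds)" by (rule less.IH[OF l])
      then have "g * g ^ (k - ?n + length ds) dvd g * (g ^ ?n * f ^ (k - ?n + length ds))"
        by (rule mult_dvd_mono[OF dvd_refl])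
      then have "g ^ (k - ?n + length (c # ds)) dvd (g * (g ^ ?n * f ^ (k - ?n + length ds))) * c"
        by (simp add: dvd_mult2)
      moreover have "g * g ^ (k - ?n + length ds) dvd g * (g ^ ?n * f ^ (k - ?n) * homog_eval f g ds)"
        by (rule mult_dvd_mono[OF dvd_refl]) (use Cons in simp)
      ultimately have "g ^ (k - ?n + length (c # ds)) dvd (g * (g ^ ?n * f ^ (k - ?n + length ds))) * c +
          g * (g ^ ?n * f ^ (k - ?n) * homog_eval f g ds)"
        by (intro dvd_add) simp_all
      then show ?case by (simp add: algebra_simps power_add)
    qed simp
    from this[of cs] have "g ^ k dvd g ^ ?n * f ^ (k - ?n) * homog_eval f g cs" using False by simp
    moreover have "g ^ ?n * f ^ k = - (g ^ ?n * f ^ (k - ?n) * homog_eval f g cs)"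
    proof -
      have "f ^ k = f ^ (k - ?n) * f ^ ?n" using False by (simp flip: power_add)
      also have "f ^ ?n = - homog_eval f g cs" using assms by (simp add: eq_neg_iff_add_eq_0)
      finally show ?thesis by simp
    qed
    ultimately show ?thesis by simp
  qed
qed

text \<open>The degree comes first, so that over finitely many variables only finitely many
  monomials lie below a given one; ties are broken by the order on exponent maps, which is
  compatible with addition.\<close>

definition mkey :: "('v::linorder \<Rightarrow>\<^sub>0 nat) \<Rightarrow> nat \<times> ('v \<Rightarrow>\<^sub>0 nat)" where
  "mkey m = (wsum (\<lambda>_. 1) m, m)"

lemma mkey_inject [simp]: "mkey m = mkey n \<longleftrightarrow> m = n"
  by (auto simp: mkey_def)

lemma mkey_add_less: "mkey m < mkey m' \<Longrightarrow> mkey n \<le> mkey n' \<Longrightarrow> mkey (m + n) < mkey (m' + n')"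
  by (auto simp: mkey_def less_prod_def less_eq_prod_def intro: add_less_le_mono)

section \<open>Leading monomials\<close>

definition lmon :: "'v::linorder cpoly \<Rightarrow> 'v \<Rightarrow>\<^sub>0 nat" where
  "lmon p = snd (Max (mkey ` pkeys p))"

lemma mkey_lmon: "p \<noteq> 0 \<Longrightarrow> mkey (lmon p) = Max (mkey ` pkeys p)"
proof -
  assume "p \<noteq> 0"
  then have "Max (mkey ` pkeys p) \<in> mkey ` pkeys p" by (intro Max_in) auto
  then show ?thesis by (auto simp: lmon_def mkey_def)
qed

lemma lmon_in_keys: "p \<noteq> 0 \<Longrightarrow> lmon p \<in> pkeys p"
proof -
  assume p: "p \<noteq> 0"
  then have "Max (mkey ` pkeys p) \<in> mkey ` pkeys p" by (intro Max_in) auto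
  then show ?thesis using mkey_lmon[OF p] by (metis image_iff mkey_inject)
qed

lemma mkey_le_lmon: "m \<in> pkeys p \<Longrightarrow> mkey m \<le> mkey (lmon p)"
  using mkey_lmon[of p] by (cases "p = 0") auto

lemma lmonI:
  assumes "m \<in> pkeys p" "\<And>n. n \<in> pkeys p \<Longrightarrow> mkey n \<le> mkey m"
  shows "lmon p = m"
proof -
  have "p \<noteq> 0" using assms(1) by auto
  then have "mkey (lmon p) = mkey m" using assms lmon_in_keys[of p] mkey_le_lmon[of m p] by fastforce
  then show ?thesis by simp
qed

text \<open>Addition is strictly monotone for \<open>mkey\<close>, so only the pair of leading
  monomials contributes to this coefficient.\<close>

lemma lookup_mult_lmon:
  fixes p q :: "'v::linorder cpoly"
  assumes "p \<noteq> 0" "q \<noteq> 0"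
  shows "plookup (p * q) (lmon p + lmon q) = plookup p (lmon p) * plookup q (lmon q)"
proof -
  have *: "m = lmon p \<and> n = lmon q" if "m \<in> pkeys p" "n \<in> pkeys q" "m + n = lmon p + lmon q" for m n
  proof (rule ccontr)
    assume "\<not> ?thesis"
    then have "mkey m < mkey (lmon p) \<or> mkey n < mkey (lmon q)"
      using mkey_le_lmon[OF that(1)] mkey_le_lmon[OF that(2)] by (metis order_le_less mkey_inject)
    then have "mkey (m + n) < mkey (lmon p + lmon q)"
      using mkey_add_less[of m "lmon p" n "lmon q"] mkey_add_less[of n "lmon q" m "lmon p"]
        mkey_le_lmon[OF that(1)] mkey_le_lmon[OF that(2)] by (auto simp: add.commute)
    then show False using that(3) by simp
  qed
  have "p * q = (\<Sum>m\<in>pkeys p. psingle m (plookup p m)) * (\<Sum>n\<in>pkeys q. psingle n (plookup q n))"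
    by (simp flip: cpoly_eq_sum_single)
  also have "\<dots> = (\<Sum>m\<in>pkeys p. \<Sum>n\<in>pkeys q. psingle (m + n) (plookup p m * plookup q n))"
    by (simp add: sum_product mult_single)
  finally have "plookup (p * q) (lmon p + lmon q) =
      (\<Sum>m\<in>pkeys p. \<Sum>n\<in>pkeys q. if m + n = lmon p + lmon q then plookup p m * plookup q n else 0)"
    by (simp add: lookup_sum lookup_single when_def)
  also have "\<dots> = (\<Sum>m\<in>pkeys p. \<Sum>n\<in>pkeys q.
      if n = lmon q then if m = lmon p then plookup p m * plookup q n else 0 else 0)"
    by (intro sum.cong refl) (use * in auto)
  also have "\<dots> = plookup p (lmon p) * plookup q (lmon q)"
    using lmon_in_keys[OF assms(1)] lmon_in_keys[OF assms(2)] by simp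
  finally show ?thesis .
qed

lemma lmon_mult:
  fixes p q :: "'v::linorder cpoly"
  assumes "p \<noteq> 0" "q \<noteq> 0"
  shows "lmon (p * q) = lmon p + lmon q"
proof (rule lmonI)
  show "lmon p + lmon q \<in> pkeys (p * q)"
    using lookup_mult_lmon[OF assms] lmon_in_keys[OF assms(1)] lmon_in_keys[OF assms(2)]
    by (simp add: in_keys_iff)
  fix n assume "n \<in> pkeys (p * q)"
  then obtain a b where ab: "n = a + b" "a \<in> pkeys p" "b \<in> pkeys q"
    using Poly_Mapping.keys_mult[of p q] by blast
  show "mkey n \<le> mkey (lmon p + lmon q)"
  proof (cases "a = lmon p")
    case True
    show ?thesis
    proof (cases "b = lmon q")
      case False
      then have "mkey b < mkey (lmon q)" using mkey_le_lmon[OF ab(3)] by (simp add: order_le_less)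
      from mkey_add_less[OF this order_refl, of "lmon p"] show ?thesis
        using ab True by (simp add: add.commute)
    qed (use True ab in simp)
  next
    case False
    then have "mkey a < mkey (lmon p)" using mkey_le_lmon[OF ab(2)] by (simp add: order_le_less)
    from mkey_add_less[OF this mkey_le_lmon[OF ab(3)]] show ?thesis using ab by simp
  qed
qed

lemma lookup_lmon_power:
  fixes p :: "'v::linorder cpoly"
  assumes "p \<noteq> 0"
  shows "plookup (lmon (p ^ k)) v = k * plookup (lmon p) v"
proof (induction k)
  case 0
  have "lmon (1 :: 'v cpoly) = 0" by (rule lmonI) auto
  then show ?case by simp
next
  case (Suc k)
  then show ?case using assms by (simp add: lmon_mult lookup_add)
qed

lemma finite_bounded_monomials:
  assumes "finite W"
  shows "finite {m :: 'v \<Rightarrow>\<^sub>0 nat. pkeys m \<subseteq> W \<and> wsum (\<lambda>_. 1) m \<le> N}"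
proof (rule finite_subset)
  show "{m. pkeys m \<subseteq> W \<and> wsum (\<lambda>_. 1) m \<le> N} \<subseteq>
      (\<lambda>h. \<Sum>v\<in>W. psingle v (h v)) ` PiE W (\<lambda>_. {..N})"
  proof
    fix m :: "'v \<Rightarrow>\<^sub>0 nat" assume m: "m \<in> {m. pkeys m \<subseteq> W \<and> wsum (\<lambda>_. 1) m \<le> N}"
    have "plookup m v \<le> N" for v
    proof (cases "v \<in> pkeys m")
      case True
      then have "plookup m v \<le> wsum (\<lambda>_. 1) m"
        unfolding wsum_def using member_le_sum[of v "pkeys m" "plookup m"] by simp
      then show ?thesis using m by simp
    qed (simp add: in_keys_iff)
    then have 1: "restrict (plookup m) W \<in> PiE W (\<lambda>_. {..N})" by auto
    have 2: "m = (\<Sum>v\<in>W. psingle v (restrict (plookup m) W v))"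
    proof (rule poly_mapping_eqI)
      fix k
      have "plookup (\<Sum>v\<in>W. psingle v (restrict (plookup m) W v)) k = (\<Sum>v\<in>W. if v = k then plookup m k else 0)"
        unfolding lookup_sum by (rule sum.cong) (auto simp: lookup_single when_def)
      also have "\<dots> = plookup m k" using m assms by (auto simp: in_keys_iff)
      finally show "plookup m k = plookup (\<Sum>v\<in>W. psingle v (restrict (plookup m) W v)) k" by simp
    qed
    show "m \<in> (\<lambda>h. \<Sum>v\<in>W. psingle v (h v)) ` PiE W (\<lambda>_. {..N})"
      by (rule image_eqI[where x = "restrict (plookup m) W"], rule 2, rule 1)
  qed
qed (use assms in \<open>auto intro: finite_PiE\<close>)

text \<open>Almost integral quotients are polynomial: the quotient of the leading monomials is a monomial,
  and subtracting it keeps the quotient almost integral.\<close>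

lemma dvd_of_almost_integral:
  fixes f g d :: "'v::linorder cpoly"
  assumes "d \<noteq> 0" "g \<noteq> 0" "\<And>k. g ^ k dvd d * f ^ k"
  shows "g dvd f"
proof -
  define W where "W = pvars f \<union> pvars g"
  \<comment> \<open>The division terminates because all its monomials stay in this finite set and
    fewer and fewer of them lie below the leading one.\<close>
  define M where "M N = {m :: 'v \<Rightarrow>\<^sub>0 nat. pkeys m \<subseteq> W \<and> wsum (\<lambda>_. 1) m \<le> N}" for N
  have finM: "finite (M N)" for N unfolding M_def by (rule finite_bounded_monomials) (simp add: W_def)
  define N where "N = wsum (\<lambda>_. 1) (lmon f)"
  have "g dvd f'" if "pvars f' \<subseteq> W" "\<And>k. g ^ k dvd d * f' ^ k" "wsum (\<lambda>_. 1) (lmon f') \<le> N" for f'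
    using that
  proof (induction "card {m \<in> M N. mkey m < mkey (lmon f')}" arbitrary: f' rule: less_induct)
    case less
    show ?case
    proof (cases "f' = 0")
      case False
      have le: "plookup (lmon g) v \<le> plookup (lmon f') v" for v
      proof -
        \<comment> \<open>The exponent of \<open>v\<close> in the leading monomial of
          \<open>d\<close> is less than \<open>?k\<close>, so it cannot compensate a deficit of one
          in each of \<open>?k\<close> factors.\<close>
        let ?k = "Suc (plookup (lmon d) v)"
        obtain r where r: "d * f' ^ ?k = g ^ ?k * r" using less.prems(2)[of ?k] by (auto simp: dvd_def)
        then have "r \<noteq> 0" using assms(1) False by auto
        then have "lmon d + lmon (f' ^ ?k) = lmon (g ^ ?k) + lmon r"
          using r assms(1,2) False by (metis lmon_mult power_not_zero)
        then have "plookup (lmon d) v + ?k * plookup (lmon f') v = ?k * plookup (lmon g) v + plookup (lmon r) v"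
          using False assms(2) by (metis lookup_add lookup_lmon_power)
        then have "?k * plookup (lmon g) v \<le> plookup (lmon d) v + ?k * plookup (lmon f') v" by linarith
        also have "\<dots> < ?k * Suc (plookup (lmon f') v)" by simp
        finally have "plookup (lmon g) v < Suc (plookup (lmon f') v)" by (simp only: mult_less_cancel1)
        then show ?thesis by simp
      qed
      define e where "e = lmon f' - lmon g"
      have e: "e + lmon g = lmon f'"
        by (rule poly_mapping_eqI) (simp add: e_def lookup_add lookup_minus le)
      define c where "c = plookup f' (lmon f') / plookup g (lmon g)"
      have lg0: "plookup g (lmon g) \<noteq> 0" using lmon_in_keys[OF assms(2)] by (simp add: in_keys_iff)
      have lf0: "plookup f' (lmon f') \<noteq> 0" using lmon_in_keys[OF False] by (simp add: in_keys_iff)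
      define s where "s = psingle e c"
      have s0: "s \<noteq> 0" using lg0 lf0 by (simp add: s_def c_def flip: keys_eq_empty)
      define f'' where "f'' = f' - s * g"
      have ls: "lmon s = e" by (rule lmonI) (use s0 in \<open>auto simp: s_def split: if_splits\<close>)
      have lsg: "lmon (s * g) = lmon f'" using lmon_mult[OF s0 assms(2)] ls e by simp
      have "plookup (s * g) (lmon f') = plookup f' (lmon f')"
        using lookup_mult_lmon[OF s0 assms(2)] ls e lg0 by (simp add: s_def c_def)
      then have cancel: "lmon f' \<notin> pkeys f''" by (simp add: f''_def in_keys_iff lookup_minus)
      have sub: "pkeys f'' \<subseteq> pkeys f' \<union> pkeys (s * g)"
        by (auto simp: f''_def in_keys_iff lookup_minus)
      have "g dvd f''"
      proof (cases "f'' = 0")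
        case nz: False
        have lt: "mkey (lmon f'') < mkey (lmon f')"
        proof -
          have k: "lmon f'' \<in> pkeys f''" by (rule lmon_in_keys[OF nz])
          then have "mkey (lmon f'') \<le> mkey (lmon f')"
            using sub mkey_le_lmon[of "lmon f''" f'] mkey_le_lmon[of "lmon f''" "s * g"] lsg by auto
          moreover have "lmon f'' \<noteq> lmon f'" using k cancel by auto
          ultimately show ?thesis by (simp add: order_le_less)
        qed
        have pv: "pvars f'' \<subseteq> W"
        proof -
          have "pkeys e \<subseteq> pkeys (lmon f')"
            unfolding e[symmetric] by (auto simp: in_keys_iff lookup_add)
          also have "\<dots> \<subseteq> pvars f'" using lmon_in_keys[OF False] by (auto simp: pvars_def)
          also have "\<dots> \<subseteq> W" by (rule less.prems(1))
          finally have "pvars s \<subseteq> W" by (auto simp: pvars_def s_def split: if_splits)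
          then show ?thesis unfolding f''_def
            by (intro pvars_diff_subset pvars_mult_subset) (use less.prems in \<open>auto simp: W_def\<close>)
        qed
        \<comment> \<open>In the binomial expansion, g^i from the hypothesis on \<open>f'\<close>
          and g^(k - i) from the power of \<open>s * g\<close> combine to g^k.\<close>
        have al: "g ^ k dvd d * f'' ^ k" for k
        proof -
          have "f'' = f' + - s * g" by (simp add: f''_def)
          then have "d * f'' ^ k = (\<Sum>i\<le>k. (d * f' ^ i) * g ^ (k - i) * (of_nat (k choose i) * (- s) ^ (k - i)))"
            unfolding binomial_ring sum_distrib_left power_mult_distrib by (simp only: mult_ac binomial_ring sum_distrib_left power_mult_distrib)
          moreover have "g ^ k dvd (d * f' ^ i) * g ^ (k - i) * (of_nat (k choose i) * (- s) ^ (k - i))"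
            if "i \<le> k" for i
          proof -
            have "g ^ i * g ^ (k - i) dvd (d * f' ^ i) * g ^ (k - i)"
              by (rule mult_dvd_mono[OF less.prems(2) dvd_refl])
            then show ?thesis using that by (simp add: dvd_mult2 flip: power_add)
          qed
          ultimately show ?thesis by (auto intro!: dvd_sum)
        qed
        show ?thesis
        proof (rule less.hyps)
          have lM: "lmon f'' \<in> M N"
          proof -
            have "pkeys (lmon f'') \<subseteq> W" using pv lmon_in_keys[OF nz] by (auto simp: pvars_def)
            moreover have "wsum (\<lambda>_. 1) (lmon f'') \<le> wsum (\<lambda>_. 1) (lmon f')"
              using lt by (auto simp: mkey_def less_prod_def)
            ultimately show ?thesis using less.prems(3) by (simp add: M_def)
          qed
          show "card {m \<in> M N. mkey m < mkey (lmon f'')} < card {m \<in> M N. mkey m < mkey (lmon f')}"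
          proof (rule psubset_card_mono)
            show "finite {m \<in> M N. mkey m < mkey (lmon f')}" using finM by simp
            show "{m \<in> M N. mkey m < mkey (lmon f'')} \<subset> {m \<in> M N. mkey m < mkey (lmon f')}"
              using lt lM by (auto simp: psubset_eq)
          qed
          show "wsum (\<lambda>_. 1) (lmon f'') \<le> N" using lM by (simp add: M_def)
        qed (use pv al in auto)
      qed simp
      then have "g dvd f'' + s * g" by simp
      then show ?thesis by (simp add: f''_def)
    qed simp
  qed
  from this[of f] show ?thesis using assms(3) by (simp add: W_def N_def)
qed

theorem cpoly_integrally_closed:
  fixes f g :: "'v::linorder cpoly"
  assumes "g \<noteq> 0" "f ^ length cs + homog_eval f g cs = 0"
  shows "g dvd f"
  by (rule dvd_of_almost_integral[of "g ^ length cs"]) (use assms almost_integral in auto)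

section \<open>Fraction fields\<close>

text \<open>Operations on classes are unions over all pairs of representatives; independence of the
  representatives collapses the union.\<close>

lemma UN_pairs_const:
  assumes "p \<in> U" "q \<in> W" "\<And>a b c d. (a, b) \<in> U \<Longrightarrow> (c, d) \<in> W \<Longrightarrow> F a b c d = Z"
  shows "(\<Union>(a, b)\<in>U. \<Union>(c, d)\<in>W. F a b c d) = Z"
proof -
  have "(\<Union>(a, b)\<in>U. \<Union>(c, d)\<in>W. F a b c d) = (\<Union>_\<in>U. \<Union>_\<in>W. Z)"
    by (intro SUP_cong refl) (auto simp: assms(3) split: prod.splits)
  then show ?thesis using assms(1,2) by auto
qed

text \<open>\<open>h\<close> embeds the ring, given as a record, into an integral domain given as a type.\<close>

locale domain_embedding =
  fixes R :: "('a, 'b) ring_scheme" (structure) and h :: "'a \<Rightarrow> 'c::idom"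
  assumes inj: "inj_on h (carrier R)"
    and closed [simp]: "\<one> \<in> carrier R" "\<zero> \<in> carrier R"
      "\<And>a b. a \<in> carrier R \<Longrightarrow> b \<in> carrier R \<Longrightarrow> a \<oplus> b \<in> carrier R"
      "\<And>a b. a \<in> carrier R \<Longrightarrow> b \<in> carrier R \<Longrightarrow> a \<otimes> b \<in> carrier R"
    and hom [simp]: "h \<one> = 1" "h \<zero> = 0"
      "\<And>a b. a \<in> carrier R \<Longrightarrow> b \<in> carrier R \<Longrightarrow> h (a \<oplus> b) = h a + h b"
      "\<And>a b. a \<in> carrier R \<Longrightarrow> b \<in> carrier R \<Longrightarrow> h (a \<otimes> b) = h a * h b"
    and neg: "\<And>a. a \<in> carrier R \<Longrightarrow> \<exists>b\<in>carrier R. h b = - h a"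
begin

lemma h_eq_iff: "a \<in> carrier R \<Longrightarrow> b \<in> carrier R \<Longrightarrow> a = b \<longleftrightarrow> h a = h b"
  using inj by (auto dest: inj_onD)

lemma domain: "domain R"
proof (rule domain.intro)
  show "cring R"
  proof (rule cringI)
    show "abelian_group R"
    proof (rule abelian_groupI)
      fix x assume x: "x \<in> carrier R"
      then obtain y where "y \<in> carrier R" "h y = - h x" using neg by blast
      then show "\<exists>y\<in>carrier R. y \<oplus> x = \<zero>" using x by (intro bexI[of _ y]) (simp_all add: h_eq_iff)
    qed (simp_all add: h_eq_iff add_ac)
    show "Group.comm_monoid R" by (rule comm_monoidI) (simp_all add: h_eq_iff mult_ac)
  qed (simp add: h_eq_iff algebra_simps)
  show "domain_axioms R" by unfold_locales (auto simp: h_eq_iff)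
qed

abbreviation "K \<equiv> frac_field R"

lemma frac_rel_iff: "((a, b), (c, d)) \<in> frac_rel R \<longleftrightarrow> a \<in> carrier R \<and> b \<in> carrier R \<and> c \<in> carrier R \<and>
    d \<in> carrier R \<and> h b \<noteq> 0 \<and> h d \<noteq> 0 \<and> h a * h d = h c * h b"
  by (auto simp: frac_rel_def h_eq_iff)

definition valid :: "'a \<Rightarrow> 'a \<Rightarrow> bool" where
  "valid a b \<longleftrightarrow> a \<in> carrier R \<and> b \<in> carrier R \<and> h b \<noteq> 0"

lemma fraction_mem: "(c, d) \<in> fraction R a b \<longleftrightarrow> valid a b \<and> valid c d \<and> h a * h d = h c * h b"
  by (auto simp: fraction_def frac_rel_iff valid_def)

lemma fraction_eq_iff:
  assumes "valid a b" "valid c d"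
  shows "fraction R a b = fraction R c d \<longleftrightarrow> h a * h d = h c * h b"
proof
  assume "fraction R a b = fraction R c d"
  then have "(c, d) \<in> fraction R a b" using assms by (simp add: fraction_mem)
  then show "h a * h d = h c * h b" by (simp add: fraction_mem)
next
  assume e: "h a * h d = h c * h b"
  have "(x, y) \<in> fraction R a b \<longleftrightarrow> (x, y) \<in> fraction R c d" for x y
  proof (cases "valid x y")
    case True
    have "h b \<noteq> 0" "h d \<noteq> 0" using assms by (auto simp: valid_def)
    have "h a * h y = h x * h b \<longleftrightarrow> h d * (h a * h y) = h d * (h x * h b)" using \<open>h d \<noteq> 0\<close> by simp
    also have "h d * (h a * h y) = (h a * h d) * h y" by (simp only: mult_ac)
    also have "\<dots> = h b * (h c * h y)" unfolding e by (simp only: mult_ac)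
    also have "h d * (h x * h b) = h b * (h x * h d)" by (simp only: mult_ac)
    also have "h b * (h c * h y) = h b * (h x * h d) \<longleftrightarrow> h c * h y = h x * h d" using \<open>h b \<noteq> 0\<close> by simp
    finally show ?thesis using True assms by (simp add: fraction_mem)
  qed (simp add: fraction_mem)
  then show "fraction R a b = fraction R c d" by auto
qed

lemma carrier_K: "x \<in> carrier K \<longleftrightarrow> (\<exists>a b. valid a b \<and> x = fraction R a b)"
proof -
  have n: "b \<in> carrier R \<Longrightarrow> b \<noteq> \<zero> \<longleftrightarrow> h b \<noteq> 0" for b by (simp add: h_eq_iff)
  have "x \<in> carrier K \<longleftrightarrow> (\<exists>a b. a \<in> carrier R \<and> b \<in> carrier R \<and> b \<noteq> \<zero> \<and> x = fraction R a b)"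
    unfolding frac_field_def quotient_def fraction_def by auto
  then show ?thesis unfolding valid_def using n by blast
qed

lemma K_cases:
  assumes "x \<in> carrier K"
  obtains a b where "valid a b" "a \<in> carrier R" "b \<in> carrier R" "h b \<noteq> 0" "x = fraction R a b"
  using assms by (auto simp: carrier_K valid_def)

lemma fraction_carrier [simp]: "valid a b \<Longrightarrow> fraction R a b \<in> carrier K"
  by (auto simp: carrier_K)

lemma valid_simps [simp]:
  "valid a b \<Longrightarrow> valid c d \<Longrightarrow> valid (a \<otimes> c) (b \<otimes> d)"
  "valid a b \<Longrightarrow> valid c d \<Longrightarrow> valid (a \<otimes> d \<oplus> c \<otimes> b) (b \<otimes> d)"
  "valid a \<one> \<longleftrightarrow> a \<in> carrier R"
  by (auto simp: valid_def)

lemma K_mult: 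
  assumes "valid a b" "valid c d"
  shows "fraction R a b \<otimes>\<^bsub>K\<^esub> fraction R c d = fraction R (a \<otimes> c) (b \<otimes> d)"
proof -
  have 1: "fraction R (a' \<otimes> c') (b' \<otimes> d') = fraction R (a \<otimes> c) (b \<otimes> d)"
    if "(a', b') \<in> fraction R a b" "(c', d') \<in> fraction R c d" for a' b' c' d'
  proof -
    have v: "valid a' b'" "valid c' d'" "h a * h b' = h a' * h b" "h c * h d' = h c' * h d"
      using that by (auto simp: fraction_mem)
    have "(h a * h b') * (h c * h d') = (h a' * h b) * (h c' * h d)" using v by simp
    then show ?thesis using v(1,2) assms
      by (subst fraction_eq_iff) (simp_all add: valid_def mult_ac)
  qed
  have 2: "(a, b) \<in> fraction R a b" "(c, d) \<in> fraction R c d" using assms by (simp_all add: fraction_mem)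
  show ?thesis unfolding frac_field_def ring.simps monoid.simps by (rule UN_pairs_const[OF 2 1])
qed

lemma K_add:
  assumes "valid a b" "valid c d"
  shows "fraction R a b \<oplus>\<^bsub>K\<^esub> fraction R c d = fraction R (a \<otimes> d \<oplus> c \<otimes> b) (b \<otimes> d)"
proof -
  have 1: "fraction R (a' \<otimes> d' \<oplus> c' \<otimes> b') (b' \<otimes> d') = fraction R (a \<otimes> d \<oplus> c \<otimes> b) (b \<otimes> d)"
    if "(a', b') \<in> fraction R a b" "(c', d') \<in> fraction R c d" for a' b' c' d'
  proof -
    have v: "valid a' b'" "valid c' d'" "h a * h b' = h a' * h b" "h c * h d' = h c' * h d"
      using that by (auto simp: fraction_mem)
    have "(h a' * h b) * (h d * h d') + (h c' * h d) * (h b * h b') =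
        (h a * h b') * (h d * h d') + (h c * h d') * (h b * h b')" using v by simp
    then show ?thesis using v(1,2) assms
      by (subst fraction_eq_iff) (simp_all add: valid_def algebra_simps)
  qed
  have 2: "(a, b) \<in> fraction R a b" "(c, d) \<in> fraction R c d" using assms by (simp_all add: fraction_mem)
  show ?thesis unfolding frac_field_def ring.simps monoid.simps by (rule UN_pairs_const[OF 2 1])
qed

lemma K_one: "\<one>\<^bsub>K\<^esub> = fraction R \<one> \<one>" and K_zero: "\<zero>\<^bsub>K\<^esub> = fraction R \<zero> \<one>"
  by (simp_all add: frac_field_def)

lemma ring_K: "ring K"
proof (rule ringI)
  note K = K_mult K_add K_one K_zero fraction_eq_iff
  show "abelian_group K"
  proof (rule abelian_groupI)
    fix x assume "x \<in> carrier K"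
    then obtain a b where ab: "valid a b" "a \<in> carrier R" "b \<in> carrier R" "h b \<noteq> 0" "x = fraction R a b"
      by (rule K_cases)
    then obtain a' where "a' \<in> carrier R" "h a' = - h a" using neg by blast
    then have "valid a' b" "fraction R a' b \<oplus>\<^bsub>K\<^esub> x = \<zero>\<^bsub>K\<^esub>"
      using ab by (simp_all add: K valid_def)
    then show "\<exists>y\<in>carrier K. y \<oplus>\<^bsub>K\<^esub> x = \<zero>\<^bsub>K\<^esub>" by (intro bexI[of _ "fraction R a' b"]) simp_all
    show "\<zero>\<^bsub>K\<^esub> \<oplus>\<^bsub>K\<^esub> x = x" using ab by (simp add: K)
  next
    fix x y assume "x \<in> carrier K" "y \<in> carrier K"
    then show "x \<oplus>\<^bsub>K\<^esub> y \<in> carrier K" "x \<oplus>\<^bsub>K\<^esub> y = y \<oplus>\<^bsub>K\<^esub> x"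
      by (elim K_cases; simp add: K algebra_simps)+
  next
    fix x y z assume "x \<in> carrier K" "y \<in> carrier K" "z \<in> carrier K"
    then show "x \<oplus>\<^bsub>K\<^esub> y \<oplus>\<^bsub>K\<^esub> z = x \<oplus>\<^bsub>K\<^esub> (y \<oplus>\<^bsub>K\<^esub> z)"
      by (elim K_cases) (simp add: K algebra_simps)
  qed (simp add: K_zero)
  show "Group.monoid K"
  proof (rule monoidI)
    fix x y z assume "x \<in> carrier K" "y \<in> carrier K" "z \<in> carrier K"
    then show "x \<otimes>\<^bsub>K\<^esub> y \<otimes>\<^bsub>K\<^esub> z = x \<otimes>\<^bsub>K\<^esub> (y \<otimes>\<^bsub>K\<^esub> z)"
      by (elim K_cases) (simp add: K algebra_simps)
  next
    fix x y assume "x \<in> carrier K" "y \<in> carrier K"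
    then show "x \<otimes>\<^bsub>K\<^esub> y \<in> carrier K" by (elim K_cases) (simp add: K)
  next
    fix x assume "x \<in> carrier K"
    then show "\<one>\<^bsub>K\<^esub> \<otimes>\<^bsub>K\<^esub> x = x" "x \<otimes>\<^bsub>K\<^esub> \<one>\<^bsub>K\<^esub> = x"
      by (elim K_cases; simp add: K)+
  qed (simp add: K_one)
  fix x y z assume "x \<in> carrier K" "y \<in> carrier K" "z \<in> carrier K"
  then show "(x \<oplus>\<^bsub>K\<^esub> y) \<otimes>\<^bsub>K\<^esub> z = x \<otimes>\<^bsub>K\<^esub> z \<oplus>\<^bsub>K\<^esub> y \<otimes>\<^bsub>K\<^esub> z"
    "z \<otimes>\<^bsub>K\<^esub> (x \<oplus>\<^bsub>K\<^esub> y) = z \<otimes>\<^bsub>K\<^esub> x \<oplus>\<^bsub>K\<^esub> z \<otimes>\<^bsub>K\<^esub> y"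
    by (elim K_cases; simp add: K algebra_simps)+
qed

lemma K_power:
  assumes "valid a b"
  shows "\<exists>c d. valid c d \<and> fraction R a b [^]\<^bsub>K\<^esub> (n::nat) = fraction R c d \<and> h c = h a ^ n \<and> h d = h b ^ n"
proof (induction n)
  case 0
  then show ?case by (intro exI[of _ \<one>]) (simp add: K_one)
next
  case (Suc n)
  then obtain c d where "valid c d" "fraction R a b [^]\<^bsub>K\<^esub> n = fraction R c d" "h c = h a ^ n" "h d = h b ^ n"
    by blast
  then show ?case using assms
    by (intro exI[of _ "c \<otimes> a"] exI[of _ "d \<otimes> b"]) (auto simp: K_mult valid_def mult.commute)
qed

text \<open>The power of \<open>h b\<close> is the length of the list, one more than the degree; the
  extra factor is cancelled in \<open>integrally_closedI\<close>. The equation is cross-multiplied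
  because the representative of the value is not normalized.\<close>

lemma K_eval:
  assumes "valid a b" "set cs \<subseteq> carrier R"
  shows "\<exists>c d. valid c d \<and> ring.eval K (map (\<lambda>c. fraction R c \<one>) cs) (fraction R a b) = fraction R c d \<and>
    h c * h b ^ length cs = h d * homog_eval (h a) (h b) (map h cs)"
  using assms(2)
proof (induction cs)
  case Nil
  then show ?case by (intro exI[of _ \<zero>] exI[of _ \<one>]) (simp add: K_zero ring.eval.simps[OF ring_K])
next
  case (Cons x cs)
  then obtain c d where cd: "valid c d"
      "ring.eval K (map (\<lambda>c. fraction R c \<one>) cs) (fraction R a b) = fraction R c d"
      "h c * h b ^ length cs = h d * homog_eval (h a) (h b) (map h cs)" by auto
  obtain e f where ef: "valid e f" "fraction R a b [^]\<^bsub>K\<^esub> (length cs) = fraction R e f"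
      "h e = h a ^ length cs" "h f = h b ^ length cs"
    using K_power[OF assms(1)] by blast
  have x: "x \<in> carrier R" using Cons.prems by simp
  have "ring.eval K (map (\<lambda>c. fraction R c \<one>) (x # cs)) (fraction R a b) =
      fraction R x \<one> \<otimes>\<^bsub>K\<^esub> fraction R e f \<oplus>\<^bsub>K\<^esub> fraction R c d"
    using cd ef by (simp add: ring.eval.simps[OF ring_K])
  also have "\<dots> = fraction R (x \<otimes> e \<otimes> d \<oplus> c \<otimes> (\<one> \<otimes> f)) (\<one> \<otimes> f \<otimes> d)"
    using x cd ef by (simp add: K_mult K_add)
  finally have 1: "ring.eval K (map (\<lambda>c. fraction R c \<one>) (x # cs)) (fraction R a b) =
      fraction R (x \<otimes> e \<otimes> d \<oplus> c \<otimes> (\<one> \<otimes> f)) (\<one> \<otimes> f \<otimes> d)" .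
  have v: "valid (x \<otimes> e \<otimes> d \<oplus> c \<otimes> (\<one> \<otimes> f)) (\<one> \<otimes> f \<otimes> d)"
    using x cd ef by (simp add: valid_def)
  have hc: "h (x \<otimes> e \<otimes> d \<oplus> c \<otimes> (\<one> \<otimes> f)) = h x * h a ^ length cs * h d + h c * h b ^ length cs"
    using x cd(1) ef by (simp add: valid_def)
  have hd: "h (\<one> \<otimes> f \<otimes> d) = h b ^ length cs * h d"
    using cd(1) ef by (simp add: valid_def)
  have "h (x \<otimes> e \<otimes> d \<oplus> c \<otimes> (\<one> \<otimes> f)) * h b ^ length (x # cs) =
      h (\<one> \<otimes> f \<otimes> d) * homog_eval (h a) (h b) (map h (x # cs))"
    unfolding hc hd using cd(3) by (simp add: algebra_simps)
  then show ?case using 1 v by blast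
qed

lemma integrally_closedI:
  assumes "\<And>a b cs. a \<in> carrier R \<Longrightarrow> b \<in> carrier R \<Longrightarrow> h b \<noteq> 0 \<Longrightarrow>
      h a ^ length cs + homog_eval (h a) (h b) cs = 0 \<Longrightarrow> \<exists>q\<in>carrier R. h a = h b * h q"
  shows "integrally_closed R"
  unfolding integrally_closed_def Let_def
proof (intro conjI domain ballI impI)
  let ?S = "(\<lambda>a. fraction R a \<one>) ` carrier R"
  fix x assume x: "x \<in> carrier K" and int: "integral_over K ?S x"
  obtain a b where ab: "valid a b" "x = fraction R a b" using x by (auto simp: carrier_K)
  obtain p where p: "p \<noteq> []" "set p \<subseteq> ?S" "hd p = \<one>\<^bsub>K\<^esub>" "ring.eval K p x = \<zero>\<^bsub>K\<^esub>"
    using int by (auto simp: integral_over_def)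
  obtain cs where cs: "set cs \<subseteq> carrier R" "p = map (\<lambda>c. fraction R c \<one>) cs"
  proof -
    define g where "g = (\<lambda>y. SOME a. a \<in> carrier R \<and> y = fraction R a \<one>)"
    have g: "g y \<in> carrier R \<and> y = fraction R (g y) \<one>" if "y \<in> set p" for y
      unfolding g_def by (rule someI_ex) (use p(2) that in blast)
    have "p = map (\<lambda>c. fraction R c \<one>) (map g p)" using g by (simp add: map_idI)
    moreover have "set (map g p) \<subseteq> carrier R" using g by auto
    ultimately show ?thesis using that by blast
  qed
  obtain c ds where c: "cs = c # ds" using p(1) cs(2) by (cases cs) auto
  obtain n d where nd: "valid n d" "ring.eval K p x = fraction R n d"
      "h n * h b ^ length cs = h d * homog_eval (h a) (h b) (map h cs)"
    using K_eval[OF ab(1) cs(1)] cs(2) ab(2) by blast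
  have "fraction R n d = fraction R \<zero> \<one>" using p(4) nd(2) by (simp add: K_zero)
  then have "h n = 0" using nd(1) by (simp add: fraction_eq_iff)
  then have e0: "homog_eval (h a) (h b) (map h cs) = 0" using nd by (simp add: valid_def)
  have "fraction R c \<one> = fraction R \<one> \<one>" using p(3) cs c by (simp add: K_one)
  then have "h c = 1" using cs(1) c by (simp add: fraction_eq_iff)
  \<comment> \<open>As the leading coefficient is 1, \<open>homog_eval\<close> of the whole list is
    \<open>h b\<close> times the homogenized monic equation.\<close>
  then have "h b * (h a ^ length (map h ds) + homog_eval (h a) (h b) (map h ds)) = 0"
    using e0 c by (simp add: algebra_simps)
  then have "h a ^ length (map h ds) + homog_eval (h a) (h b) (map h ds) = 0"
    using ab(1) by (simp add: valid_def)
  then obtain q where q: "q \<in> carrier R" "h a = h b * h q"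
    using assms[of a b "map h ds"] ab(1) by (auto simp: valid_def)
  then have "x = fraction R q \<one>" using ab by (simp add: fraction_eq_iff mult.commute)
  then show "x \<in> ?S" using q by blast
qed

end

section \<open>Arc rings of algebras of functions\<close>

locale fun_algebra =
  fixes A :: "('x \<Rightarrow> complex) set"
  assumes const: "(\<lambda>_. c) \<in> A"
    and add: "f \<in> A \<Longrightarrow> g \<in> A \<Longrightarrow> (\<lambda>x. f x + g x) \<in> A"
    and mult: "f \<in> A \<Longrightarrow> g \<in> A \<Longrightarrow> (\<lambda>x. f x * g x) \<in> A"
begin

lemma smult: "f \<in> A \<Longrightarrow> (\<lambda>x. c * f x) \<in> A"
  using mult[OF const] by simp

abbreviation "R \<equiv> fun_alg A"

definition Pm :: "nat \<Rightarrow> (('x \<Rightarrow> complex) \<times> nat) cpoly set" where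
  "Pm m = {p. pvars p \<subseteq> A \<times> {..m}}"

lemma Pm_closed:
  "p \<in> Pm m \<Longrightarrow> q \<in> Pm m \<Longrightarrow> p + q \<in> Pm m" "p \<in> Pm m \<Longrightarrow> q \<in> Pm m \<Longrightarrow> p * q \<in> Pm m"
  "p \<in> Pm m \<Longrightarrow> q \<in> Pm m \<Longrightarrow> p - q \<in> Pm m" "0 \<in> Pm m" "1 \<in> Pm m" "p \<in> Pm m \<Longrightarrow> - p \<in> Pm m"
  "pconst c \<in> Pm m" "f \<in> A \<Longrightarrow> k \<le> m \<Longrightarrow> pvar (f, k) \<in> Pm m"
  by (simp_all add: Pm_def pvars_add_subset pvars_mult_subset pvars_diff_subset)

lemma Pm_sum: "(\<And>a. a \<in> C \<Longrightarrow> f a \<in> Pm m) \<Longrightarrow> sum f C \<in> Pm m"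
  by (induction C rule: infinite_finite_induct) (auto simp: Pm_closed)

lemma Pm_mono: "m \<le> n \<Longrightarrow> Pm m \<subseteq> Pm n"
  by (auto simp: Pm_def)

lemma jet_poly_simps [simp]:
  "carrier (jet_poly R m) = Pm m" "monoid.mult (jet_poly R m) = (*)" "\<one>\<^bsub>jet_poly R m\<^esub> = 1"
  "\<zero>\<^bsub>jet_poly R m\<^esub> = 0" "ring.add (jet_poly R m) = (+)"
  by (auto simp: jet_poly_def Pm_def pvars_def fun_alg_def)

lemma cring_jet_poly: "cring (jet_poly R m)"
proof (rule cringI)
  show "abelian_group (jet_poly R m)"
  proof (rule abelian_groupI)
    fix x assume "x \<in> carrier (jet_poly R m)"
    then show "\<exists>y\<in>carrier (jet_poly R m). y \<oplus>\<^bsub>jet_poly R m\<^esub> x = \<zero>\<^bsub>jet_poly R m\<^esub>"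
      by (intro bexI[of _ "- x"]) (simp_all add: Pm_closed)
  qed (simp_all add: Pm_closed add_ac)
  show "Group.comm_monoid (jet_poly R m)"
    by (rule comm_monoidI) (simp_all add: Pm_closed mult_ac)
qed (simp add: algebra_simps)

lemma idealI_jet_poly:
  assumes "K \<subseteq> Pm m" "0 \<in> K" "\<And>x y. x \<in> K \<Longrightarrow> y \<in> K \<Longrightarrow> x + y \<in> K"
    and mult: "\<And>x p. x \<in> K \<Longrightarrow> p \<in> Pm m \<Longrightarrow> p * x \<in> K"
  shows "ideal K (jet_poly R m)"
proof -
  interpret cring "jet_poly R m" by (rule cring_jet_poly)
  have m: "\<ominus>\<^bsub>jet_poly R m\<^esub> x = - x" if "x \<in> Pm m" for x
    using minus_equality[of "- x" x] that by (simp add: Pm_closed)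
  show ?thesis
  proof (rule idealI)
    show "subgroup K (add_monoid (jet_poly R m))"
    proof (rule subgroup.intro)
      fix x assume x: "x \<in> K"
      then have "inv\<^bsub>add_monoid (jet_poly R m)\<^esub> x = pconst (- 1) * x"
        using m[of x] assms(1) by (auto simp: a_inv_def pconst_uminus)
      then show "inv\<^bsub>add_monoid (jet_poly R m)\<^esub> x \<in> K"
        using mult[OF x, of "pconst (- 1)"] by (simp add: Pm_closed)
    qed (use assms in auto)
    show "a \<otimes>\<^bsub>jet_poly R m\<^esub> x \<in> K" if "a \<in> K" "x \<in> carrier (jet_poly R m)" for a x
      using mult[OF that(1), of x] that by (simp add: mult.commute)
  qed (use assms ring_axioms in auto)
qed

definition JI :: "nat \<Rightarrow> (('x \<Rightarrow> complex) \<times> nat) cpoly set" where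
  "JI m = jet_ideal R m"

lemma jet_rels_alt: "jet_rels R m =
     {pvar (\<lambda>x. f x + g x, k) - (pvar (f, k) + pvar (g, k)) | f g k. f \<in> A \<and> g \<in> A \<and> k \<le> m} \<union>
     {pvar (\<lambda>x. f x * g x, k) - (\<Sum>i\<le>k. pvar (f, i) * pvar (g, k - i)) | f g k. f \<in> A \<and> g \<in> A \<and> k \<le> m} \<union>
     {pvar (\<lambda>x. c * f x, k) - pconst c * pvar (f, k) | c f k. f \<in> A \<and> k \<le> m} \<union>
     {pvar (\<lambda>_. 1, k) - (if k = 0 then 1 else 0) | k. k \<le> m}"
  by (simp add: jet_rels_def fun_alg_def)

lemma jet_rels_subset: "jet_rels R m \<subseteq> Pm m"
  unfolding jet_rels_alt
  by (auto intro!: Pm_closed Pm_sum const add mult smult)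

lemma ideal_JI: "ideal (JI m) (jet_poly R m)"
proof -
  interpret cring "jet_poly R m" by (rule cring_jet_poly)
  show ?thesis unfolding JI_def jet_ideal_def by (rule genideal_ideal) (simp add: jet_rels_subset)
qed

lemma jet_rels_JI: "jet_rels R m \<subseteq> JI m"
proof -
  interpret cring "jet_poly R m" by (rule cring_jet_poly)
  show ?thesis unfolding JI_def jet_ideal_def by (rule genideal_self) (simp add: jet_rels_subset)
qed

lemma JI_closed:
  "0 \<in> JI m" "x \<in> JI m \<Longrightarrow> y \<in> JI m \<Longrightarrow> x + y \<in> JI m" "x \<in> JI m \<Longrightarrow> p \<in> Pm m \<Longrightarrow> p * x \<in> JI m"
  "JI m \<subseteq> Pm m"
proof -
  interpret ideal "JI m" "jet_poly R m" by (rule ideal_JI)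
  show "0 \<in> JI m" "x \<in> JI m \<Longrightarrow> y \<in> JI m \<Longrightarrow> x + y \<in> JI m" "x \<in> JI m \<Longrightarrow> p \<in> Pm m \<Longrightarrow> p * x \<in> JI m"
    "JI m \<subseteq> Pm m"
    using additive_subgroup.zero_closed[OF is_additive_subgroup]
      additive_subgroup.a_closed[OF is_additive_subgroup, of x y] I_l_closed[of x p] a_subset
    by simp_all
qed

lemma JI_rels:
  "f \<in> A \<Longrightarrow> g \<in> A \<Longrightarrow> k \<le> m \<Longrightarrow> pvar (\<lambda>x. f x + g x, k) - (pvar (f, k) + pvar (g, k)) \<in> JI m"
  "f \<in> A \<Longrightarrow> g \<in> A \<Longrightarrow> k \<le> m \<Longrightarrow>
    pvar (\<lambda>x. f x * g x, k) - (\<Sum>i\<le>k. pvar (f, i) * pvar (g, k - i)) \<in> JI m"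
  "f \<in> A \<Longrightarrow> k \<le> m \<Longrightarrow> pvar (\<lambda>x. c * f x, k) - pconst c * pvar (f, k) \<in> JI m"
  "k \<le> m \<Longrightarrow> pvar (\<lambda>_. 1, k) - (if k = 0 then 1 else 0) \<in> JI m"
proof -
  assume fg: "f \<in> A" "g \<in> A" "k \<le> m"
  show "pvar (\<lambda>x. f x + g x, k) - (pvar (f, k) + pvar (g, k)) \<in> JI m"
    by (rule subsetD[OF jet_rels_JI], unfold jet_rels_alt,
        intro UnI1 CollectI exI[of _ f] exI[of _ g] exI[of _ k]) (simp add: fg)
  show "pvar (\<lambda>x. f x * g x, k) - (\<Sum>i\<le>k. pvar (f, i) * pvar (g, k - i)) \<in> JI m"
    by (rule subsetD[OF jet_rels_JI], unfold jet_rels_alt,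
        rule UnI1, rule UnI1, rule UnI2, intro CollectI exI[of _ f] exI[of _ g] exI[of _ k]) (simp add: fg)
next
  assume f: "f \<in> A" "k \<le> m"
  show "pvar (\<lambda>x. c * f x, k) - pconst c * pvar (f, k) \<in> JI m"
    by (rule subsetD[OF jet_rels_JI], unfold jet_rels_alt,
        rule UnI1, rule UnI2, intro CollectI exI[of _ c] exI[of _ f] exI[of _ k]) (simp add: f)
next
  assume k: "k \<le> m"
  show "pvar (\<lambda>_. 1, k) - (if k = 0 then 1 else 0) \<in> JI m"
    by (rule subsetD[OF jet_rels_JI], unfold jet_rels_alt,
        rule UnI2, intro CollectI exI[of _ k]) (simp add: k)
qed

text \<open>The elements of the ideal that satisfy the property form an ideal containing the
  relations.\<close>

lemma JI_induct [consumes 1, case_names zero rel add mult]: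
  assumes x: "x \<in> JI m" and "P 0" "\<And>x. x \<in> jet_rels R m \<Longrightarrow> P x"
    and "\<And>x y. x \<in> JI m \<Longrightarrow> y \<in> JI m \<Longrightarrow> P x \<Longrightarrow> P y \<Longrightarrow> P (x + y)"
    and "\<And>x p. x \<in> JI m \<Longrightarrow> p \<in> Pm m \<Longrightarrow> P x \<Longrightarrow> P (p * x)"
  shows "P x"
proof -
  interpret cring "jet_poly R m" by (rule cring_jet_poly)
  let ?K = "{x \<in> JI m. P x}"
  have "ideal ?K (jet_poly R m)"
  proof (rule idealI_jet_poly)
    show "?K \<subseteq> Pm m" using JI_closed(4) by blast
    show "0 \<in> ?K" using assms(2) JI_closed(1) by blast
    show "x + y \<in> ?K" if "x \<in> ?K" "y \<in> ?K" for x y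
      using that assms(4) JI_closed(2) by blast
    show "p * x \<in> ?K" if "x \<in> ?K" "p \<in> Pm m" for x p
      using that assms(5) JI_closed(3) by blast
  qed
  then have "JI m \<subseteq> ?K"
    unfolding JI_def jet_ideal_def
    by (rule genideal_minimal) (use assms(3) jet_rels_JI in \<open>auto simp: JI_def jet_ideal_def\<close>)
  then show ?thesis using x by auto
qed

lemma JI_mono: "m \<le> n \<Longrightarrow> JI m \<subseteq> JI n"
proof
  fix x assume mn: "m \<le> n" and "x \<in> JI m"
  from this(2) show "x \<in> JI n"
  proof (induction rule: JI_induct)
    case (rel x)
    have "jet_rels R m \<subseteq> jet_rels R n"
      unfolding jet_rels_alt
      by (intro Un_mono Collect_mono impI; elim exE conjE; intro exI conjI;
          (assumption | erule order_trans[OF _ mn]))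
    then show ?case using rel jet_rels_JI by blast
  next
    case (mult x p)
    then show ?case using JI_closed(3) Pm_mono[OF mn] by blast
  qed (simp_all add: JI_closed(1,2))
qed

text \<open>The transition maps send a polynomial to its own class at the next level. So all jet
  rings come from one polynomial ring with growing sets of variables, and the direct limit is the
  quotient of \<open>P\<close> by \<open>J\<close>.\<close>

definition P :: "(('x \<Rightarrow> complex) \<times> nat) cpoly set" where
  "P = {p. pvars p \<subseteq> A \<times> UNIV}"

definition J :: "(('x \<Rightarrow> complex) \<times> nat) cpoly set" where
  "J = (\<Union>m. JI m)"

lemma P_eq: "P = (\<Union>m. Pm m)"
proof (intro equalityI subsetI)
  fix p assume p: "p \<in> P"
  let ?m = "Max (insert 0 (snd ` pvars p))"
  have "snd v \<le> ?m" if "v \<in> pvars p" for v using that by (intro Max_ge) auto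
  then have "p \<in> Pm ?m" using p unfolding P_def Pm_def by fastforce
  then show "p \<in> (\<Union>m. Pm m)" by blast
qed (auto simp: P_def Pm_def)

lemma P_closed:
  "p \<in> P \<Longrightarrow> q \<in> P \<Longrightarrow> p + q \<in> P" "p \<in> P \<Longrightarrow> q \<in> P \<Longrightarrow> p * q \<in> P"
  "p \<in> P \<Longrightarrow> q \<in> P \<Longrightarrow> p - q \<in> P" "0 \<in> P" "1 \<in> P" "p \<in> P \<Longrightarrow> - p \<in> P"
  "pconst c \<in> P" "f \<in> A \<Longrightarrow> pvar (f, k) \<in> P"
  by (simp_all add: P_def pvars_add_subset pvars_mult_subset pvars_diff_subset)

lemma P_sum: "(\<And>a. a \<in> C \<Longrightarrow> f a \<in> P) \<Longrightarrow> sum f C \<in> P"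
  by (induction C rule: infinite_finite_induct) (auto simp: P_closed)

lemma J_zero: "0 \<in> J"
  unfolding J_def using JI_closed(1) by blast

lemma J_add: "x \<in> J \<Longrightarrow> y \<in> J \<Longrightarrow> x + y \<in> J"
proof -
  assume "x \<in> J" "y \<in> J"
  then obtain m n where "x \<in> JI m" "y \<in> JI n" by (auto simp: J_def)
  then have "x \<in> JI (max m n)" "y \<in> JI (max m n)"
    using JI_mono[of m "max m n"] JI_mono[of n "max m n"] by auto
  then show ?thesis using JI_closed(2) by (auto simp: J_def)
qed

lemma J_mult: "x \<in> J \<Longrightarrow> p \<in> P \<Longrightarrow> p * x \<in> J"
proof -
  assume "x \<in> J" "p \<in> P"
  then obtain m n where "x \<in> JI m" "p \<in> Pm n" by (auto simp: J_def P_eq)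
  then have "x \<in> JI (max m n)" "p \<in> Pm (max m n)"
    using JI_mono[of m "max m n"] Pm_mono[of n "max m n"] by auto
  then show ?thesis using JI_closed(3) by (auto simp: J_def)
qed

lemma J_uminus: "x \<in> J \<Longrightarrow> - x \<in> J"
  using J_mult[of x "pconst (- 1)"] by (simp add: P_closed pconst_uminus)

lemma J_sum: "(\<And>a. a \<in> C \<Longrightarrow> f a \<in> J) \<Longrightarrow> sum f C \<in> J"
  by (induction C rule: infinite_finite_induct) (auto simp: J_zero J_add)

lemma J_minus_commute: "x - y \<in> J \<Longrightarrow> y - x \<in> J"
  using J_uminus[of "x - y"] by simp

lemma J_trans: "x - y \<in> J \<Longrightarrow> y - z \<in> J \<Longrightarrow> x - z \<in> J"
  using J_add[of "x - y" "y - z"] by simp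

lemma J_diff_mult:
  assumes "p - p' \<in> J" "q - q' \<in> J" "q \<in> P" "p' \<in> P"
  shows "p * q - p' * q' \<in> J"
proof -
  have "p * q - p' * q' = q * (p - p') + p' * (q - q')" by (simp add: algebra_simps)
  then show ?thesis using assms J_mult J_add by simp
qed

lemma J_diff_add: "p - p' \<in> J \<Longrightarrow> q - q' \<in> J \<Longrightarrow> (p + q) - (p' + q') \<in> J"
  using J_add[of "p - p'" "q - q'"] by (simp add: algebra_simps)

lemma J_rels:
  "f \<in> A \<Longrightarrow> g \<in> A \<Longrightarrow> pvar (\<lambda>x. f x + g x, k) - (pvar (f, k) + pvar (g, k)) \<in> J"
  "f \<in> A \<Longrightarrow> g \<in> A \<Longrightarrow> pvar (\<lambda>x. f x * g x, k) - (\<Sum>i\<le>k. pvar (f, i) * pvar (g, k - i)) \<in> J"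
  "f \<in> A \<Longrightarrow> pvar (\<lambda>x. c * f x, k) - pconst c * pvar (f, k) \<in> J"
  "pvar (\<lambda>_. 1, k) - (if k = 0 then 1 else 0) \<in> J"
proof -
  assume fg: "f \<in> A" "g \<in> A"
  show "pvar (\<lambda>x. f x + g x, k) - (pvar (f, k) + pvar (g, k)) \<in> J"
    unfolding J_def by (rule UN_I[of k], rule UNIV_I, rule JI_rels(1)[OF fg order_refl])
  show "pvar (\<lambda>x. f x * g x, k) - (\<Sum>i\<le>k. pvar (f, i) * pvar (g, k - i)) \<in> J"
    unfolding J_def by (rule UN_I[of k], rule UNIV_I, rule JI_rels(2)[OF fg order_refl])
next
  assume f: "f \<in> A"
  show "pvar (\<lambda>x. c * f x, k) - pconst c * pvar (f, k) \<in> J"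
    unfolding J_def by (rule UN_I[of k], rule UNIV_I, rule JI_rels(3)[OF f order_refl])
next
  show "pvar (\<lambda>_. 1, k) - (if k = 0 then 1 else 0) \<in> J"
    unfolding J_def by (rule UN_I[of k], rule UNIV_I, rule JI_rels(4)[OF order_refl])
qed

lemma J_psubst:
  fixes h h' :: "'v \<Rightarrow> (('x \<Rightarrow> complex) \<times> nat) cpoly"
  assumes "\<And>v. v \<in> pvars p \<Longrightarrow> h v - h' v \<in> J \<and> h v \<in> P \<and> h' v \<in> P"
  shows "psubst h p - psubst h' p \<in> J \<and> psubst h p \<in> P \<and> psubst h' p \<in> P"
proof -
  have "psubst h q - psubst h' q \<in> J \<and> psubst h q \<in> P \<and> psubst h' q \<in> P" if "pvars q \<subseteq> pvars p" for q
    using that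
  proof (induction q rule: cpoly_induct)
    case (const a)
    then show ?case by (simp add: J_zero P_closed)
  next
    case (add p q)
    then show ?case by (simp add: J_diff_add P_closed)
  next
    case (mult p q)
    then show ?case by (simp add: J_diff_mult P_closed)
  qed (use assms in auto)
  then show ?thesis by simp
qed

abbreviation jcl :: "nat \<Rightarrow> (('x \<Rightarrow> complex) \<times> nat) cpoly \<Rightarrow> _" where
  "jcl m p \<equiv> jet_class R m p"

lemma jcl_eq: "jcl m p = {i + p | i. i \<in> JI m}"
  unfolding jet_class_def a_r_coset_def' JI_def by auto

lemma jcl_eq_iff: "jcl m p = jcl m q \<longleftrightarrow> p - q \<in> JI m"
proof
  assume "jcl m p = jcl m q"
  then have "p \<in> jcl m q" unfolding jcl_eq using JI_closed(1)[of m] by force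
  then show "p - q \<in> JI m" by (auto simp: jcl_eq)
next
  assume pq: "p - q \<in> JI m"
  have sub: "jcl m p \<subseteq> jcl m q" if pq: "p - q \<in> JI m" for p q
  proof
    fix x assume "x \<in> jcl m p"
    then obtain i where "i \<in> JI m" "x = i + p" by (auto simp: jcl_eq)
    then have "i + (p - q) \<in> JI m" "x = (i + (p - q)) + q" using JI_closed(2) pq by auto
    then show "x \<in> jcl m q" unfolding jcl_eq by blast
  qed
  have "pconst (- 1) * (p - q) \<in> JI m" by (rule JI_closed(3)[OF pq]) (rule Pm_closed)
  then have "q - p \<in> JI m" by (simp add: pconst_uminus)
  then show "jcl m p = jcl m q" using sub[OF pq] sub[of q p] by blast
qed

lemma jcl_self: "p \<in> jcl m p"
  unfolding jcl_eq using JI_closed(1)[of m] by force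

lemma jcl_mem: "q \<in> jcl m p \<longleftrightarrow> q - p \<in> JI m"
  unfolding jcl_eq by (auto intro: exI[of _ "q - p"])

lemma jet_ring_simps:
  "carrier (jet_ring R m) = jcl m ` Pm m"
  "p \<in> Pm m \<Longrightarrow> q \<in> Pm m \<Longrightarrow> jcl m p \<otimes>\<^bsub>jet_ring R m\<^esub> jcl m q = jcl m (p * q)"
  "p \<in> Pm m \<Longrightarrow> q \<in> Pm m \<Longrightarrow> jcl m p \<oplus>\<^bsub>jet_ring R m\<^esub> jcl m q = jcl m (p + q)"
  "\<one>\<^bsub>jet_ring R m\<^esub> = jcl m 1" "\<zero>\<^bsub>jet_ring R m\<^esub> = jcl m 0"
proof -
  interpret I: ideal "JI m" "jet_poly R m" by (rule ideal_JI)
  have c: "jcl m p = JI m +>\<^bsub>jet_poly R m\<^esub> p" for p by (simp add: jet_class_def JI_def)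
  show "carrier (jet_ring R m) = jcl m ` Pm m"
    by (auto simp: jet_ring_def FactRing_def A_RCOSETS_def' c JI_def)
  show "p \<in> Pm m \<Longrightarrow> q \<in> Pm m \<Longrightarrow> jcl m p \<otimes>\<^bsub>jet_ring R m\<^esub> jcl m q = jcl m (p * q)"
    using I.rcoset_mult_add[of p q] by (simp add: jet_ring_def FactRing_def c JI_def)
  show "p \<in> Pm m \<Longrightarrow> q \<in> Pm m \<Longrightarrow> jcl m p \<oplus>\<^bsub>jet_ring R m\<^esub> jcl m q = jcl m (p + q)"
    using I.a_rcos_sum[of p q] by (simp add: jet_ring_def FactRing_def c JI_def)
  show "\<one>\<^bsub>jet_ring R m\<^esub> = jcl m 1" by (simp add: jet_ring_def FactRing_def c JI_def)
  show "\<zero>\<^bsub>jet_ring R m\<^esub> = jcl m 0"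
    unfolding jcl_eq by (simp add: jet_ring_def FactRing_def JI_def)
qed

lemma jet_trans_jcl:
  assumes "m \<le> n"
  shows "jet_trans R m n (jcl m p) = jcl n p"
proof -
  have "jcl n q = jcl n p" if "q \<in> jcl m p" for q
    using that JI_mono[OF assms] by (auto simp: jcl_mem jcl_eq_iff)
  then show ?thesis unfolding jet_trans_def using jcl_self[of p m] by blast
qed

text \<open>An explicit description of a class of the direct limit, in which \<open>p\<close> need
  not be assigned to a level.\<close>

definition acl :: "(('x \<Rightarrow> complex) \<times> nat) cpoly \<Rightarrow> (nat \<times> (('x \<Rightarrow> complex) \<times> nat) cpoly set) set" where
  "acl p = {(n, jcl n q) | n q. q \<in> Pm n \<and> p - q \<in> J}"

lemma dlim_rel_jcl:
  assumes "p \<in> Pm m"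
  shows "((m, jcl m p), (n, y)) \<in> dlim_rel (jet_ring R) (jet_trans R) \<longleftrightarrow> (\<exists>q\<in>Pm n. y = jcl n q \<and> p - q \<in> J)"
proof
  assume "((m, jcl m p), (n, y)) \<in> dlim_rel (jet_ring R) (jet_trans R)"
  then obtain q k where q: "q \<in> Pm n" "y = jcl n q" "m \<le> k" "n \<le> k"
      "jet_trans R m k (jcl m p) = jet_trans R n k y"
    by (auto simp: dlim_rel_def jet_ring_simps)
  then have "p - q \<in> JI k" by (simp add: jet_trans_jcl jcl_eq_iff)
  then show "\<exists>q\<in>Pm n. y = jcl n q \<and> p - q \<in> J" using q by (auto simp: J_def)
next
  assume "\<exists>q\<in>Pm n. y = jcl n q \<and> p - q \<in> J"
  then obtain q k where q: "q \<in> Pm n" "y = jcl n q" "p - q \<in> JI k" by (auto simp: J_def)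
  let ?k = "max k (max m n)"
  have "p - q \<in> JI ?k" using q(3) JI_mono[of k ?k] by auto
  then have "jet_trans R m ?k (jcl m p) = jet_trans R n ?k y"
    using q by (simp add: jet_trans_jcl jcl_eq_iff)
  then show "((m, jcl m p), (n, y)) \<in> dlim_rel (jet_ring R) (jet_trans R)"
    using assms q by (auto simp: dlim_rel_def jet_ring_simps intro!: exI[of _ ?k])
qed

lemma dlim_in_jcl: "p \<in> Pm m \<Longrightarrow> dlim_in (jet_ring R) (jet_trans R) m (jcl m p) = acl p"
  unfolding dlim_in_def acl_def by (auto simp: dlim_rel_jcl)

lemma acl_eq_iff:
  assumes "p \<in> P" "q \<in> P"
  shows "acl p = acl q \<longleftrightarrow> p - q \<in> J"
proof
  assume e: "acl p = acl q"
  obtain m where m: "p \<in> Pm m" using assms P_eq by auto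
  then have "(m, jcl m p) \<in> acl p" unfolding acl_def using J_zero by fastforce
  then obtain q' where q': "jcl m p = jcl m q'" "q - q' \<in> J" unfolding e by (auto simp: acl_def)
  then have "p - q' \<in> J" by (auto simp: jcl_eq_iff J_def)
  then show "p - q \<in> J" using J_trans[OF _ J_minus_commute] q'(2) by blast
next
  assume pq: "p - q \<in> J"
  have "p - r \<in> J \<longleftrightarrow> q - r \<in> J" for r
    using J_trans[OF pq] J_trans[OF J_minus_commute[OF pq]] by blast
  then show "acl p = acl q" by (simp add: acl_def)
qed

lemma acl_cases:
  assumes "(m, x) \<in> acl p"
  obtains p' where "p' \<in> Pm m" "x = jcl m p'" "p' - p \<in> J"
  using assms J_minus_commute by (auto simp: acl_def)

lemma acl_nonempty:
  assumes "p \<in> P"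
  obtains m x where "(m, x) \<in> acl p"
proof -
  obtain m where "p \<in> Pm m" using assms P_eq by auto
  then have "(m, jcl m p) \<in> acl p" unfolding acl_def using J_zero by fastforce
  then show ?thesis by (rule that)
qed

lemma Pm_P: "p \<in> Pm m \<Longrightarrow> p \<in> P"
  by (auto simp: P_eq)

lemma carrier_arc_ring: "carrier (arc_ring R) = acl ` P"
proof -
  have "carrier (arc_ring R) = (\<Union>m. \<Union>p\<in>Pm m. {dlim_in (jet_ring R) (jet_trans R) m (jcl m p)})"
    by (auto simp: arc_ring_def dlim_def quotient_def dlim_in_def jet_ring_simps)
  also have "\<dots> = acl ` P" by (auto simp: dlim_in_jcl P_eq)
  finally show ?thesis .
qed

lemma arc_ring_simps:
  "\<one>\<^bsub>arc_ring R\<^esub> = acl 1" "\<zero>\<^bsub>arc_ring R\<^esub> = acl 0"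
  "p \<in> P \<Longrightarrow> q \<in> P \<Longrightarrow> acl p \<otimes>\<^bsub>arc_ring R\<^esub> acl q = acl (p * q)"
  "p \<in> P \<Longrightarrow> q \<in> P \<Longrightarrow> acl p \<oplus>\<^bsub>arc_ring R\<^esub> acl q = acl (p + q)"
proof -
  show "\<one>\<^bsub>arc_ring R\<^esub> = acl 1" "\<zero>\<^bsub>arc_ring R\<^esub> = acl 0"
    by (simp_all add: arc_ring_def dlim_def jet_ring_simps dlim_in_jcl Pm_closed)
  assume p: "p \<in> P" and q: "q \<in> P"
  have lift: "p' \<in> Pm (max m n)" "q' \<in> Pm (max m n)" if "p' \<in> Pm m" "q' \<in> Pm n" for p' q' m n
    using that Pm_mono[of m "max m n"] Pm_mono[of n "max m n"] by auto
  obtain z w where z: "z \<in> acl p" and w: "w \<in> acl q" using acl_nonempty[OF p] acl_nonempty[OF q] by metis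
  have "(let k = max m n in dlim_in (jet_ring R) (jet_trans R) k
      (jet_trans R m k x \<otimes>\<^bsub>jet_ring R k\<^esub> jet_trans R n k y)) = acl (p * q)"
    if mx: "(m, x) \<in> acl p" and ny: "(n, y) \<in> acl q" for m x n y
  proof -
    obtain p' where p': "p' \<in> Pm m" "x = jcl m p'" "p' - p \<in> J" using mx by (rule acl_cases)
    obtain q' where q': "q' \<in> Pm n" "y = jcl n q'" "q' - q \<in> J" using ny by (rule acl_cases)
    have "acl (p' * q') = acl (p * q)"
      using p' q' p q by (subst acl_eq_iff) (auto simp: P_closed Pm_P intro!: J_diff_mult)
    then show ?thesis
      using p' q' lift[OF p'(1) q'(1)] by (simp add: Let_def jet_trans_jcl jet_ring_simps dlim_in_jcl Pm_closed)
  qed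
  then show "acl p \<otimes>\<^bsub>arc_ring R\<^esub> acl q = acl (p * q)"
    unfolding arc_ring_def dlim_def ring.simps monoid.simps by (intro UN_pairs_const[OF z w])
  have "(let k = max m n in dlim_in (jet_ring R) (jet_trans R) k
      (jet_trans R m k x \<oplus>\<^bsub>jet_ring R k\<^esub> jet_trans R n k y)) = acl (p + q)"
    if mx: "(m, x) \<in> acl p" and ny: "(n, y) \<in> acl q" for m x n y
  proof -
    obtain p' where p': "p' \<in> Pm m" "x = jcl m p'" "p' - p \<in> J" using mx by (rule acl_cases)
    obtain q' where q': "q' \<in> Pm n" "y = jcl n q'" "q' - q \<in> J" using ny by (rule acl_cases)
    have "acl (p' + q') = acl (p + q)"
      using p' q' p q by (subst acl_eq_iff) (auto simp: P_closed Pm_P intro!: J_diff_add)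
    then show ?thesis
      using p' q' lift[OF p'(1) q'(1)] by (simp add: Let_def jet_trans_jcl jet_ring_simps dlim_in_jcl Pm_closed)
  qed
  then show "acl p \<oplus>\<^bsub>arc_ring R\<^esub> acl q = acl (p + q)"
    unfolding arc_ring_def dlim_def ring.simps monoid.simps by (intro UN_pairs_const[OF z w])
qed

end

section \<open>Maps of arc rings induced by homomorphisms of function algebras\<close>

locale fun_algebra_hom = S: fun_algebra A + T: fun_algebra B
  for A :: "('x \<Rightarrow> complex) set" and B :: "('y \<Rightarrow> complex) set" +
  fixes \<phi> :: "('x \<Rightarrow> complex) \<Rightarrow> 'y \<Rightarrow> complex"
  assumes maps: "f \<in> A \<Longrightarrow> \<phi> f \<in> B"
    and hom_add: "f \<in> A \<Longrightarrow> g \<in> A \<Longrightarrow> \<phi> (\<lambda>x. f x + g x) = (\<lambda>y. \<phi> f y + \<phi> g y)"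
    and hom_mult: "f \<in> A \<Longrightarrow> g \<in> A \<Longrightarrow> \<phi> (\<lambda>x. f x * g x) = (\<lambda>y. \<phi> f y * \<phi> g y)"
    and hom_smult: "f \<in> A \<Longrightarrow> \<phi> (\<lambda>x. c * f x) = (\<lambda>y. c * \<phi> f y)"
    and hom_one: "\<phi> (\<lambda>_. 1) = (\<lambda>_. 1)"
begin

definition pr :: "(('x \<Rightarrow> complex) \<times> nat) cpoly \<Rightarrow> (('y \<Rightarrow> complex) \<times> nat) cpoly" where
  "pr = psubst (\<lambda>(f, k). pvar (\<phi> f, k))"

lemma pr_Pm: "p \<in> S.Pm m \<Longrightarrow> pr p \<in> T.Pm m"
  using pvars_psubst[of "\<lambda>(f, k). pvar (\<phi> f, k)" p] maps
  by (fastforce simp: S.Pm_def T.Pm_def pr_def)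

lemma pr_P: "p \<in> S.P \<Longrightarrow> pr p \<in> T.P"
  using pr_Pm by (auto simp: S.P_eq T.P_eq)

lemma pr_JI: "x \<in> S.JI m \<Longrightarrow> pr x \<in> T.JI m"
proof (induction rule: S.JI_induct)
  case zero
  then show ?case by (simp add: pr_def T.JI_closed)
next
  case (rel x)
  then show ?case
    unfolding S.jet_rels_alt
  proof (elim UnE CollectE exE conjE)
    fix f g k assume "f \<in> A" "g \<in> A" "k \<le> m" "x = pvar (\<lambda>x. f x + g x, k) - (pvar (f, k) + pvar (g, k))"
    then show ?thesis using T.JI_rels(1)[of "\<phi> f" "\<phi> g" k m] by (simp add: pr_def hom_add maps)
  next
    fix f g k assume "f \<in> A" "g \<in> A" "k \<le> m"
      "x = pvar (\<lambda>x. f x * g x, k) - (\<Sum>i\<le>k. pvar (f, i) * pvar (g, k - i))"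
    then show ?thesis using T.JI_rels(2)[of "\<phi> f" "\<phi> g" k m] by (simp add: pr_def hom_mult maps)
  next
    fix c f k assume "f \<in> A" "k \<le> m" "x = pvar (\<lambda>x. c * f x, k) - pconst c * pvar (f, k)"
    then show ?thesis using T.JI_rels(3)[of "\<phi> f" k m c] by (simp add: pr_def hom_smult maps)
  next
    fix k assume "k \<le> m" "x = pvar (\<lambda>_. 1, k) - (if k = 0 then 1 else 0)"
    then show ?thesis using T.JI_rels(4)[of k m] by (simp add: pr_def hom_one split: if_splits)
  qed
next
  case (add x y)
  then show ?case by (simp add: pr_def T.JI_closed)
next
  case (mult x p)
  then show ?case using T.JI_closed(3)[of "pr x" m "pr p"] pr_Pm by (simp add: pr_def)
qed

lemma pr_J: "x \<in> S.J \<Longrightarrow> pr x \<in> T.J"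
  using pr_JI by (auto simp: S.J_def T.J_def)

lemma arc_map_acl:
  assumes "p \<in> S.P"
  shows "arc_map (fun_alg B) \<phi> (S.acl p) = T.acl (pr p)"
proof -
  have jm: "jet_map (fun_alg B) \<phi> m (S.jcl m q) = T.jcl m (pr q)" for m q
  proof -
    have e: "prename (\<lambda>(a, k). (\<phi> a, k)) r = pr r" for r
      unfolding prename_eq pr_def by (rule psub_cong) (auto split: prod.splits)
    have "T.jcl m (pr r) = T.jcl m (pr q)" if "r \<in> S.jcl m q" for r
    proof -
      have "pr (r - q) \<in> T.JI m" using that by (intro pr_JI) (simp add: S.jcl_mem)
      then show ?thesis by (simp add: T.jcl_eq_iff pr_def)
    qed
    then show ?thesis unfolding jet_map_def e using S.jcl_self[of q m] by blast
  qed
  have *: "dlim_in (jet_ring (fun_alg B)) (jet_trans (fun_alg B)) m (jet_map (fun_alg B) \<phi> m x) = T.acl (pr p)"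
    if mx: "(m, x) \<in> S.acl p" for m x
  proof -
    obtain p' where p': "p' \<in> S.Pm m" "x = S.jcl m p'" "p' - p \<in> S.J" using mx by (rule S.acl_cases)
    have "pr p' - pr p \<in> T.J" using pr_J[OF p'(3)] by (simp add: pr_def)
    then have "T.acl (pr p') = T.acl (pr p)"
      using p' assms by (subst T.acl_eq_iff) (auto simp: pr_P S.Pm_P)
    then show ?thesis using p' by (simp add: jm T.dlim_in_jcl pr_Pm)
  qed
  obtain m x where "(m, x) \<in> S.acl p" using S.acl_nonempty[OF assms] .
  then show ?thesis unfolding arc_map_def using * by blast
qed

end

subsection \<open>Generators\<close>

lemma fun_algebra_gen_funs: "fun_algebra (gen_funs S)"
  by unfold_locales (auto intro: gen_funs.intros)

text \<open>The jet relations rewrite each symbol \<open>(f, k)\<close> along the construction of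
  \<open>f\<close> from the generators. A product at order \<open>k\<close> uses its factors at all
  orders up to \<open>k\<close>, so the order stays arbitrary in the induction.\<close>

lemma reduce_to_generators:
  fixes h :: "'l \<Rightarrow> 'x \<Rightarrow> complex"
  assumes A: "A = gen_funs (h ` L)" and p: "p \<in> fun_algebra.P A"
  shows "\<exists>r. pvars r \<subseteq> L \<times> UNIV \<and> p - psubst (\<lambda>(l, k). pvar (h l, k)) r \<in> fun_algebra.J A"
proof -
  interpret fun_algebra A unfolding A by (rule fun_algebra_gen_funs)
  let ?k = "psubst (\<lambda>(l, k). pvar (h l, k))"
  have hA: "h l \<in> A" if "l \<in> L" for l using that by (auto simp: A intro: gen_funs.gen)
  have kP: "?k r \<in> P" if "pvars r \<subseteq> L \<times> UNIV" for r
    using that by (induction r rule: cpoly_induct) (auto simp: P_closed hA)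
  have gen: "\<exists>r. pvars r \<subseteq> L \<times> UNIV \<and> pvar (f, k) - ?k r \<in> J" if "f \<in> gen_funs (h ` L)" for f k
    using that
  proof (induction arbitrary: k rule: gen_funs.induct)
    case (const c)
    have "pvar (\<lambda>x. c * (\<lambda>_. 1) x, k) - pconst c * pvar (\<lambda>_. 1, k) \<in> J"
      by (rule J_rels(3)) (rule fun_algebra.const, unfold_locales)
    then have 1: "pvar (\<lambda>x. c, k) - pconst c * pvar (\<lambda>_. 1, k) \<in> J" by simp
    have "pconst c * (pvar (\<lambda>_. 1, k) - (if k = 0 then 1 else 0)) \<in> J"
      by (rule J_mult[OF J_rels(4)]) (rule P_closed)
    then have "pconst c * pvar (\<lambda>_. 1, k) - pconst (if k = 0 then c else 0) \<in> J"
      by (cases k) (simp_all add: right_diff_distrib)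
    from J_trans[OF 1 this] show ?case by (intro exI[of _ "pconst (if k = 0 then c else 0)"]) simp
  next
    case (gen f)
    then obtain l where "l \<in> L" "f = h l" by auto
    then show ?case by (intro exI[of _ "pvar (l, k)"]) (simp add: J_zero)
  next
    case (add f g)
    obtain r s where r: "pvars r \<subseteq> L \<times> UNIV" "pvar (f, k) - ?k r \<in> J"
      and s: "pvars s \<subseteq> L \<times> UNIV" "pvar (g, k) - ?k s \<in> J" using add.IH by metis
    have "pvar (\<lambda>x. f x + g x, k) - (pvar (f, k) + pvar (g, k)) \<in> J"
      by (rule J_rels(1)) (use add.hyps A in auto)
    from J_trans[OF this J_diff_add[OF r(2) s(2)]] show ?case
      using r(1) s(1) by (intro exI[of _ "r + s"]) (simp add: pvars_add_subset)
  next
    case (mult f g)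
    obtain r where r: "\<And>k. pvars (r k) \<subseteq> L \<times> UNIV" "\<And>k. pvar (f, k) - ?k (r k) \<in> J" using mult.IH(1) by metis
    obtain s where s: "\<And>k. pvars (s k) \<subseteq> L \<times> UNIV" "\<And>k. pvar (g, k) - ?k (s k) \<in> J" using mult.IH(2) by metis
    have fg: "f \<in> A" "g \<in> A" using mult.hyps A by auto
    have 1: "pvar (\<lambda>x. f x * g x, k) - (\<Sum>i\<le>k. pvar (f, i) * pvar (g, k - i)) \<in> J"
      by (rule J_rels(2)[OF fg])
    have "(\<Sum>i\<le>k. pvar (f, i) * pvar (g, k - i) - ?k (r i) * ?k (s (k - i))) \<in> J"
      by (intro J_sum J_diff_mult r s kP P_closed fg)
    then have 2: "(\<Sum>i\<le>k. pvar (f, i) * pvar (g, k - i)) - ?k (\<Sum>i\<le>k. r i * s (k - i)) \<in> J"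
      by (simp add: sum_subtractf)
    have "pvars (\<Sum>i\<le>k. r i * s (k - i)) \<subseteq> L \<times> UNIV"
      by (rule order_trans[OF pvars_sum]) (intro UN_least pvars_mult_subset r s)
    with J_trans[OF 1 2] show ?case by blast
  qed
  have "pvars p \<subseteq> A \<times> UNIV" using p by (simp add: P_def)
  then show ?thesis
  proof (induction p rule: cpoly_induct)
    case (const a)
    then show ?case by (intro exI[of _ "pconst a"]) (simp add: J_zero)
  next
    case (var v)
    then show ?case using gen A by (cases v) auto
  next
    case (add p q)
    then obtain r s where "pvars r \<subseteq> L \<times> UNIV" "p - ?k r \<in> J" "pvars s \<subseteq> L \<times> UNIV" "q - ?k s \<in> J" by blast
    then show ?case using J_diff_add[of p "?k r" q "?k s"]
      by (intro exI[of _ "r + s"]) (simp add: pvars_add_subset)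
  next
    case (mult p q)
    then obtain r s where rs: "pvars r \<subseteq> L \<times> UNIV" "p - ?k r \<in> J" "pvars s \<subseteq> L \<times> UNIV" "q - ?k s \<in> J" by blast
    have "q \<in> P" using mult.hyps by (simp add: P_def)
    then have "p * q - ?k (r * s) \<in> J"
      using J_diff_mult[OF rs(2,4) _ kP[OF rs(1)]] by simp
    then show ?case using pvars_mult_subset[OF rs(1,3)] by blast
  qed
qed

subsection \<open>Evaluation along curves\<close>

text \<open>The curve \<open>w(\<tau>)\<close> matters only where \<open>D(\<tau>) \<noteq> 0\<close>; \<open>F\<close> is the expansion at \<open>0\<close> of the
  rational function \<open>f(w(\<tau>))\<close>, whose denominator is a power of \<open>D\<close>.\<close>

definition has_germ :: "complex poly \<Rightarrow> (complex \<Rightarrow> 'x) \<Rightarrow> ('x \<Rightarrow> complex) \<Rightarrow> complex fps \<Rightarrow> bool" where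
  "has_germ D w f F \<longleftrightarrow> (\<exists>N Q. (\<forall>\<tau>. poly D \<tau> \<noteq> 0 \<longrightarrow> poly D \<tau> ^ N * f (w \<tau>) = poly Q \<tau>) \<and>
     F * fps_of_poly D ^ N = fps_of_poly Q)"

lemma poly_eq_off_zeros:
  fixes D Q Q' :: "complex poly"
  assumes "D \<noteq> 0" "\<And>\<tau>. poly D \<tau> \<noteq> 0 \<Longrightarrow> poly Q \<tau> = poly Q' \<tau>"
  shows "Q = Q'"
proof -
  have "poly (D * (Q - Q')) \<tau> = 0" for \<tau> using assms(2)[of \<tau>] by (cases "poly D \<tau> = 0") auto
  then have "D * (Q - Q') = 0" using poly_all_0_iff_0 by blast
  then show ?thesis using assms(1) by simp
qed

text \<open>With denominators cleared, two expansions yield polynomials that agree off the zeros of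
  \<open>D\<close>, hence everywhere; a power of \<open>D\<close> can be cancelled among power
  series.\<close>

lemma has_germ_unique:
  assumes "D \<noteq> 0" "has_germ D w f F" "has_germ D w f F'"
  shows "F = F'"
proof -
  obtain N Q where 1: "\<And>\<tau>. poly D \<tau> \<noteq> 0 \<Longrightarrow> poly D \<tau> ^ N * f (w \<tau>) = poly Q \<tau>" "F * fps_of_poly D ^ N = fps_of_poly Q"
    using assms(2) by (auto simp: has_germ_def)
  obtain N' Q' where 2: "\<And>\<tau>. poly D \<tau> \<noteq> 0 \<Longrightarrow> poly D \<tau> ^ N' * f (w \<tau>) = poly Q' \<tau>" "F' * fps_of_poly D ^ N' = fps_of_poly Q'"
    using assms(3) by (auto simp: has_germ_def)
  have "D ^ N' * Q = D ^ N * Q'"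
  proof (rule poly_eq_off_zeros[OF assms(1)])
    fix \<tau> assume t: "poly D \<tau> \<noteq> 0"
    show "poly (D ^ N' * Q) \<tau> = poly (D ^ N * Q') \<tau>"
      using 1(1)[OF t, symmetric] 2(1)[OF t, symmetric] by simp
  qed
  then have "fps_of_poly (D ^ N' * Q) = fps_of_poly (D ^ N * Q')" by simp
  then have "fps_of_poly D ^ N' * (F * fps_of_poly D ^ N) = fps_of_poly D ^ N * (F' * fps_of_poly D ^ N')"
    unfolding 1(2) 2(2) by (simp add: fps_of_poly_mult fps_of_poly_power)
  then have "(fps_of_poly D ^ N * fps_of_poly D ^ N') * F = (fps_of_poly D ^ N * fps_of_poly D ^ N') * F'"
    by (simp only: mult_ac)
  then show ?thesis using assms(1) by simp
qed

lemma has_germ_const: "has_germ D w (\<lambda>_. c) (fps_const c)"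
  unfolding has_germ_def by (rule exI[of _ 0], rule exI[of _ "[:c:]"]) (simp add: fps_of_poly_const)

lemma has_germ_add:
  assumes "has_germ D w f F" "has_germ D w g G"
  shows "has_germ D w (\<lambda>x. f x + g x) (F + G)"
proof -
  obtain N Q where 1: "\<And>\<tau>. poly D \<tau> \<noteq> 0 \<Longrightarrow> poly D \<tau> ^ N * f (w \<tau>) = poly Q \<tau>" "F * fps_of_poly D ^ N = fps_of_poly Q"
    using assms(1) by (auto simp: has_germ_def)
  obtain N' Q' where 2: "\<And>\<tau>. poly D \<tau> \<noteq> 0 \<Longrightarrow> poly D \<tau> ^ N' * g (w \<tau>) = poly Q' \<tau>" "G * fps_of_poly D ^ N' = fps_of_poly Q'"
    using assms(2) by (auto simp: has_germ_def)
  have "poly D \<tau> ^ (N + N') * (f (w \<tau>) + g (w \<tau>)) = poly (D ^ N' * Q + D ^ N * Q') \<tau>" if "poly D \<tau> \<noteq> 0" for \<tau>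
    using 1(1)[OF that, symmetric] 2(1)[OF that, symmetric] by (simp add: power_add algebra_simps)
  moreover have "(F + G) * fps_of_poly D ^ (N + N') = fps_of_poly (D ^ N' * Q + D ^ N * Q')"
    using 1(2)[symmetric] 2(2)[symmetric]
    by (simp add: fps_of_poly_mult fps_of_poly_power fps_of_poly_add power_add algebra_simps)
  ultimately show ?thesis unfolding has_germ_def by blast
qed

lemma has_germ_mult:
  assumes "has_germ D w f F" "has_germ D w g G"
  shows "has_germ D w (\<lambda>x. f x * g x) (F * G)"
proof -
  obtain N Q where 1: "\<And>\<tau>. poly D \<tau> \<noteq> 0 \<Longrightarrow> poly D \<tau> ^ N * f (w \<tau>) = poly Q \<tau>" "F * fps_of_poly D ^ N = fps_of_poly Q"
    using assms(1) by (auto simp: has_germ_def)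
  obtain N' Q' where 2: "\<And>\<tau>. poly D \<tau> \<noteq> 0 \<Longrightarrow> poly D \<tau> ^ N' * g (w \<tau>) = poly Q' \<tau>" "G * fps_of_poly D ^ N' = fps_of_poly Q'"
    using assms(2) by (auto simp: has_germ_def)
  have "poly D \<tau> ^ (N + N') * (f (w \<tau>) * g (w \<tau>)) = poly (Q * Q') \<tau>" if "poly D \<tau> \<noteq> 0" for \<tau>
    using 1(1)[OF that, symmetric] 2(1)[OF that, symmetric] by (simp add: power_add algebra_simps)
  moreover have "(F * G) * fps_of_poly D ^ (N + N') = fps_of_poly (Q * Q')"
    using 1(2)[symmetric] 2(2)[symmetric]
    by (simp add: fps_of_poly_mult power_add algebra_simps)
  ultimately show ?thesis unfolding has_germ_def by blast
qed

lemma has_germ_poly: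
  assumes "\<And>\<tau>. poly D \<tau> \<noteq> 0 \<Longrightarrow> f (w \<tau>) = poly Q \<tau>"
  shows "has_germ D w f (fps_of_poly Q)"
  unfolding has_germ_def by (rule exI[of _ 0], rule exI[of _ Q]) (use assms in simp)

lemma has_germ_gen_funs:
  assumes "f \<in> gen_funs S" "\<And>f. f \<in> S \<Longrightarrow> \<exists>F. has_germ D w f F"
  shows "\<exists>F. has_germ D w f F"
  using assms(1)
proof (induction rule: gen_funs.induct)
  case (const c)
  show ?case by (rule exI, rule has_germ_const)
next
  case (gen f)
  then show ?case by (rule assms(2))
next
  case (add f g)
  then obtain F G where "has_germ D w f F" "has_germ D w g G" by blast
  then show ?case by (intro exI, rule has_germ_add)
next
  case (mult f g)
  then obtain F G where "has_germ D w f F" "has_germ D w g G" by blast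
  then show ?case by (intro exI, rule has_germ_mult)
qed

definition germ :: "complex poly \<Rightarrow> (complex \<Rightarrow> 'x) \<Rightarrow> ('x \<Rightarrow> complex) \<Rightarrow> complex fps" where
  "germ D w f = (THE F. has_germ D w f F)"

lemma germ_eq: "D \<noteq> 0 \<Longrightarrow> has_germ D w f F \<Longrightarrow> germ D w f = F"
  unfolding germ_def by (rule the_equality) (auto intro: has_germ_unique)

definition curve_eval :: "complex poly \<Rightarrow> (complex \<Rightarrow> 'x) \<Rightarrow> (('x \<Rightarrow> complex) \<times> nat) cpoly \<Rightarrow> complex" where
  "curve_eval D w = peval (\<lambda>(f, k). fps_nth (germ D w f) k)"

text \<open>Taking germs along a curve is additive and multiplicative, so it respects the jet
  relations and defines a point of the arc space.\<close>

lemma (in fun_algebra) curve_eval_J: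
  assumes D: "D \<noteq> 0" and ex: "\<And>f. f \<in> A \<Longrightarrow> \<exists>F. has_germ D w f F" and x: "x \<in> J"
  shows "curve_eval D w x = 0"
proof -
  have g: "has_germ D w f (germ D w f)" if "f \<in> A" for f using ex[OF that] germ_eq[OF D] by metis
  obtain m where "x \<in> JI m" using x by (auto simp: J_def)
  then show ?thesis
  proof (induction rule: JI_induct)
    case (rel x)
    then show ?case unfolding jet_rels_alt
    proof (elim UnE CollectE exE conjE)
      fix f h k assume f: "f \<in> A" "h \<in> A" and x: "x = pvar (\<lambda>x. f x + h x, k) - (pvar (f, k) + pvar (h, k))"
      show ?thesis using germ_eq[OF D has_germ_add[OF g[OF f(1)] g[OF f(2)]]] by (simp add: x curve_eval_def)
    next
      fix f h k assume f: "f \<in> A" "h \<in> A"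
        and x: "x = pvar (\<lambda>x. f x * h x, k) - (\<Sum>i\<le>k. pvar (f, i) * pvar (h, k - i))"
      show ?thesis using germ_eq[OF D has_germ_mult[OF g[OF f(1)] g[OF f(2)]]]
        by (simp add: x curve_eval_def fps_mult_nth atMost_atLeast0)
    next
      fix c f k assume f: "f \<in> A" and x: "x = pvar (\<lambda>x. c * f x, k) - pconst c * pvar (f, k)"
      show ?thesis using germ_eq[OF D has_germ_mult[OF has_germ_const g[OF f]]] by (simp add: x curve_eval_def)
    next
      fix k assume x: "x = pvar (\<lambda>_. 1, k) - (if k = 0 then 1 else 0)"
      show ?thesis using germ_eq[OF D has_germ_const[of D w 1]] by (simp add: x curve_eval_def)
    qed
  qed (simp_all add: curve_eval_def)
qed

section \<open>Weight coordinates\<close>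

lemma of_cstar_nonzero [simp]: "of_cstar g \<noteq> 0"
  using of_cstar[of g] by simp

lemma of_cstar_mult: "of_cstar (g * h) = of_cstar g * of_cstar h"
  by transfer simp

lemma of_cstar_one: "of_cstar 1 = 1"
  by transfer simp

lemma of_cstar_Abs [simp]: "z \<noteq> 0 \<Longrightarrow> of_cstar (Abs_cstar z) = z"
  by (rule Abs_cstar_inverse) simp

text \<open>Regular functions on the multiplicative group are Laurent polynomials, and a power of
  the coordinate clears the pole.\<close>

lemma cstar_funs_poly:
  assumes "f \<in> cstar_funs"
  shows "\<exists>N Q. \<forall>g. of_cstar g ^ N * f g = poly Q (of_cstar g)"
  using assms unfolding cstar_funs_def
proof (induction rule: gen_funs.induct)
  case (const c)
  show ?case by (rule exI[of _ 0], rule exI[of _ "[:c:]"]) simp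
next
  case (gen f)
  then consider "f = of_cstar" | "f = (\<lambda>g. inverse (of_cstar g))" by blast
  then show ?case
  proof cases
    case 1
    then show ?thesis by (intro exI[of _ 0] exI[of _ "[:0, 1:]"]) simp
  next
    case 2
    then show ?thesis by (intro exI[of _ 1] exI[of _ "[:1:]"]) simp
  qed
next
  case (add f h)
  then obtain N Q M Q' where "\<And>g. of_cstar g ^ N * f g = poly Q (of_cstar g)"
      "\<And>g. of_cstar g ^ M * h g = poly Q' (of_cstar g)" by blast
  then have "of_cstar g ^ (N + M) * (f g + h g) = poly (monom 1 M * Q + monom 1 N * Q') (of_cstar g)" for g
    by (simp add: poly_monom power_add algebra_simps flip: \<open>\<And>g. of_cstar g ^ N * f g = poly Q (of_cstar g)\<close>
        \<open>\<And>g. of_cstar g ^ M * h g = poly Q' (of_cstar g)\<close>)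
  then show ?case by blast
next
  case (mult f h)
  then obtain N Q M Q' where "\<And>g. of_cstar g ^ N * f g = poly Q (of_cstar g)"
      "\<And>g. of_cstar g ^ M * h g = poly Q' (of_cstar g)" by blast
  then have "of_cstar g ^ (N + M) * (f g * h g) = poly (Q * Q') (of_cstar g)" for g
    by (simp add: power_add algebra_simps flip: \<open>\<And>g. of_cstar g ^ N * f g = poly Q (of_cstar g)\<close>
        \<open>\<And>g. of_cstar g ^ M * h g = poly Q' (of_cstar g)\<close>)
  then show ?case by blast
qed

lemma gen_funs_sum:
  "(\<And>a. a \<in> C \<Longrightarrow> f a \<in> gen_funs S) \<Longrightarrow> (\<lambda>x. \<Sum>a\<in>C. f a x) \<in> gen_funs S"
  by (induction C rule: infinite_finite_induct) (auto intro: gen_funs.intros)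

text \<open>The family \<open>c\<close> is total, with zero functions outside \<open>L\<close>, so
  that linearity and equivariance hold for every index; \<open>vec\<close> realizes arbitrary
  prescribed coordinates in \<open>L\<close>.\<close>

locale weight_coords =
  fixes scale :: "complex \<Rightarrow> 'v::ab_group_add \<Rightarrow> 'v" and act :: "cstar \<Rightarrow> 'v \<Rightarrow> 'v"
    and L :: "(bool \<times> nat) set" and c :: "bool \<times> nat \<Rightarrow> 'v \<Rightarrow> complex" and vec :: "(bool \<times> nat \<Rightarrow> complex) \<Rightarrow> 'v"
  assumes V_eq: "V_funs scale = gen_funs (c ` L)"
    and linear: "linear_functional scale (c l)"
    and outside: "l \<notin> L \<Longrightarrow> c l v = 0"
    and c_vec: "l \<in> L \<Longrightarrow> c l (vec a) = a l"
    and c_False: "c (False, i) (act g v) = of_cstar g * c (False, i) v"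
    and c_True: "c (True, i) (act g v) = inverse (of_cstar g) * c (True, i) v"

context cstar_module
begin

lemma act_add: "act g (v + w) = act g v + act g w"
  and act_scale: "act g (scale c v) = scale c (act g v)"
  using act_linear[of g] by (simp_all add: Vector_Spaces.linear_iff)

lemma act_zero: "act g 0 = 0"
  using act_scale[of g 0 0] by simp

lemma act_sum: "act g (sum f A) = (\<Sum>a\<in>A. act g (f a))"
  by (induction A rule: infinite_finite_induct) (auto simp: act_add act_zero)

lemma linear_functional_iff:
  "linear_functional scale l \<longleftrightarrow> (\<forall>v w. l (v + w) = l v + l w) \<and> (\<forall>c v. l (scale c v) = c * l v)"
proof -
  have "vector_space ((*) :: complex \<Rightarrow> complex \<Rightarrow> complex)" by unfold_locales (simp_all add: algebra_simps)
  then show ?thesis using vector_space_axioms by (simp add: Vector_Spaces.linear_iff)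
qed

definition wt_space :: "int \<Rightarrow> 'v set" where
  "wt_space n = {v. \<forall>g. act g v = scale (of_cstar g powi n) v}"

text \<open>The coefficients of the Laurent polynomial \<open>g \<mapsto> g v\<close> are weight vectors, and they sum to \<open>v\<close>.\<close>

lemma sum_of_weight_vectors:
  assumes weights: "\<And>n. is_weight scale act n \<Longrightarrow> n = 1 \<or> n = - 1"
  shows "v \<in> span (wt_space 1 \<union> wt_space (- 1))"
proof -
  obtain B0 where B0: "finite B0" "span B0 = UNIV" using finite_dim by blast
  obtain B where B: "B \<subseteq> B0" "independent B" "B0 \<subseteq> span B"
    using maximal_independent_subset by blast
  have finB: "finite B" using B(1) B0(1) finite_subset by blast
  have spB: "span B = UNIV" using B(3) B0(2) span_minimal[OF B(3) subspace_span] by auto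
  define l where "l b w = representation B w b" for b w
  have lin: "linear_functional scale (l b)" for b
    unfolding linear_functional_iff l_def using B(2) spB
    by (simp add: representation_add representation_scale)
  have expand: "w = (\<Sum>b\<in>B. scale (l b w) b)" for w
    unfolding l_def using sum_representation_eq[OF B(2) _ finB order_refl, of w] spB by simp
  have "\<forall>b. \<exists>N Q. \<forall>g. of_cstar g ^ N * l b (act g v) = poly Q (of_cstar g)"
    using cstar_funs_poly[OF rational[OF lin]] by blast
  then obtain N Q where NQ: "\<And>b g. of_cstar g ^ N b * l b (act g v) = poly (Q b) (of_cstar g)" by metis
  \<comment> \<open>One power of the coordinate of the group clears the poles of all matrix
    entries.\<close>
  define M where "M = (\<Sum>b\<in>B. N b)"
  define Q' where "Q' b = monom 1 (M - N b) * Q b" for b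
  have Q': "of_cstar g ^ M * l b (act g v) = poly (Q' b) (of_cstar g)" if "b \<in> B" for b g
  proof -
    have "N b \<le> M" unfolding M_def using member_le_sum[of b B N] that finB by simp
    then have "of_cstar g ^ M = of_cstar g ^ (M - N b) * of_cstar g ^ N b" by (simp flip: power_add)
    then show ?thesis by (simp add: Q'_def poly_monom NQ[symmetric] mult.assoc)
  qed
  define K where "K = (\<Sum>b\<in>B. degree (Q' b))"
  have polyK: "poly (Q' b) x = (\<Sum>k\<le>K. coeff (Q' b) k * x ^ k)" if "b \<in> B" for b x
  proof -
    have "degree (Q' b) \<le> K" unfolding K_def using member_le_sum[of b B "\<lambda>b. degree (Q' b)"] that finB by simp
    then show ?thesis unfolding poly_altdef
      by (intro sum.mono_neutral_left) (auto simp: coeff_eq_0)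
  qed
  define u where "u k = (\<Sum>b\<in>B. scale (coeff (Q' b) k) b)" for k
  have main: "scale (of_cstar g ^ M) (act g v) = (\<Sum>k\<le>K. scale (of_cstar g ^ k) (u k))" for g
  proof -
    have "scale (of_cstar g ^ M) (act g v) = (\<Sum>b\<in>B. scale (of_cstar g ^ M * l b (act g v)) b)"
      by (subst expand[of "act g v"]) (simp add: scale_sum_right)
    also have "\<dots> = (\<Sum>b\<in>B. \<Sum>k\<le>K. scale (of_cstar g ^ k * coeff (Q' b) k) b)"
      by (rule sum.cong) (simp_all add: Q' polyK scale_sum_left mult.commute)
    also have "\<dots> = (\<Sum>k\<le>K. scale (of_cstar g ^ k) (u k))"
      unfolding u_def by (subst sum.swap) (simp add: scale_sum_right)
    finally show ?thesis .
  qed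
  \<comment> \<open>Coordinate by coordinate, a polynomial that vanishes at all nonzero numbers is
    zero.\<close>
  have indep: "x k = 0" if x: "\<And>g. (\<Sum>k\<le>K. scale (of_cstar g ^ k) (x k)) = 0" and k: "k \<le> K" for x k
  proof -
    have "l b (x k) = 0" for b
    proof -
      define p where "p = (\<Sum>k\<le>K. monom (l b (x k)) k)"
      have lsum: "l b (sum f A) = (\<Sum>a\<in>A. l b (f a))" for f and A :: "nat set"
      proof (induction A rule: infinite_finite_induct)
        case (insert a A)
        then show ?case using lin[of b] by (simp add: linear_functional_iff)
      qed (use lin[of b] linear_functional_iff[of "l b"] in \<open>auto simp: l_def representation_zero\<close>)
      have "poly p z = 0" if z: "z \<noteq> 0" for z
      proof -
        have "0 = l b (\<Sum>k\<le>K. scale (z ^ k) (x k))" using x[of "Abs_cstar z"] z by (simp add: l_def representation_zero)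
        also have "\<dots> = poly p z"
          unfolding lsum p_def poly_sum poly_monom using lin[of b]
          by (simp add: linear_functional_iff mult.commute)
        finally show ?thesis by simp
      qed
      then have "p = 0" using poly_eq_off_zeros[of "[:0, 1:]" p 0] by simp
      then have "coeff p k = 0" by simp
      then show ?thesis using k by (simp add: p_def coeff_sum coeff_monom if_distrib cong: if_cong)
    qed
    then show ?thesis using expand[of "x k"] by simp
  qed
  \<comment> \<open>The expansion of \<open>act (h * g) v\<close> in powers of
    \<open>of_cstar g\<close> is compared with \<open>act h\<close> applied to the expansion of
    \<open>act g v\<close>.\<close>
  have wt: "scale (of_cstar h ^ M) (act h (u k)) = scale (of_cstar h ^ k) (u k)" if k: "k \<le> K" for h k
  proof -
    have "(\<Sum>k\<le>K. scale (of_cstar g ^ k) (scale (of_cstar h ^ M) (act h (u k)) - scale (of_cstar h ^ k) (u k))) = 0" for g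
    proof -
      have "scale (of_cstar (h * g) ^ M) (act (h * g) v) =
          scale (of_cstar h ^ M) (act h (scale (of_cstar g ^ M) (act g v)))"
        by (simp add: of_cstar_mult power_mult_distrib act_scale act_mult)
      also have "\<dots> = (\<Sum>k\<le>K. scale (of_cstar g ^ k) (scale (of_cstar h ^ M) (act h (u k))))"
        unfolding main by (simp add: act_sum act_scale scale_sum_right mult.commute)
      finally have "(\<Sum>k\<le>K. scale (of_cstar g ^ k) (scale (of_cstar h ^ M) (act h (u k)))) =
          (\<Sum>k\<le>K. scale (of_cstar (h * g) ^ k) (u k))" unfolding main by simp
      then show ?thesis
        by (simp add: scale_right_diff_distrib sum_subtractf of_cstar_mult power_mult_distrib mult.commute)
    qed
    from indep[OF this k] show ?thesis by simp
  qed
  have mem: "u k \<in> span (wt_space 1 \<union> wt_space (- 1))" if k: "k \<le> K" for k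
  proof (cases "u k = 0")
    case False
    have act_u: "act g (u k) = scale (of_cstar g powi (int k - int M)) (u k)" for g
    proof -
      have "act g (u k) = scale (inverse (of_cstar g ^ M)) (scale (of_cstar g ^ M) (act g (u k)))"
        by simp
      also have "\<dots> = scale (inverse (of_cstar g ^ M) * of_cstar g ^ k) (u k)"
        unfolding wt[OF k] by simp
      also have "inverse (of_cstar g ^ M) * of_cstar g ^ k = of_cstar g powi (int k - int M)"
        by (simp add: power_int_diff field_simps)
      finally show ?thesis .
    qed
    then have "is_weight scale act (int k - int M)" using False by (auto simp: is_weight_def)
    then have "int k - int M = 1 \<or> int k - int M = - 1" by (rule weights)
    then have "u k \<in> wt_space 1 \<union> wt_space (- 1)" using act_u by (auto simp: wt_space_def)
    then show ?thesis by (rule span_base)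
  qed (simp add: span_zero)
  have "(\<Sum>k\<le>K. u k) \<in> span (wt_space 1 \<union> wt_space (- 1))"
    by (rule span_sum) (use mem in simp)
  moreover have "(\<Sum>k\<le>K. u k) = v" using main[of 1] by (simp add: of_cstar_one act_one)
  ultimately show ?thesis by (simp only:)
qed

text \<open>The group element 2 would act on such a vector both as 2 and as 1/2.\<close>

lemma wt_space_disjoint:
  assumes "v \<in> wt_space 1" "v \<in> wt_space (- 1)"
  shows "v = 0"
proof -
  let ?g = "Abs_cstar 2"
  have "scale (of_cstar ?g powi 1) v = scale (of_cstar ?g powi (- 1)) v"
    using assms unfolding wt_space_def by (metis (mono_tags, lifting) mem_Collect_eq)
  then have "scale 2 v - scale (1 / 2) v = 0" by (simp add: power_int_minus)
  then have "scale (3 / 2) v = 0" by (simp flip: scale_left_diff_distrib)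
  then show ?thesis by simp
qed

text \<open>The weight vectors span, so a basis can be chosen among them; the coordinates are the
  dual basis, each flagged by the weight of its basis vector.\<close>

theorem weight_coordinates:
  assumes weights: "\<And>n. is_weight scale act n \<Longrightarrow> n = 1 \<or> n = - 1"
  shows "\<exists>L c vec. weight_coords scale act L c vec"
proof -
  let ?W = "wt_space 1 \<union> wt_space (- 1)"
  obtain B0 where B0: "finite B0" "span B0 = UNIV" using finite_dim by blast
  obtain B where B: "B \<subseteq> ?W" "independent B" "?W \<subseteq> span B"
    using maximal_independent_subset by blast
  have spB: "span B = UNIV"
    using span_minimal[OF B(3) subspace_span] sum_of_weight_vectors[OF weights] by blast
  have finB: "finite B" using independent_span_bound[OF B0(1) B(2)] B0(2) by simp
  define n where "n = card B"
  obtain b where b: "bij_betw b {..<n} B"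
    using ex_bij_betw_nat_finite[OF finB] unfolding n_def atLeast0LessThan by blast
  have bB: "b i \<in> B" if "i < n" for i using b that by (auto simp: bij_betw_def)
  have binj: "b i = b j \<longleftrightarrow> i = j" if "i < n" "j < n" for i j
    using b that by (auto simp: bij_betw_def inj_on_def)
  define w where "w k = (if k then - 1 else 1 :: int)" for k
  define L where "L = {(k, i). i < n \<and> b i \<in> wt_space (w k)}"
  define c where "c l v = (if l \<in> L then representation B v (b (snd l)) else 0)" for l v
  \<comment> \<open>The flag \<open>b i \<in> wt_space (- 1)\<close> is the only one with which the
    index \<open>i\<close> occurs in \<open>L\<close>.\<close>
  define vec where "vec a = (\<Sum>i<n. scale (a (b i \<in> wt_space (- 1), i)) (b i))" for a
  have sum_b: "(\<Sum>i<n. f (b i)) = (\<Sum>x\<in>B. f x)" for f :: "'v \<Rightarrow> 'v"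
    by (rule sum.reindex_bij_betw[OF b])
  have rep_b: "representation B (b i) (b j) = (if i = j then 1 else 0)" if "i < n" "j < n" for i j
    using representation_basis[OF B(2) bB[OF that(1)]] binj[OF that] by auto
  have rep_sum: "representation B (\<Sum>i<n. scale (f i) (b i)) (b j) = f j" if "j < n" for f j
  proof -
    have "representation B (\<Sum>i<n. scale (f i) (b i)) (b j) = (\<Sum>i<n. f i * representation B (b i) (b j))"
      using B(2) spB by (simp add: representation_sum representation_scale)
    also have "\<dots> = (\<Sum>i<n. if i = j then f j else 0)"
      by (rule sum.cong) (use rep_b that in auto)
    finally show ?thesis using that by simp
  qed
  have expand: "v = (\<Sum>i<n. scale (representation B v (b i)) (b i))" for v
    using sum_representation_eq[OF B(2) _ finB order_refl, of v] spB
      sum_b[of "\<lambda>x. scale (representation B v x) x"] by simp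
  have wts: "\<exists>k. (k, i) \<in> L" if "i < n" for i
  proof -
    have "b i \<in> wt_space (w False) \<or> b i \<in> wt_space (w True)" using bB[OF that] B(1) by (auto simp: w_def)
    then show ?thesis using that by (auto simp: L_def)
  qed
  have uniq: "k = (b i \<in> wt_space (- 1))" if "(k, i) \<in> L" for k i
  proof -
    have i: "i < n" "b i \<in> wt_space (w k)" using that by (auto simp: L_def)
    have "b i \<noteq> 0"
    proof
      assume "b i = 0"
      then have "0 \<in> B" using bB[OF i(1)] by (simp only:)
      then have "dependent B" by (rule dependent_zero)
      with B(2) show False by (rule notE)
    qed
    then show ?thesis using i wt_space_disjoint[of "b i"] by (cases k) (auto simp: w_def)
  qed
  have lin: "linear_functional scale (c l)" for l
    unfolding linear_functional_iff c_def using B(2) spB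
    by (simp add: representation_add representation_scale)
  have act_b: "act g (b i) = scale (of_cstar g powi w k) (b i)" if "(k, i) \<in> L" for g k i
    using that by (auto simp: L_def wt_space_def)
  have rep_act: "representation B (act g v) (b i) = of_cstar g powi w k * representation B v (b i)"
    if ki: "(k, i) \<in> L" for g v k i
  proof -
    have "act g v = (\<Sum>j<n. scale (representation B v (b j) * of_cstar g powi w (b j \<in> wt_space (- 1))) (b j))"
    proof -
      have "act g v = (\<Sum>j<n. scale (representation B v (b j)) (act g (b j)))"
        by (subst expand[of v]) (simp add: act_sum act_scale)
      also have "\<dots> = (\<Sum>j<n. scale (representation B v (b j) * of_cstar g powi w (b j \<in> wt_space (- 1))) (b j))"
      proof (rule sum.cong[OF refl])
        fix j assume "j \<in> {..<n}"
        then obtain k' where k': "(k', j) \<in> L" using wts by auto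
        then show "scale (representation B v (b j)) (act g (b j)) =
            scale (representation B v (b j) * of_cstar g powi w (b j \<in> wt_space (- 1))) (b j)"
          using act_b[OF k'] uniq[OF k'] by simp
      qed
      finally show ?thesis .
    qed
    moreover have "i < n" using ki by (simp add: L_def)
    ultimately show ?thesis using uniq[OF ki] by (simp add: rep_sum mult.commute)
  qed
  show ?thesis
  proof (intro exI[of _ L] exI[of _ c] exI[of _ vec] weight_coords.intro)
    show "V_funs scale = gen_funs (c ` L)"
    proof (intro equalityI subsetI)
      fix f assume "f \<in> V_funs scale"
      then show "f \<in> gen_funs (c ` L)"
        unfolding V_funs_def
      proof (induction rule: gen_funs.induct)
        case (gen f)
        then have f: "linear_functional scale f" by simp
        have f0: "f 0 = 0"
        proof -
          have "f (scale 0 0) = 0 * f 0" using f unfolding linear_functional_iff by blast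
          then show ?thesis by simp
        qed
        have fsum: "f (sum h A) = (\<Sum>a\<in>A. f (h a))" for h and A :: "nat set"
        proof (induction A rule: infinite_finite_induct)
          case (insert a A)
          then show ?case using f by (simp add: linear_functional_iff)
        qed (use f0 in auto)
        have "f v = (\<Sum>i<n. f (b i) * c (b i \<in> wt_space (- 1), i) v)" for v
        proof -
          have "f v = (\<Sum>i<n. representation B v (b i) * f (b i))"
            by (subst expand[of v]) (use f in \<open>simp add: fsum linear_functional_iff\<close>)
          also have "\<dots> = (\<Sum>i<n. f (b i) * c (b i \<in> wt_space (- 1), i) v)"
          proof (rule sum.cong[OF refl])
            fix i assume "i \<in> {..<n}"
            then obtain k where "(k, i) \<in> L" using wts by auto
            then show "representation B v (b i) * f (b i) = f (b i) * c (b i \<in> wt_space (- 1), i) v"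
              using uniq by (auto simp: c_def)
          qed
          finally show ?thesis .
        qed
        then have f_eq: "(\<lambda>v. \<Sum>i<n. f (b i) * c (b i \<in> wt_space (- 1), i) v) = f" by (intro ext) (rule sym)
        have "(\<lambda>v. f (b i) * c (b i \<in> wt_space (- 1), i) v) \<in> gen_funs (c ` L)" if lt: "i < n" for i
        proof -
          obtain k where "(k, i) \<in> L" using wts[OF lt] by blast
          then have "(b i \<in> wt_space (- 1), i) \<in> L" using uniq by auto
          then show ?thesis by (intro gen_funs.mult gen_funs.const gen_funs.gen) auto
        qed
        then have "(\<lambda>v. \<Sum>i<n. f (b i) * c (b i \<in> wt_space (- 1), i) v) \<in> gen_funs (c ` L)"
          by (intro gen_funs_sum) simp
        then show ?case unfolding f_eq .
      qed (auto intro: gen_funs.intros)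
    next
      fix f assume "f \<in> gen_funs (c ` L)"
      then show "f \<in> V_funs scale"
        unfolding V_funs_def by (induction rule: gen_funs.induct) (use lin in \<open>auto intro: gen_funs.intros\<close>)
    qed
    show "linear_functional scale (c l)" for l by (rule lin)
    show "c l v = 0" if "l \<notin> L" for l v using that by (simp add: c_def)
    show "c l (vec a) = a l" if l: "l \<in> L" for a l
    proof -
      obtain k i where ki: "l = (k, i)" by (cases l)
      then have "i < n" using l by (simp add: L_def)
      then show ?thesis using l uniq[of k i] by (simp add: ki c_def vec_def rep_sum)
    qed
    show "c (False, i) (act g v) = of_cstar g * c (False, i) v" for i g v
      using rep_act[of False i g v] by (simp add: c_def w_def)
    show "c (True, i) (act g v) = inverse (of_cstar g) * c (True, i) v" for i g v
      using rep_act[of True i g v] by (simp add: c_def w_def power_int_minus)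
  qed
qed

end

text \<open>\<open>g\<close> is invertible as a power series, so every point \<open>a'\<close> is
  obtained by scaling some point \<open>a\<close> with \<open>g\<close>.\<close>

lemma arc_scale_eq_0D:
  assumes g: "coeff g 0 \<noteq> 0" and 0: "arc_scale b g q = 0"
  shows "q = 0"
proof (rule peval_eq_0D)
  fix a' :: "(bool \<times> nat) \<times> nat \<Rightarrow> complex"
  define A where "A i = Abs_fps (\<lambda>k. a' ((b, i), k)) * inverse (fps_of_poly g)" for i
  define a where "a = (\<lambda>((b', i), k). if b' = b then fps_nth (A i) k else a' ((b', i), k))"
  have "(\<Sum>u\<le>k. coeff g u * a ((b, i), k - u)) = a' ((b, i), k)" for i k
  proof -
    have "(\<Sum>u\<le>k. coeff g u * a ((b, i), k - u)) = fps_nth (fps_of_poly g * A i) k"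
      by (simp add: a_def fps_mult_nth atMost_atLeast0)
    also have "fps_of_poly g * A i = Abs_fps (\<lambda>k. a' ((b, i), k)) * (inverse (fps_of_poly g) * fps_of_poly g)"
      by (simp add: A_def mult_ac)
    also have "inverse (fps_of_poly g) * fps_of_poly g = 1"
      using g by (intro inverse_mult_eq_1) simp
    finally show ?thesis by simp
  qed
  then have "peval a (arc_scale b g q) = peval a' q"
    unfolding arc_scale_def peval_psubst by (intro psub_cong) (auto simp: a_def)
  then show "peval a' q = 0" using 0 by simp
qed

lemma arc_scale_mult: "arc_scale b g (p * q) = arc_scale b g p * arc_scale b g q"
  by (simp add: arc_scale_def)

lemma arc_invariantD: "arc_invariant q \<Longrightarrow> coeff g 0 \<noteq> 0 \<Longrightarrow> arc_scale False g q = arc_scale True g q"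
  by (simp add: arc_invariant_def)

context weight_coords
begin

abbreviation "OV \<equiv> V_funs scale"
abbreviation "OZ \<equiv> invariant_funs scale act"
abbreviation "OGV \<equiv> GV_funs scale"

sublocale V: fun_algebra OV
  unfolding V_funs_def by (rule fun_algebra_gen_funs)

sublocale GV: fun_algebra OGV
  unfolding GV_funs_def by (rule fun_algebra_gen_funs)

sublocale Z: fun_algebra OZ
  by unfold_locales (auto simp: invariant_funs_def intro: V.const V.add V.mult)

lemma linear_OV: "linear_functional scale l \<Longrightarrow> l \<in> OV"
  unfolding V_funs_def by (rule gen_funs.gen) simp

lemma c_OV: "c l \<in> OV"
  by (rule linear_OV[OF linear])

lemma OV_induct [consumes 1, case_names const coord add mult]:
  assumes "f \<in> OV" "\<And>a. Q (\<lambda>_. a)" "\<And>l. l \<in> L \<Longrightarrow> Q (c l)"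
    "\<And>f g. f \<in> OV \<Longrightarrow> g \<in> OV \<Longrightarrow> Q f \<Longrightarrow> Q g \<Longrightarrow> Q (\<lambda>x. f x + g x)"
    "\<And>f g. f \<in> OV \<Longrightarrow> g \<in> OV \<Longrightarrow> Q f \<Longrightarrow> Q g \<Longrightarrow> Q (\<lambda>x. f x * g x)"
  shows "Q f"
  using assms(1) unfolding V_eq
  by (induction rule: gen_funs.induct) (use assms(2-) in \<open>auto simp: V_eq\<close>)

lemma pullback_OGV: "action_pullback act f \<in> OGV \<and> proj_pullback f \<in> OGV" if "f \<in> OV"
  using that
proof (induction rule: OV_induct)
  case (const a)
  then show ?case using GV.const[of a] by (simp add: action_pullback_def proj_pullback_def)
next
  case (coord l)
  have 1: "proj_pullback (c l) \<in> OGV" for l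
    unfolding GV_funs_def proj_pullback_def
    by (rule gen_funs.gen, rule UnI2, intro CollectI exI[of _ "c l"] conjI refl linear)
  have 2: "(\<lambda>(g, v). of_cstar g) \<in> OGV" "(\<lambda>(g, v). inverse (of_cstar g)) \<in> OGV"
    unfolding GV_funs_def by (intro gen_funs.gen; simp)+
  obtain b i where l: "l = (b, i)" by (cases l)
  have "action_pullback act (c l) = (\<lambda>x. (case x of (g, v) \<Rightarrow> if b then inverse (of_cstar g) else of_cstar g) *
      proj_pullback (c l) x)"
    by (auto simp: action_pullback_def proj_pullback_def l c_False c_True fun_eq_iff)
  then show ?case using GV.mult[OF 2(1) 1] GV.mult[OF 2(2) 1] 1 by (cases b) auto
next
  case (add f g)
  then show ?case
    using GV.add[of "action_pullback act f" "action_pullback act g"] GV.add[of "proj_pullback f" "proj_pullback g"]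
    by (simp add: action_pullback_def proj_pullback_def case_prod_unfold)
next
  case (mult f g)
  then show ?case
    using GV.mult[of "action_pullback act f" "action_pullback act g"] GV.mult[of "proj_pullback f" "proj_pullback g"]
    by (simp add: action_pullback_def proj_pullback_def case_prod_unfold)
qed

sublocale incl: fun_algebra_hom OZ OV "\<lambda>f. f"
  by unfold_locales (auto simp: invariant_funs_def)

sublocale action: fun_algebra_hom OV OGV "action_pullback act"
  by unfold_locales (use pullback_OGV in \<open>auto simp: action_pullback_def fun_eq_iff\<close>)

sublocale proj: fun_algebra_hom OV OGV proj_pullback
  by unfold_locales (use pullback_OGV in \<open>auto simp: proj_pullback_def fun_eq_iff\<close>)

subsection \<open>Generators of the invariant functions\<close>

definition zc :: "nat \<times> nat \<Rightarrow> 'v \<Rightarrow> complex" where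
  "zc = (\<lambda>(i, j) v. c (False, i) v * c (True, j) v)"

definition Lz :: "(nat \<times> nat) set" where
  "Lz = {(i, j). (False, i) \<in> L \<and> (True, j) \<in> L}"

lemma zc_OZ: "zc ij \<in> OZ"
proof -
  obtain i j where ij: "ij = (i, j)" by (cases ij)
  show ?thesis
    unfolding invariant_funs_def ij zc_def
    using V.mult[OF c_OV c_OV, of "(False, i)" "(True, j)"] by (simp add: c_False c_True)
qed

text \<open>The group element 2 alone detects balance: it multiplies x by 2 and y by 1/2. If only
  one kind of variable occurred, the value would be a nontrivial power of 2 or 1/2; otherwise a
  product x_i y_j splits off.\<close>

lemma balanced_monomial:
  assumes "pkeys m \<subseteq> L" "mval (\<lambda>l. if fst l then 1 / 2 else 2 :: complex) m = 1"
  shows "(\<lambda>v. mval (\<lambda>l. c l v) m) \<in> gen_funs (zc ` Lz)"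
  using assms
proof (induction "\<Sum>l\<in>pkeys m. plookup m l" arbitrary: m rule: less_induct)
  case less
  let ?s = "\<lambda>l. if fst l then 1 / 2 else 2 :: complex"
  show ?case
  proof (cases "m = 0")
    case True
    then show ?thesis by (simp add: gen_funs.const)
  next
    case False
    then have "pkeys m \<noteq> {}" by simp
    have "\<exists>i. (b, i) \<in> pkeys m" for b
    proof (rule ccontr)
      assume none: "\<nexists>i. (b, i) \<in> pkeys m"
      have fst: "fst l = (\<not> b)" if "l \<in> pkeys m" for l
      proof (rule ccontr)
        assume "fst l \<noteq> (\<not> b)"
        then have "l = (b, snd l)" by (intro prod_eqI) auto
        then show False using none that by metis
      qed
      define n where "n = (\<Sum>l\<in>pkeys m. plookup m l)"
      have "mval ?s m = mval (\<lambda>_. if b then 2 else 1 / 2) m"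
        by (rule mval_cong) (use fst in auto)
      also have "\<dots> = (if b then 2 else 1 / 2) ^ n"
        by (simp add: mval_def power_sum n_def)
      finally have "norm ((if b then 2 else 1 / 2 :: complex) ^ n) = 1"
        using less.prems(2) by simp
      then have "(2::real) ^ n = 1" by (cases b) (simp_all add: norm_power norm_divide power_divide)
      moreover obtain l where "l \<in> pkeys m" using \<open>pkeys m \<noteq> {}\<close> by blast
      then have "plookup m l \<le> n" "plookup m l \<noteq> 0"
        unfolding n_def by (auto simp: in_keys_iff intro!: member_le_sum)
      ultimately show False using one_less_power[of "2::real" n] by simp
    qed
    then obtain i j where ij: "(False, i) \<in> pkeys m" "(True, j) \<in> pkeys m" by blast
    define e where "e = psingle (False, i) 1 + psingle (True, j) (1::nat)"
    have e: "plookup e l = (if l = (False, i) \<or> l = (True, j) then 1 else 0)" for l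
      by (auto simp: e_def lookup_add lookup_single when_def)
    define m' where "m' = m - e"
    have m: "m = e + m'"
    proof (rule poly_mapping_eqI)
      fix l show "plookup m l = plookup (e + m') l"
        using ij by (auto simp: m'_def lookup_add lookup_minus e in_keys_iff)
    qed
    have sub: "pkeys m' \<subseteq> pkeys m" unfolding m'_def by (auto simp: in_keys_iff lookup_minus)
    have "(\<Sum>l\<in>pkeys m'. plookup m' l) = (\<Sum>l\<in>pkeys m. plookup m' l)"
      by (rule sum.mono_neutral_left) (use sub in \<open>auto simp: in_keys_iff\<close>)
    also have "\<dots> < (\<Sum>l\<in>pkeys m. plookup m l)"
    proof (rule sum_strict_mono_ex1)
      show "\<exists>l\<in>pkeys m. plookup m' l < plookup m l"
        using ij(1) by (intro bexI[of _ "(False, i)"]) (auto simp: m'_def lookup_minus e in_keys_iff)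
    qed (auto simp: m'_def lookup_minus)
    finally have "(\<lambda>v. mval (\<lambda>l. c l v) m') \<in> gen_funs (zc ` Lz)"
    proof (rule less.hyps)
      show "pkeys m' \<subseteq> L" using sub less.prems(1) by blast
      show "mval ?s m' = 1" using less.prems(2) unfolding m by (simp add: mval_add e_def)
    qed
    moreover have "zc (i, j) \<in> gen_funs (zc ` Lz)"
      using ij less.prems(1) by (intro gen_funs.gen) (auto simp: Lz_def)
    ultimately have "(\<lambda>v. zc (i, j) v * mval (\<lambda>l. c l v) m') \<in> gen_funs (zc ` Lz)"
      by (intro gen_funs.mult)
    then show ?thesis unfolding m by (simp add: mval_add e_def zc_def)
  qed
qed

text \<open>An invariant function is a polynomial \<open>q\<close> in the coordinates. Every point
  is a coordinate vector, so \<open>q\<close> equals its rescaling by the group element 2, which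
  forces each monomial to be balanced.\<close>

lemma OZ_eq: "OZ = gen_funs (zc ` Lz)"
proof (intro equalityI subsetI)
  fix f assume f: "f \<in> OZ"
  then have "f \<in> OV" by (simp add: invariant_funs_def)
  then have "\<exists>q. pvars q \<subseteq> L \<and> (\<forall>v. f v = peval (\<lambda>l. c l v) q)"
  proof (induction rule: OV_induct)
    case (const a)
    show ?case by (rule exI[of _ "pconst a"]) simp
  next
    case (coord l)
    then show ?case by (intro exI[of _ "pvar l"]) simp
  next
    case (add f g)
    then obtain p q where "pvars p \<subseteq> L" "pvars q \<subseteq> L"
      "\<And>v. f v = peval (\<lambda>l. c l v) p" "\<And>v. g v = peval (\<lambda>l. c l v) q" by blast
    then show ?case by (intro exI[of _ "p + q"]) (simp add: pvars_add_subset)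
  next
    case (mult f g)
    then obtain p q where "pvars p \<subseteq> L" "pvars q \<subseteq> L"
      "\<And>v. f v = peval (\<lambda>l. c l v) p" "\<And>v. g v = peval (\<lambda>l. c l v) q" by blast
    then show ?case by (intro exI[of _ "p * q"]) (simp add: pvars_mult_subset)
  qed
  then obtain q where q: "pvars q \<subseteq> L" "\<And>v. f v = peval (\<lambda>l. c l v) q" by blast
  let ?s = "\<lambda>l. if fst l then 1 / 2 else 2 :: complex"
  have "peval a (psubst (\<lambda>l. pconst (?s l) * pvar l) q) = peval a q" for a
  proof -
    let ?g = "Abs_cstar 2"
    have "c l (act ?g (vec a)) = ?s l * a l" if "l \<in> L" for l
      using that by (cases l) (auto simp: c_False c_True c_vec)
    then have "peval (\<lambda>l. c l (act ?g (vec a))) q = peval (\<lambda>l. ?s l * a l) q"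
      using q(1) by (intro psub_cong) blast
    moreover have "peval (\<lambda>l. c l (vec a)) q = peval a q"
      using q(1) c_vec by (intro psub_cong) blast
    moreover have "f (act ?g (vec a)) = f (vec a)" using f by (simp add: invariant_funs_def)
    ultimately show ?thesis by (simp add: q(2) peval_psubst)
  qed
  then have "psubst (\<lambda>l. pconst (?s l) * pvar l) q = q" by (rule peval_eqI)
  then have "plookup q m * mval ?s m = plookup q m" for m
    using lookup_psubst_scale[of ?s q m] by simp
  then have bal: "mval ?s m = 1" if "m \<in> pkeys q" for m using that by (auto simp: in_keys_iff)
  have "(\<lambda>v. \<Sum>m\<in>pkeys q. plookup q m * mval (\<lambda>l. c l v) m) \<in> gen_funs (zc ` Lz)"
  proof (intro gen_funs_sum gen_funs.mult gen_funs.const balanced_monomial)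
    fix m assume m: "m \<in> pkeys q"
    show "pkeys m \<subseteq> L" using m q(1) by (auto simp: pvars_def)
    show "mval ?s m = 1" using m by (rule bal)
  qed
  moreover have "(\<lambda>v. \<Sum>m\<in>pkeys q. plookup q m * mval (\<lambda>l. c l v) m) = f"
    by (intro ext) (simp add: q(2) psub_def)
  ultimately show "f \<in> gen_funs (zc ` Lz)" by simp
next
  fix f assume "f \<in> gen_funs (zc ` Lz)"
  then show "f \<in> OZ"
    by (induction rule: gen_funs.induct) (use zc_OZ Z.const Z.add Z.mult in auto)
qed

subsection \<open>Coordinates on the arc space\<close>

text \<open>Coordinates outside \<open>L\<close> are zero functions, so \<open>iota\<close> can be
  injective modulo \<open>V.J\<close> only on polynomials with indices in \<open>L\<close>.\<close>

definition valid :: "xy_poly \<Rightarrow> bool" where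
  "valid q \<longleftrightarrow> pvars q \<subseteq> L \<times> UNIV"

definition iota :: "xy_poly \<Rightarrow> (('v \<Rightarrow> complex) \<times> nat) cpoly" where
  "iota = psubst (\<lambda>(l, k). pvar (c l, k))"

definition kappa :: "z_poly \<Rightarrow> (('v \<Rightarrow> complex) \<times> nat) cpoly" where
  "kappa = psubst (\<lambda>(ij, k). pvar (zc ij, k))"

lemma iota_add: "iota (p + q) = iota p + iota q" and iota_mult: "iota (p * q) = iota p * iota q"
  by (simp_all add: iota_def)

lemma iota_P: "iota q \<in> V.P"
  unfolding iota_def by (induction q rule: cpoly_induct') (auto simp: V.P_closed c_OV)

lemma kappa_P: "kappa r \<in> Z.P"
  unfolding kappa_def by (induction r rule: cpoly_induct') (auto simp: Z.P_closed zc_OZ)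

lemma Z_P_subset: "Z.P \<subseteq> V.P"
  unfolding V.P_def Z.P_def
  by (intro Collect_mono impI, erule order_trans, intro Sigma_mono) (auto simp: invariant_funs_def)

lemma Z_J_subset: "Z.J \<subseteq> V.J"
proof
  fix x assume "x \<in> Z.J"
  then have "incl.pr x \<in> V.J" by (rule incl.pr_J)
  then show "x \<in> V.J" by (simp add: incl.pr_def case_prod_unfold)
qed

text \<open>As a function on V, \<open>zc (i, j)\<close> is a product of two coordinates, and the
  product relation expands its coefficients just as \<open>phi\<close> does.\<close>

lemma kappa_iota: "kappa r - iota (phi r) \<in> V.J"
proof -
  let ?h = "\<lambda>((i, j), k). \<Sum>u\<le>k. pvar (c (False, i), u) * pvar (c (True, j), k - u)"
  have "iota (phi r) = psubst ?h r"
    unfolding iota_def phi_def psubst_psubst by (rule psub_cong) auto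
  moreover have "kappa r - psubst ?h r \<in> V.J \<and> kappa r \<in> V.P \<and> psubst ?h r \<in> V.P"
    unfolding kappa_def
  proof (rule V.J_psubst)
    fix v :: "(nat \<times> nat) \<times> nat"
    obtain i j k where v: "v = ((i, j), k)" by (metis prod.collapse)
    have "zc (i, j) \<in> OV" using zc_OZ by (simp add: invariant_funs_def)
    then show "(case v of (ij, k) \<Rightarrow> pvar (zc ij, k)) - ?h v \<in> V.J \<and>
        (case v of (ij, k) \<Rightarrow> pvar (zc ij, k)) \<in> V.P \<and> ?h v \<in> V.P"
      using V.J_rels(2)[OF c_OV c_OV, of "(False, i)" "(True, j)" k]
      by (auto simp: v zc_def intro!: V.P_closed V.P_sum c_OV)
  qed
  ultimately show ?thesis by simp
qed

text \<open>The two products of entries in the minor are the same function, hence the same symbol of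
  the jet ring; its two expansions by the product relation differ by the minor.\<close>

lemma kappa_minor: "kappa (minor i j i' j' k) \<in> Z.J"
proof -
  have "pvar (\<lambda>v. zc (i, j) v * zc (i', j') v, k) - kappa (\<Sum>u\<le>k. pvar ((i, j), u) * pvar ((i', j'), k - u)) \<in> Z.J"
    for i j i' j'
    using Z.J_rels(2)[OF zc_OZ zc_OZ] by (simp add: kappa_def)
  from Z.J_trans[OF Z.J_minus_commute[OF this[of i j i' j']]] this[of i j' i' j]
  have "(\<lambda>v. zc (i, j) v * zc (i', j') v) = (\<lambda>v. zc (i, j') v * zc (i', j) v) \<Longrightarrow>
    kappa (\<Sum>u\<le>k. pvar ((i, j), u) * pvar ((i', j'), k - u)) -
    kappa (\<Sum>u\<le>k. pvar ((i, j'), u) * pvar ((i', j), k - u)) \<in> Z.J" by simp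
  then show ?thesis by (simp add: minor_def kappa_def zc_def fun_eq_iff)
qed

lemma kappa_span:
  assumes "r \<in> cpoly.span minor_multiples"
  shows "kappa r \<in> Z.J"
  using assms
proof (induction rule: cpoly.span_induct_alt)
  case base
  then show ?case by (simp add: kappa_def Z.J_zero)
next
  case (step a x y)
  then obtain m i j i' j' k where x: "x = psingle m 1 * minor i j i' j' k" by (auto simp: minor_multiples_def)
  have "kappa (pconst a * psingle m 1) * kappa (minor i j i' j' k) \<in> Z.J"
    by (rule Z.J_mult[OF kappa_minor kappa_P])
  then show ?case using Z.J_add step(2) by (simp add: x kappa_def mult.assoc)
qed

definition curve :: "(bool \<times> nat \<Rightarrow> complex poly) \<Rightarrow> complex \<Rightarrow> 'v" where
  "curve Q \<tau> = vec (\<lambda>l. poly (Q l) \<tau>)"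

lemma has_germ_coord:
  assumes "l \<in> L"
  shows "has_germ D (curve Q) (c l) (fps_of_poly (Q l))"
  by (rule has_germ_poly) (simp add: curve_def c_vec assms)

lemma ex_germ: "f \<in> OV \<Longrightarrow> \<exists>F. has_germ D (curve Q) f F"
  unfolding V_eq by (erule has_germ_gen_funs) (use has_germ_coord in blast)

definition trunc :: "((bool \<times> nat) \<times> nat \<Rightarrow> complex) \<Rightarrow> nat \<Rightarrow> bool \<times> nat \<Rightarrow> complex poly" where
  "trunc a N l = (\<Sum>k\<le>N. monom (a (l, k)) k)"

lemma coeff_trunc: "k \<le> N \<Longrightarrow> coeff (trunc a N l) k = a (l, k)"
  by (simp add: trunc_def coeff_sum coeff_monom if_distrib cong: if_cong)

lemma coeff_mult_trunc:
  "k \<le> N \<Longrightarrow> coeff (g * trunc a N l) k = (\<Sum>u\<le>k. coeff g u * a (l, k - u))"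
  by (simp add: coeff_mult coeff_trunc)

lemma pvars_bound: "\<exists>N. \<forall>v\<in>pvars (q :: xy_poly). snd v \<le> N"
  by (rule exI[of _ "Max (snd ` pvars q)"]) simp

text \<open>Up to the orders occurring in \<open>q\<close>, each point \<open>a\<close> is realized
  by the polynomial curve with coefficients \<open>a\<close>, and elements of \<open>V.J\<close>
  vanish along it. Thus the arc coordinates are algebraically independent.\<close>

lemma iota_J_eq_0:
  assumes "valid q" "iota q \<in> V.J"
  shows "q = 0"
proof (rule peval_eq_0D)
  fix a
  obtain N where N: "\<And>v. v \<in> pvars q \<Longrightarrow> snd v \<le> N" using pvars_bound by blast
  let ?w = "curve (trunc a N)"
  have "0 = curve_eval 1 ?w (iota q)"
    by (rule V.curve_eval_J[symmetric]) (use ex_germ assms in auto)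
  also have "\<dots> = peval a q"
    unfolding curve_eval_def iota_def peval_psubst
  proof (rule psub_cong)
    fix v assume v: "v \<in> pvars q"
    then have "fst v \<in> L" using assms(1) by (auto simp: valid_def)
    then show "peval (\<lambda>(f, k). fps_nth (germ 1 ?w f) k) (case v of (l, k) \<Rightarrow> pvar (c l, k)) = a v"
      using germ_eq[OF _ has_germ_coord, of 1 "fst v" "trunc a N"] N[OF v]
      by (cases v) (simp add: coeff_trunc)
  qed
  finally show "peval a q = 0" by simp
qed

text \<open>Evaluate along arcs \<open>(g, v)\<close> of \<open>G \<times> V\<close> in which the coordinates of weight \<open>-1\<close> of \<open>v\<close> are divisible
  by \<open>g\<close>, so that \<open>g v\<close> is polynomial again.\<close>

lemma arc_invariant_iota:
  assumes q: "valid q" and inv: "V.acl (iota q) \<in> carrier (arc_invariants scale act)"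
  shows "arc_invariant q"
  unfolding arc_invariant_def
proof (intro allI impI peval_eqI)
  fix g :: "complex poly" and a
  assume g0: "coeff g 0 \<noteq> 0"
  then have g: "g \<noteq> 0" by auto
  obtain N where N: "\<And>v. v \<in> pvars q \<Longrightarrow> snd v \<le> N" using pvars_bound by blast
  \<comment> \<open>For \<open>b = True\<close> the curve is (x, g y), as seen by the projection;
    acting by \<open>g\<close> on it gives (g x, y), the curve for \<open>b = False\<close>.\<close>
  define Q where "Q b l = (if fst l = b then g * trunc a N l else trunc a N l)" for b l
  define w where "w \<tau> = (Abs_cstar (poly g \<tau>), curve (Q True) \<tau>)" for \<tau>
  have proj: "has_germ g w (proj_pullback f) F" if "has_germ g (curve (Q True)) f F" for f F
    using that by (simp add: has_germ_def w_def proj_pullback_def)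
  have ex: "\<exists>F. has_germ g w f F" if "f \<in> OGV" for f
    using that unfolding GV_funs_def
  proof (rule has_germ_gen_funs)
    fix f :: "cstar \<times> 'v \<Rightarrow> complex"
    assume "f \<in> {\<lambda>(g, v). of_cstar g, \<lambda>(g, v). inverse (of_cstar g)} \<union> {\<lambda>(g, v). l v | l. linear_functional scale l}"
    then consider "f = (\<lambda>(g, v). of_cstar g)" | "f = (\<lambda>(g, v). inverse (of_cstar g))"
      | l where "f = proj_pullback l" "linear_functional scale l" by (auto simp: proj_pullback_def)
    then show "\<exists>F. has_germ g w f F"
    proof cases
      case 1
      have "has_germ g w f (fps_of_poly g)" by (rule has_germ_poly) (simp add: 1 w_def)
      then show ?thesis ..
    next
      case 2
      have "has_germ g w f (inverse (fps_of_poly g))"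
        unfolding has_germ_def using g0
        by (intro exI[of _ 1] conjI allI impI) (auto simp: 2 w_def inverse_mult_eq_1 intro!: exI[of _ 1])
      then show ?thesis ..
    next
      case 3
      then show ?thesis using ex_germ[OF linear_OV, of l g "Q True"] proj by blast
    qed
  qed
  have germs: "germ g w (proj_pullback (c l)) = fps_of_poly (Q True l)"
      "germ g w (action_pullback act (c l)) = fps_of_poly (Q False l)" if l: "l \<in> L" for l
  proof -
    show "germ g w (proj_pullback (c l)) = fps_of_poly (Q True l)"
      by (rule germ_eq[OF g proj[OF has_germ_coord[OF l]]])
    show "germ g w (action_pullback act (c l)) = fps_of_poly (Q False l)"
    proof (rule germ_eq[OF g has_germ_poly])
      fix \<tau> assume t: "poly g \<tau> \<noteq> 0"
      obtain b i where "l = (b, i)" by (cases l)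
      then show "action_pullback act (c l) (w \<tau>) = poly (Q False l) \<tau>"
        using t l by (cases b) (simp_all add: action_pullback_def w_def c_False c_True curve_def c_vec Q_def)
    qed
  qed
  have eval: "curve_eval g w (psubst (\<lambda>(f, k). pvar (\<psi> f, k)) (iota q)) = peval a (arc_scale b g q)"
    if \<psi>: "\<And>l. l \<in> L \<Longrightarrow> germ g w (\<psi> (c l)) = fps_of_poly (Q b l)" for \<psi> b
    unfolding curve_eval_def iota_def arc_scale_def peval_psubst
  proof (rule psub_cong)
    fix v assume v: "v \<in> pvars q"
    obtain b' i k where vb: "v = ((b', i), k)" by (metis prod.collapse)
    have L: "(b', i) \<in> L" using q v by (auto simp: valid_def vb)
    have k: "k \<le> N" using N[OF v] by (simp add: vb)
    show "peval (\<lambda>v. peval (\<lambda>(f, k). fps_nth (germ g w f) k) (case v of (f, k) \<Rightarrow> pvar (\<psi> f, k)))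
        (case v of (l, k) \<Rightarrow> pvar (c l, k)) =
      peval a (case v of (x, k) \<Rightarrow> (case x of (b', i) \<Rightarrow> \<lambda>k.
        if b' = b then \<Sum>u\<le>k. pconst (coeff g u) * pvar ((b', i), k - u) else pvar ((b', i), k)) k)"
      using k by (simp add: vb \<psi>[OF L] Q_def coeff_trunc coeff_mult_trunc)
  qed
  have "GV.acl (action.pr (iota q)) = GV.acl (proj.pr (iota q))"
    using inv by (simp add: arc_invariants_def action.arc_map_acl proj.arc_map_acl iota_P)
  then have "action.pr (iota q) - proj.pr (iota q) \<in> GV.J"
    by (simp add: GV.acl_eq_iff action.pr_P proj.pr_P iota_P)
  then have "curve_eval g w (action.pr (iota q) - proj.pr (iota q)) = 0"
    by (intro GV.curve_eval_J[OF g ex])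
  then have "curve_eval g w (action.pr (iota q)) = curve_eval g w (proj.pr (iota q))"
    by (simp add: curve_eval_def)
  then show "peval a (arc_scale False g q) = peval a (arc_scale True g q)"
    unfolding action.pr_def proj.pr_def
    by (simp add: eval[where b = False and \<psi> = "action_pullback act", OF germs(2)]
        eval[where b = True and \<psi> = proj_pullback, OF germs(1)])
qed

subsection \<open>The comparison map\<close>

abbreviation "AZ \<equiv> arc_quotient scale act"
abbreviation "AI \<equiv> arc_invariants scale act"

lemma AZ_simps:
  "carrier AZ = Z.acl ` Z.P" "\<one>\<^bsub>AZ\<^esub> = Z.acl 1" "\<zero>\<^bsub>AZ\<^esub> = Z.acl 0"
  "p \<in> Z.P \<Longrightarrow> q \<in> Z.P \<Longrightarrow> Z.acl p \<otimes>\<^bsub>AZ\<^esub> Z.acl q = Z.acl (p * q)"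
  "p \<in> Z.P \<Longrightarrow> q \<in> Z.P \<Longrightarrow> Z.acl p \<oplus>\<^bsub>AZ\<^esub> Z.acl q = Z.acl (p + q)"
  by (simp_all add: arc_quotient_def Z.carrier_arc_ring Z.arc_ring_simps)

lemma AI_simps:
  "carrier AI \<subseteq> V.acl ` V.P" "\<one>\<^bsub>AI\<^esub> = V.acl 1"
  "p \<in> V.P \<Longrightarrow> q \<in> V.P \<Longrightarrow> V.acl p \<otimes>\<^bsub>AI\<^esub> V.acl q = V.acl (p * q)"
  "p \<in> V.P \<Longrightarrow> q \<in> V.P \<Longrightarrow> V.acl p \<oplus>\<^bsub>AI\<^esub> V.acl q = V.acl (p + q)"
  by (auto simp: arc_invariants_def arc_V_def V.carrier_arc_ring V.arc_ring_simps)

lemma p_arc_acl: "p \<in> Z.P \<Longrightarrow> p_arc scale (Z.acl p) = V.acl p"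
  unfolding p_arc_def by (subst incl.arc_map_acl) (auto simp: incl.pr_def case_prod_unfold)

lemma acl_in_AI:
  assumes "p \<in> Z.P"
  shows "V.acl p \<in> carrier AI"
proof -
  have p: "p \<in> V.P" using assms Z_P_subset by blast
  have "action_pullback act f = proj_pullback f" if "f \<in> OZ" for f
    using that by (auto simp: invariant_funs_def action_pullback_def proj_pullback_def)
  then have "action.pr p = proj.pr p"
    unfolding action.pr_def proj.pr_def by (intro psub_cong) (use assms in \<open>fastforce simp: Z.P_def\<close>)
  then show ?thesis
    using p by (simp add: arc_invariants_def arc_V_def V.carrier_arc_ring action.arc_map_acl proj.arc_map_acl)
qed

lemma acl_iota_phi: "V.acl (iota (phi r)) = p_arc scale (Z.acl (kappa r))"
proof -
  have "V.acl (kappa r) = V.acl (iota (phi r))"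
    using kappa_iota iota_P kappa_P Z_P_subset by (subst V.acl_eq_iff) auto
  then show ?thesis by (simp add: p_arc_acl kappa_P)
qed

lemma ex_valid:
  assumes "p \<in> V.P"
  obtains q where "valid q" "V.acl (iota q) = V.acl p"
proof -
  obtain q where q: "pvars q \<subseteq> L \<times> UNIV" "p - iota q \<in> V.J"
    using reduce_to_generators[OF V_eq assms] unfolding iota_def by blast
  show ?thesis
  proof (rule that[of q])
    show "valid q" using q(1) by (simp add: valid_def)
    show "V.acl (iota q) = V.acl p"
      using V.J_minus_commute[OF q(2)] by (simp add: V.acl_eq_iff iota_P assms)
  qed
qed

lemma acl_iota_inject:
  assumes "valid q" "valid q'" "V.acl (iota q) = V.acl (iota q')"
  shows "q = q'"
proof -
  have "iota (q - q') \<in> V.J" using assms(3) by (simp add: V.acl_eq_iff iota_P) (simp add: iota_def)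
  moreover have "valid (q - q')" using assms(1,2) by (simp add: valid_def pvars_diff_subset)
  ultimately have "q - q' = 0" by (intro iota_J_eq_0)
  then show ?thesis by simp
qed

lemma valid_phi:
  assumes "pvars r \<subseteq> Lz \<times> UNIV"
  shows "valid (phi r)"
  using assms
proof (induction r rule: cpoly_induct)
  case (var v)
  then show ?case
  proof -
    obtain i j k where v: "v = ((i, j), k)" by (metis prod.collapse)
    have "valid (\<Sum>u\<le>k. pvar ((False, i), u) * pvar ((True, j), k - u))"
      unfolding valid_def
      by (rule order_trans[OF pvars_sum], intro UN_least pvars_mult_subset) (use var v in \<open>auto simp: Lz_def\<close>)
    then show ?thesis by (simp add: v phi_def)
  qed
qed (auto simp: valid_def phi_def pvars_add_subset pvars_mult_subset)

text \<open>A difference in the kernel is represented by some \<open>kappa r\<close>. Independence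
  of the arc coordinates gives \<open>phi r = 0\<close>, so \<open>r\<close> is a combination of
  multiples of minors, which already vanish in the arc ring of Z.\<close>

lemma p_arc_inj: "inj_on (p_arc scale) (carrier AZ)"
proof (rule inj_onI)
  fix U W assume "U \<in> carrier AZ" "W \<in> carrier AZ" and e: "p_arc scale U = p_arc scale W"
  then obtain p p' where p: "p \<in> Z.P" "U = Z.acl p" "p' \<in> Z.P" "W = Z.acl p'" by (auto simp: AZ_simps)
  then have "p - p' \<in> V.J" using e Z_P_subset by (simp add: p_arc_acl V.acl_eq_iff subset_iff)
  moreover obtain r where r: "pvars r \<subseteq> Lz \<times> UNIV" "(p - p') - kappa r \<in> Z.J"
    using reduce_to_generators[OF OZ_eq, of "p - p'"] p by (auto simp: kappa_def Z.P_closed)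
  moreover have "kappa r - (p - p') \<in> V.J" using Z.J_minus_commute[OF r(2)] Z_J_subset by blast
  ultimately have "kappa r \<in> V.J" using V.J_add[of "kappa r - (p - p')" "p - p'"] by simp
  then have "iota (phi r) \<in> V.J"
    using V.J_add[OF V.J_minus_commute[OF kappa_iota[of r]]] by fastforce
  then have "phi r = 0" by (intro iota_J_eq_0 valid_phi r)
  then have "kappa r \<in> Z.J" by (intro kappa_span kernel_phi)
  then have "p - p' \<in> Z.J" using Z.J_add[OF r(2)] by fastforce
  then show "U = W" using p by (simp add: Z.acl_eq_iff)
qed

lemma p_arc_iso: "p_arc scale \<in> ring_iso AZ AI"
  unfolding ring_iso_def
proof (intro CollectI conjI)
  show "p_arc scale \<in> ring_hom AZ AI"
    using Z_P_subset
    by (intro ring_hom_memI) (auto simp: AZ_simps p_arc_acl acl_in_AI AI_simps Z.P_closed subset_iff)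
  have "carrier AI \<subseteq> p_arc scale ` carrier AZ"
  proof
    fix F assume F: "F \<in> carrier AI"
    then obtain p where p: "p \<in> V.P" "F = V.acl p" using AI_simps(1) by blast
    obtain q where q: "valid q" "V.acl (iota q) = F" using ex_valid[OF p(1)] p(2) by metis
    then have "arc_invariant q" using F by (intro arc_invariant_iota) auto
    then obtain r where "q = phi r" using arc_invariant_in_range_phi by blast
    then have "F = p_arc scale (Z.acl (kappa r))" using q(2) acl_iota_phi by simp
    then show "F \<in> p_arc scale ` carrier AZ" using kappa_P by (auto simp: AZ_simps)
  qed
  then show "bij_betw (p_arc scale) (carrier AZ) (carrier AI)"
    unfolding bij_betw_def using p_arc_inj by (auto simp: AZ_simps p_arc_acl acl_in_AI)
qed

text \<open>The comparison map followed by the inverse of \<open>iota\<close>: an embedding into a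
  polynomial ring, where divisibility can be studied.\<close>

definition coords :: "(nat \<times> (('v \<Rightarrow> complex) \<times> nat) cpoly set) set \<Rightarrow> xy_poly" where
  "coords U = (SOME q. valid q \<and> V.acl (iota q) = p_arc scale U)"

lemma coords:
  assumes "U \<in> carrier AZ"
  shows "valid (coords U)" "V.acl (iota (coords U)) = p_arc scale U"
proof -
  obtain p where p: "p \<in> Z.P" "U = Z.acl p" using assms by (auto simp: AZ_simps)
  have "p \<in> V.P" using p(1) Z_P_subset by blast
  then obtain q where "valid q" "V.acl (iota q) = V.acl p" by (rule ex_valid)
  then have "valid q \<and> V.acl (iota q) = p_arc scale U" by (simp only: p p_arc_acl simp_thms)
  then have "valid (coords U) \<and> V.acl (iota (coords U)) = p_arc scale U"
    unfolding coords_def by (rule someI)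
  then show "valid (coords U)" "V.acl (iota (coords U)) = p_arc scale U" by blast+
qed

lemma coords_eqI:
  assumes "U \<in> carrier AZ" "valid q" "V.acl (iota q) = p_arc scale U"
  shows "coords U = q"
  using coords[OF assms(1)] assms by (intro acl_iota_inject) auto

lemma coords_arc_invariant:
  assumes "U \<in> carrier AZ"
  shows "arc_invariant (coords U)"
proof (rule arc_invariant_iota[OF coords(1)[OF assms]])
  show "V.acl (iota (coords U)) \<in> carrier AI"
    unfolding coords(2)[OF assms] using p_arc_iso assms by (auto simp: ring_iso_def ring_hom_def)
qed

lemma coords_add_mult:
  assumes "U \<in> carrier AZ" "W \<in> carrier AZ"
  shows "U \<oplus>\<^bsub>AZ\<^esub> W \<in> carrier AZ" "U \<otimes>\<^bsub>AZ\<^esub> W \<in> carrier AZ"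
    "coords (U \<oplus>\<^bsub>AZ\<^esub> W) = coords U + coords W" "coords (U \<otimes>\<^bsub>AZ\<^esub> W) = coords U * coords W"
proof -
  show closed: "U \<oplus>\<^bsub>AZ\<^esub> W \<in> carrier AZ" "U \<otimes>\<^bsub>AZ\<^esub> W \<in> carrier AZ"
    using assms by (auto simp: AZ_simps Z.P_closed)
  note hom = ring_hom_add[of "p_arc scale" AZ AI, OF _ assms] ring_hom_mult[of "p_arc scale" AZ AI, OF _ assms]
  have h: "p_arc scale \<in> ring_hom AZ AI" using p_arc_iso by (simp add: ring_iso_def)
  note c = coords[OF assms(1)] coords[OF assms(2)]
  show "coords (U \<oplus>\<^bsub>AZ\<^esub> W) = coords U + coords W"
  proof (rule coords_eqI[OF closed(1)])
    have "V.acl (iota (coords U + coords W)) = V.acl (iota (coords U)) \<oplus>\<^bsub>AI\<^esub> V.acl (iota (coords W))"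
      by (simp only: iota_add AI_simps(4)[OF iota_P iota_P])
    then show "V.acl (iota (coords U + coords W)) = p_arc scale (U \<oplus>\<^bsub>AZ\<^esub> W)"
      by (simp only: hom(1)[OF h] c)
  qed (use c(1,3) in \<open>simp add: valid_def pvars_add_subset\<close>)
  show "coords (U \<otimes>\<^bsub>AZ\<^esub> W) = coords U * coords W"
  proof (rule coords_eqI[OF closed(2)])
    have "V.acl (iota (coords U * coords W)) = V.acl (iota (coords U)) \<otimes>\<^bsub>AI\<^esub> V.acl (iota (coords W))"
      by (simp only: iota_mult AI_simps(3)[OF iota_P iota_P])
    then show "V.acl (iota (coords U * coords W)) = p_arc scale (U \<otimes>\<^bsub>AZ\<^esub> W)"
      by (simp only: hom(2)[OF h] c)
  qed (use c(1,3) in \<open>simp add: valid_def pvars_mult_subset\<close>)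
qed

lemma domain_embedding_coords: "domain_embedding AZ coords"
proof
  show "inj_on coords (carrier AZ)"
    using p_arc_inj coords(2) unfolding inj_on_def by metis
  show one: "\<one>\<^bsub>AZ\<^esub> \<in> carrier AZ" and zero: "\<zero>\<^bsub>AZ\<^esub> \<in> carrier AZ" by (simp_all add: AZ_simps Z.P_closed)
  show "coords \<one>\<^bsub>AZ\<^esub> = 1"
    by (rule coords_eqI[OF one]) (simp_all add: valid_def iota_def AZ_simps p_arc_acl Z.P_closed)
  show "coords \<zero>\<^bsub>AZ\<^esub> = 0"
    by (rule coords_eqI[OF zero]) (simp_all add: valid_def iota_def AZ_simps p_arc_acl Z.P_closed)
  show "\<exists>b\<in>carrier AZ. coords b = - coords a" if a: "a \<in> carrier AZ" for a
  proof
    have m: "Z.acl (pconst (- 1)) \<in> carrier AZ" by (simp add: AZ_simps Z.P_closed)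
    have "coords (Z.acl (pconst (- 1))) = pconst (- 1)"
      by (rule coords_eqI[OF m]) (simp_all add: valid_def iota_def p_arc_acl Z.P_closed)
    then show "coords (Z.acl (pconst (- 1)) \<otimes>\<^bsub>AZ\<^esub> a) = - coords a"
      using coords_add_mult(4)[OF m a] by (simp add: pconst_uminus)
    show "Z.acl (pconst (- 1)) \<otimes>\<^bsub>AZ\<^esub> a \<in> carrier AZ" by (rule coords_add_mult(2)[OF m a])
  qed
qed (rule coords_add_mult; assumption)+

lemma AZ_integrally_closed: "integrally_closed AZ"
proof -
  show ?thesis
  proof (rule domain_embedding.integrally_closedI[OF domain_embedding_coords])
    fix a b cs
    assume a: "a \<in> carrier AZ" and b: "b \<in> carrier AZ" and b0: "coords b \<noteq> 0"
      and "coords a ^ length cs + homog_eval (coords a) (coords b) cs = 0"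
    then have "coords b dvd coords a" by (intro cpoly_integrally_closed)
    then obtain q0 where q0: "coords a = coords b * q0" ..
    \<comment> \<open>A priori the quotient involves variables outside \<open>L\<close>; setting
      them to 0 fixes \<open>coords a\<close> and \<open>coords b\<close> and yields a quotient
      without them.\<close>
    let ?ret = "psubst (\<lambda>v. if fst v \<in> L then pvar v else 0) :: xy_poly \<Rightarrow> xy_poly"
    define q where "q = ?ret q0"
    have ret: "?ret p = p" if "valid p" for p
    proof -
      have "?ret p = psubst pvar p" by (rule psub_cong) (use that in \<open>auto simp: valid_def\<close>)
      then show ?thesis by simp
    qed
    have "coords a = ?ret (coords a)" by (rule ret[OF coords(1)[OF a], symmetric])
    also have "\<dots> = ?ret (coords b) * q" by (simp only: q0 q_def psubst_simps)
    also have "?ret (coords b) = coords b" by (rule ret[OF coords(1)[OF b]])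
    finally have q: "coords a = coords b * q" .
    have "valid q"
      unfolding valid_def q_def by (rule order_trans[OF pvars_psubst]) (auto split: if_splits)
    have "arc_invariant q"
      unfolding arc_invariant_def
    proof (intro allI impI)
      fix g :: "complex poly" assume g: "coeff g 0 \<noteq> 0"
      have "arc_scale False g (coords b) * arc_scale False g q = arc_scale True g (coords b) * arc_scale True g q"
        using arc_invariantD[OF coords_arc_invariant[OF a] g] by (simp only: q arc_scale_mult)
      moreover have "arc_scale False g (coords b) = arc_scale True g (coords b)"
        by (rule arc_invariantD[OF coords_arc_invariant[OF b] g])
      moreover have "arc_scale True g (coords b) \<noteq> 0" using arc_scale_eq_0D[OF g] b0 by blast
      ultimately show "arc_scale False g q = arc_scale True g q" by (metis mult_left_cancel)
    qed
    then obtain r where r: "q = phi r" using arc_invariant_in_range_phi by blast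
    show "\<exists>q\<in>carrier AZ. coords a = coords b * coords q"
    proof
      show k: "Z.acl (kappa r) \<in> carrier AZ" using kappa_P by (simp add: AZ_simps)
      have "coords (Z.acl (kappa r)) = q"
        by (rule coords_eqI[OF k \<open>valid q\<close>]) (simp add: r acl_iota_phi)
      then show "coords a = coords b * coords (Z.acl (kappa r))" by (simp only: q)
    qed
  qed
qed

end

theorem theorem5p1:
  fixes scale :: "complex \<Rightarrow> 'v::ab_group_add \<Rightarrow> 'v"
    and act :: "cstar \<Rightarrow> 'v \<Rightarrow> 'v"
  assumes "cstar_module scale act"
    and "\<And>n. is_weight scale act n \<Longrightarrow> n = 1 \<or> n = - 1"
  shows "p_arc scale \<in> ring_iso (arc_quotient scale act) (arc_invariants scale act) \<and>
    integrally_closed (arc_quotient scale act)"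
proof -
  interpret cstar_module scale act by (rule assms(1))
  obtain L c vec where "weight_coords scale act L c vec"
    using weight_coordinates[OF assms(2)] by blast
  then interpret weight_coords scale act L c vec .
  show ?thesis using p_arc_iso AZ_integrally_closed by blast
qed

end
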